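(* Let $N \ge 1$ be an integer, $1 \le p < +\infty$, $-1 < \gamma < 0$, and let $u \in L^p(\mathbb{R}^N)$. Then $$\frac{K_{N,p}}{\gamma + 2p}\, \Phi(u) \le \limsup_{\lambda \to 0_+} \Phi_\lambda(u) + \limsup_{\lambda \to +\infty} \Phi_\lambda(u).$$ In particular, if the right-hand side is finite, then $u \in W^{1,p}(\mathbb{R}^N)$ if $p>1$, and $u \in BV(\mathbb{R}^N)$ if $p=1$.
   Context: Functions are real-valued. For $u \in L^p(\mathbb{R}^N)$: if $p>1$, $\Phi(u) = \int_{\mathbb{R}^N} |\nabla u|^p\,dx$ when $u \in W^{1,p}(\mathbb{R}^N)$ and $\Phi(u)=+\infty$ otherwise; if $p=1$, $\Phi(u) = \|\nabla u\|_{\mathcal{M}(\mathbb{R}^N)} := \sup\{ |\int_{\mathbb{R}^N} u\, \mathrm{div}\,\varphi\,dx| : \varphi \in C_c^\infty(\mathbb{R}^N;\mathbb{R}^N),\ \|\varphi\|_{L^\infty} \le 1\}$ (the total variation), which is $+\infty$ when $u \notin BV(\mathbb{R}^N)$. $K_{N,p} = \int_{\mathbb{S}^{N-1}} |e\cdot\sigma|^p\,d\sigma$ for any $e \in \mathbb{S}^{N-1}$ (surface measure on the unit sphere; for $N=1$ counting measure on $\{\pm 1\}$). For $\lambda>0$, and for the given $p$ and $\gamma$, $$\Phi_\lambda(u) = \lambda^p \iint_{\{(x,y)\in \mathbb{R}^N\times\mathbb{R}^N:\ |u(x)-u(y)|/|x-y|^{1+\gamma/p} > \lambda\}} |x-y|^{-N+\gamma}\,dx\,dy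 \in [0,+\infty].$$ *)

theory Defs
  imports "HOL-Analysis.Analysis"
begin

definition Lp :: "real \<Rightarrow> ('a::euclidean_space \<Rightarrow> 'b::euclidean_space) \<Rightarrow> bool" where
  "Lp p f \<longleftrightarrow> f \<in> borel_measurable lebesgue \<and> integrable lebesgue (\<lambda>x. norm (f x) powr p)"

definition locally_integrable :: "('a::euclidean_space \<Rightarrow> 'b::euclidean_space) \<Rightarrow> bool" where
  "locally_integrable f \<longleftrightarrow> (\<forall>K. compact K \<longrightarrow> f absolutely_integrable_on K)"

definition partial_deriv :: "'n::finite \<Rightarrow> (real^'n \<Rightarrow> 'b::real_normed_vector) \<Rightarrow> real^'n \<Rightarrow> 'b" where
  "partial_deriv i f x = frechet_derivative f (at x) (axis i 1)"

primrec C_k :: "nat \<Rightarrow> (real^'n::finite \<Rightarrow> 'b::real_normed_vector) \<Rightarrow> bool" where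
  "C_k 0 f \<longleftrightarrow> continuous_on UNIV f"
| "C_k (Suc k) f \<longleftrightarrow> (\<forall>x. f differentiable (at x)) \<and> (\<forall>i. C_k k (partial_deriv i f))"

definition test_function :: "(real^'n::finite \<Rightarrow> 'b::real_normed_vector) \<Rightarrow> bool" where
  "test_function \<phi> \<longleftrightarrow> (\<forall>k. C_k k \<phi>) \<and> compact (closure {x. \<phi> x \<noteq> 0})"

definition divergence :: "(real^'n::finite \<Rightarrow> real^'n) \<Rightarrow> real^'n \<Rightarrow> real" where
  "divergence \<phi> x = (\<Sum>i\<in>UNIV. partial_deriv i (\<lambda>y. \<phi> y $ i) x)"

definition has_weak_gradient :: "(real^'n::finite \<Rightarrow> real) \<Rightarrow> (real^'n \<Rightarrow> real^'n) \<Rightarrow> bool" where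
  "has_weak_gradient u G \<longleftrightarrow> locally_integrable u \<and> locally_integrable G \<and>
     (\<forall>\<phi> :: real^'n \<Rightarrow> real. test_function \<phi> \<longrightarrow>
        (\<forall>i. (LINT x|lebesgue. u x * partial_deriv i \<phi> x) = - (LINT x|lebesgue. G x $ i * \<phi> x)))"

text \<open>A weak gradient is unique up to a null set, so integrals of it do not depend on the choice.\<close>

definition weak_gradient :: "(real^'n::finite \<Rightarrow> real) \<Rightarrow> real^'n \<Rightarrow> real^'n" where
  "weak_gradient u = (SOME G. has_weak_gradient u G)"

definition sobolev_W1 :: "real \<Rightarrow> (real^'n::finite \<Rightarrow> real) \<Rightarrow> bool" where
  "sobolev_W1 p u \<longleftrightarrow> Lp p u \<and> (\<exists>G. has_weak_gradient u G \<and> Lp p G)"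

definition total_variation :: "(real^'n::finite \<Rightarrow> real) \<Rightarrow> ennreal" where
  "total_variation u =
     (SUP \<phi> \<in> {\<phi> :: real^'n \<Rightarrow> real^'n. test_function \<phi> \<and> (AE x in lebesgue. norm (\<phi> x) \<le> 1)}.
        ennreal \<bar>LINT x|lebesgue. u x * divergence \<phi> x\<bar>)"

definition BV :: "(real^'n::finite \<Rightarrow> real) \<Rightarrow> bool" where
  "BV u \<longleftrightarrow> Lp 1 u \<and> total_variation u < \<infinity>"

definition Phi :: "real \<Rightarrow> (real^'n::finite \<Rightarrow> real) \<Rightarrow> ennreal" where
  "Phi p u =
     (if p = 1 then total_variation u
      else if sobolev_W1 p u then \<integral>\<^sup>+x. ennreal (norm (weak_gradient u x) powr p) \<partial>lebesgue
      else \<infinity>)"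

text \<open>The surface measure of a Borel set \<open>A\<close> of the unit sphere is \<open>N\<close> times the volume of the
  cone \<open>{r \<sigma> | 0 < r \<le> 1, \<sigma> \<in> A}\<close>; for \<open>N = 1\<close> this is the counting measure on \<open>{-1, 1}\<close>.\<close>

definition sphere_measure :: "('a::euclidean_space) measure" where
  "sphere_measure =
     distr (scale_measure (of_nat DIM('a)) (restrict_space lborel (cball 0 1 - {0})))
       (restrict_space borel (sphere 0 1)) (\<lambda>x. x /\<^sub>R norm x)"

lemma emeasure_sphere_measure:
  fixes A :: "'a::euclidean_space set"
  assumes "A \<in> sets borel" "A \<subseteq> sphere 0 1"
  shows "emeasure sphere_measure A =
    of_nat DIM('a) * emeasure lborel {r *\<^sub>R \<sigma> | r \<sigma>. 0 < r \<and> r \<le> 1 \<and> \<sigma> \<in> A}"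
proof -
  let ?B = "cball 0 1 - {0::'a}" and ?f = "\<lambda>x::'a. x /\<^sub>R norm x"
  have B: "?B \<in> sets borel" by measurable
  have "?f \<in> restrict_space borel ?B \<rightarrow>\<^sub>M restrict_space borel (sphere 0 1)"
    by (rule measurable_restrict_space3) auto
  then have f: "?f \<in> scale_measure (of_nat DIM('a)) (restrict_space lborel ?B)
      \<rightarrow>\<^sub>M restrict_space borel (sphere 0 1)"
    by (subst measurable_cong_sets[OF _ refl, where M' = "restrict_space borel ?B"])
       (simp_all cong: sets_restrict_space_cong)
  have A: "A \<in> sets (restrict_space borel (sphere 0 1))"
    using assms by (auto simp: sets_restrict_space)
  have eq: "?f -` A \<inter> ?B = {r *\<^sub>R \<sigma> | r \<sigma>. 0 < r \<and> r \<le> 1 \<and> \<sigma> \<in> A}" (is "?L = ?R")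
  proof (intro set_eqI iffI)
    fix x assume x: "x \<in> ?L"
    then have "x = norm x *\<^sub>R ?f x" by auto
    with x show "x \<in> ?R"
      by (intro CollectI exI[of _ "norm x"] exI[of _ "?f x"]) auto
  next
    fix x assume "x \<in> ?R"
    then obtain r \<sigma> where "x = r *\<^sub>R \<sigma>" "0 < r" "r \<le> 1" "\<sigma> \<in> A" by auto
    moreover from this assms have "norm \<sigma> = 1" by auto
    ultimately show "x \<in> ?L" by auto
  qed
  show ?thesis
    unfolding sphere_measure_def
    using B by (simp add: emeasure_distr[OF f A] space_scale_measure space_restrict_space eq[symmetric]
        emeasure_restrict_space)
qed

definition K_const :: "real^'n::finite \<Rightarrow> real \<Rightarrow> real" where
  "K_const e p = (LINT \<sigma>|sphere_measure. \<bar>e \<bullet> \<sigma>\<bar> powr p)"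

definition Phi_lam :: "real \<Rightarrow> real \<Rightarrow> real \<Rightarrow> (real^'n::finite \<Rightarrow> real) \<Rightarrow> ennreal" where
  "Phi_lam p \<gamma> l u = ennreal (l powr p) *
     (\<integral>\<^sup>+(x, y). ennreal (norm (x - y) powr (- real CARD('n) + \<gamma>)) *
        indicator {(x, y). \<bar>u x - u y\<bar> / norm (x - y) powr (1 + \<gamma> / p) > l} (x, y)
        \<partial>(lebesgue \<Otimes>\<^sub>M lebesgue))"

end

theory Submission
  imports Defs
begin

text \<open>Write \<open>Q = \<bar>u(x + h) - u(x)\<bar> / \<bar>h\<bar>\<^bsup>1 + \<gamma>/p\<^esup>\<close>. Integrating \<open>\<Phi>\<^sub>\<lambda>(u)\<close> against the weight
  \<open>\<delta> \<lambda>\<^bsup>\<delta> - 1\<^esup> max(1, \<lambda>)\<^bsup>-2\<delta>\<^esup>\<close>, which has mass one on \<open>(0, 1)\<close> and on \<open>(1, \<infinity>)\<close> and concentrates at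
  \<open>0\<close> and \<open>\<infinity>\<close> as \<open>\<delta> \<rightarrow> 0\<close>, bounds \<open>\<delta>/(p + \<delta>)\<close> times the integral of
  \<open>Q\<^bsup>p + \<delta>\<^esup> max(1, Q)\<^bsup>-2\<delta>\<^esup> \<bar>h\<bar>\<^bsup>\<gamma> - N\<^esup>\<close> by the sum of the two upper limits, up to an error that vanishes
  with \<open>\<delta>\<close>. Truncating \<open>u\<close> only decreases \<open>Q\<close>, and for bounded \<open>u\<close> and \<open>\<bar>h\<bar> \<le> 1\<close> one has
  \<open>max(1, Q) \<le> C \<bar>h\<bar>\<^bsup>-1 - \<gamma>/p\<^esup>\<close>. What remains is a functional of Bourgain--Brezis--Mironescu type with
  kernel \<open>\<bar>h\<bar>\<^bsup>(2 + \<gamma>/p)\<delta> - N\<^esup>\<close>; it is convex in \<open>u\<close>, so it decreases under mollification, and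
  for a differentiable function Fatou's lemma bounds its lower limit from below by
  \<open>K / (\<gamma> + 2p)\<close> times the integral of \<open>\<bar>\<nabla>u\<bar>\<^sup>p\<close>. Finally the truncations and
  mollifications are removed: by duality for \<open>p = 1\<close>, and for \<open>p > 1\<close> by
  the uniform convexity of \<open>L\<^sup>p\<close>.\<close>

section \<open>Inequalities and integrals\<close>

text \<open>The constant is a product of three limits. Integration over the level gives the factor
  \<open>\<delta> / (p + \<delta>)\<close>; the radial integral of the kernel over the unit ball is
  of order 1/((2 + \<gamma>/p) \<delta>), so \<delta> cancels and 1/p times 1/(2 + \<gamma>/p), that
  is 1/(\<gamma> + 2p), remains; the directions give K. The weight has to be bent at \<lambda> = 1
  because the pure power \<open>\<lambda> powr (\<delta> - 1)\<close> has infinite mass near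
  infinity. The price is the factor max(1, Q)^(-2\<delta>), which for unbounded u has no lower bound
  in terms of h alone; this forces the truncation. The truncation level enters only through a
  constant raised to the power -2\<delta>, which tends to 1, so the bound obtained is uniform in the
  level. Mollification comes before Fatou's lemma because pointwise lower limits of difference
  quotients are informative only where the function is differentiable. For p = 1 the gradients of
  the approximants may concentrate to a measure, so there the total variation is bounded directly
  and no limit gradient is constructed.\<close>

lemma powr_above_tangent:
  fixes t m q :: real
  assumes "0 \<le> t" "0 \<le> m" "1 \<le> q"
  shows "m powr q + q * m powr (q - 1) * (t - m) \<le> t powr q"
proof (cases "t = 0 \<or> m = 0")
  case True
  then show ?thesis
  proof
    assume "t = 0"
    have "m powr (q - 1) * m = m powr q"
      using assms by (cases "m = 0") (auto simp: powr_diff)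
    then have "m powr q + q * m powr (q - 1) * (0 - m) = (1 - q) * m powr q"
      by (simp add: algebra_simps)
    also have "\<dots> \<le> 0" using assms by (simp add: mult_nonpos_nonneg)
    finally show ?thesis using \<open>t = 0\<close> by simp
  qed (use assms in auto)
next
  case False
  then have p: "t > 0" "m > 0" using assms by auto
  \<comment> \<open>Young's inequality with weights 1/q and 1 - 1/q, applied to the two q-th powers,
    is the tangent inequality divided by q.\<close>
  have "(t powr q) powr (1/q) * (m powr q) powr (1 - 1/q) \<le> 1/q * t powr q + (1 - 1/q) * m powr q"
    using assms p by (intro Youngs_inequality_0) auto
  moreover have "(t powr q) powr (1/q) = t" using assms p by (simp add: powr_powr)
  moreover have "(m powr q) powr (1 - 1/q) = m powr (q - 1)"
    using assms p by (simp add: powr_powr right_diff_distrib)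
  moreover have "m powr (q - 1) * m = m powr q"
    using p by (simp add: powr_diff)
  ultimately have "q * (t * m powr (q - 1)) \<le> q * (1/q * t powr q + (1 - 1/q) * m powr q)"
    using assms by (intro mult_left_mono) auto
  also have "\<dots> = t powr q + (q - 1) * m powr q" using assms by (simp add: field_simps)
  finally show ?thesis using \<open>m powr (q - 1) * m = m powr q\<close> by (simp add: algebra_simps)
qed

text \<open>Jensen's inequality for the probability density \<rho>: the tangent to the q-th power at
  the weighted mean \<open>m\<close> of |X| is integrated against \<rho>, where its linear term
  cancels. Since the right-hand side is an \<open>ennreal\<close>, only the case of a finite
  integral requires an argument.\<close>

lemma powr_integral_le:
  fixes X \<rho> :: "'a \<Rightarrow> real" and q :: real
  assumes q: "1 \<le> q" and \<rho>: "\<And>z. 0 \<le> \<rho> z" "integrable M \<rho>" "(\<integral>z. \<rho> z \<partial>M) = 1"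
    and X: "integrable M (\<lambda>z. \<rho> z * X z)" and Xm[measurable]: "X \<in> borel_measurable M"
  shows "ennreal (\<bar>\<integral>z. \<rho> z * X z \<partial>M\<bar> powr q) \<le> (\<integral>\<^sup>+z. ennreal (\<rho> z * \<bar>X z\<bar> powr q) \<partial>M)"
proof (cases "(\<integral>\<^sup>+z. ennreal (\<rho> z * \<bar>X z\<bar> powr q) \<partial>M) = \<infinity>")
  case False
  have [measurable]: "\<rho> \<in> borel_measurable M" using \<rho> by auto
  have int: "integrable M (\<lambda>z. \<rho> z * \<bar>X z\<bar> powr q)"
    using False \<rho> by (intro integrableI_nonneg) (auto simp: top.not_eq_extremum)
  have aX: "integrable M (\<lambda>z. \<rho> z * \<bar>X z\<bar>)"
    using integrable_abs[OF X] \<rho> by (simp add: abs_mult)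
  define m where "m = (\<integral>z. \<rho> z * \<bar>X z\<bar> \<partial>M)"
  have m0: "0 \<le> m" unfolding m_def using \<rho> by (intro integral_nonneg_AE) auto
  have "\<bar>\<integral>z. \<rho> z * X z \<partial>M\<bar> \<le> (\<integral>z. \<bar>\<rho> z * X z\<bar> \<partial>M)" by (rule integral_abs_bound)
  also have "\<dots> = m" unfolding m_def using \<rho> by (simp add: abs_mult)
  finally have "\<bar>\<integral>z. \<rho> z * X z \<partial>M\<bar> powr q \<le> m powr q"
    using q by (intro powr_mono2) auto
  also have "m powr q = (\<integral>z. \<rho> z * (m powr q - q * m powr (q - 1) * m) + q * m powr (q - 1) * (\<rho> z * \<bar>X z\<bar>) \<partial>M)"
    using \<rho> aX by (subst Bochner_Integration.integral_add) (auto simp: m_def[symmetric])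
  also have "\<dots> \<le> (\<integral>z. \<rho> z * \<bar>X z\<bar> powr q \<partial>M)"
  proof (rule integral_mono)
    show "integrable M (\<lambda>z. \<rho> z * (m powr q - q * m powr (q - 1) * m) + q * m powr (q - 1) * (\<rho> z * \<bar>X z\<bar>))"
      using \<rho> aX by auto
    fix z
    have "\<rho> z * (m powr q + q * m powr (q - 1) * (\<bar>X z\<bar> - m)) \<le> \<rho> z * \<bar>X z\<bar> powr q"
      using \<rho> m0 q by (intro mult_left_mono powr_above_tangent) auto
    then show "\<rho> z * (m powr q - q * m powr (q - 1) * m) + q * m powr (q - 1) * (\<rho> z * \<bar>X z\<bar>) \<le> \<rho> z * \<bar>X z\<bar> powr q"
      by (simp add: algebra_simps)
  qed (rule int)
  finally have "ennreal (\<bar>\<integral>z. \<rho> z * X z \<partial>M\<bar> powr q) \<le> ennreal (\<integral>z. \<rho> z * \<bar>X z\<bar> powr q \<partial>M)"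
    by (rule ennreal_leI)
  also have "\<dots> = (\<integral>\<^sup>+z. ennreal (\<rho> z * \<bar>X z\<bar> powr q) \<partial>M)"
    using \<rho> by (intro nn_integral_eq_integral[symmetric] int) auto
  finally show ?thesis .
qed simp

lemma nn_integral_lborel_shift:
  fixes f :: "'a::euclidean_space \<Rightarrow> ennreal"
  assumes [measurable]: "f \<in> borel_measurable borel"
  shows "(\<integral>\<^sup>+x. f (c + x) \<partial>lborel) = (\<integral>\<^sup>+x. f x \<partial>lborel)"
  by (subst (2) lborel_distr_plus[of c, symmetric]) (simp add: nn_integral_distr)

lemma nn_integral_lborel_scale:
  fixes f :: "'a::euclidean_space \<Rightarrow> ennreal"
  assumes [measurable]: "f \<in> borel_measurable borel" and "0 < t"
  shows "(\<integral>\<^sup>+x. f x \<partial>lborel) = ennreal (t ^ DIM('a)) * (\<integral>\<^sup>+x. f (t *\<^sub>R x) \<partial>lborel)"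
  using assms
  by (subst lborel_affine[of t 0])
     (auto simp: nn_integral_density nn_integral_distr nn_integral_cmult)

lemma lborel_integral_shift:
  fixes f :: "'a::euclidean_space \<Rightarrow> 'b::{banach, second_countable_topology}"
  assumes [measurable]: "f \<in> borel_measurable borel"
  shows "(\<integral>x. f (c + x) \<partial>lborel) = (\<integral>x. f x \<partial>lborel)"
  by (subst (2) lborel_distr_plus[of c, symmetric]) (simp add: integral_distr)

lemma lborel_integrable_shift:
  fixes f :: "'a::euclidean_space \<Rightarrow> 'b::{banach, second_countable_topology}"
  assumes [measurable]: "f \<in> borel_measurable borel"
  shows "integrable lborel (\<lambda>x. f (c + x)) \<longleftrightarrow> integrable lborel f"
  by (subst (2) lborel_distr_plus[of c, symmetric]) (simp add: integrable_distr_eq)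

lemma nn_integral_powr_from_0:
  assumes "-1 < a" "0 \<le> c"
  shows "(\<integral>\<^sup>+l. ennreal (l powr a) * indicator {0..c} l \<partial>lborel) = ennreal (c powr (a + 1) / (a + 1))"
  using has_integral_powr_from_0[OF assms] by (intro nn_integral_has_integral_lebesgue') auto

lemma nn_integral_powr_to_inf:
  assumes "a < -1" "0 < c"
  shows "(\<integral>\<^sup>+l. ennreal (l powr a) * indicator {c..} l \<partial>lborel) = ennreal (- (c powr (a + 1)) / (a + 1))"
  by (intro nn_integral_has_integral_lebesgue' has_integral_powr_to_inf assms) auto

section \<open>Averaging over the level\<close>

text \<open>The integral of \<open>l powr (p + \<delta> - 1)\<close> over (0, q) is q^(p +
  \<delta>)/(p + \<delta>), and on that range the decreasing factor
  \<open>max 1 l powr (- 2 * \<delta>)\<close> is at least its value at q.\<close>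

lemma layer_cake_weight:
  fixes q p \<delta> :: real
  assumes "0 \<le> q" "1 \<le> p" "0 < \<delta>"
  shows "ennreal (\<delta> / (p + \<delta>) * q powr (p + \<delta>) * max 1 q powr (- 2 * \<delta>))
    \<le> (\<integral>\<^sup>+l. ennreal (\<delta> * l powr (\<delta> - 1) * max 1 l powr (- 2 * \<delta>) * l powr p) * indicator {0<..<q} l \<partial>lborel)"
proof -
  have "ennreal (\<delta> / (p + \<delta>) * q powr (p + \<delta>) * max 1 q powr (- 2 * \<delta>))
    = ennreal (\<delta> * max 1 q powr (- 2 * \<delta>)) * ennreal (q powr (p + \<delta> - 1 + 1) / (p + \<delta> - 1 + 1))"
    using assms by (subst ennreal_mult[symmetric]) (auto simp: field_simps)
  also have "\<dots> = (\<integral>\<^sup>+l. ennreal (\<delta> * max 1 q powr (- 2 * \<delta>)) * (ennreal (l powr (p + \<delta> - 1)) * indicator {0..q} l) \<partial>lborel)"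
    using assms by (subst nn_integral_powr_from_0[symmetric]) (auto simp: nn_integral_cmult)
  also have "\<dots> \<le> (\<integral>\<^sup>+l. ennreal (\<delta> * l powr (\<delta> - 1) * max 1 l powr (- 2 * \<delta>) * l powr p) * indicator {0<..<q} l \<partial>lborel)"
  proof (intro nn_integral_mono_AE)
    have "AE l in lborel. l \<noteq> 0 \<and> l \<noteq> q"
      using AE_lborel_singleton[of 0] AE_lborel_singleton[of q] by eventually_elim auto
    then show "AE l in lborel. ennreal (\<delta> * max 1 q powr (- 2 * \<delta>)) * (ennreal (l powr (p + \<delta> - 1)) * indicator {0..q} l)
      \<le> ennreal (\<delta> * l powr (\<delta> - 1) * max 1 l powr (- 2 * \<delta>) * l powr p) * indicator {0<..<q} l"
    proof eventually_elim
      case (elim l)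
      show ?case
      proof (cases "0 < l \<and> l < q")
        case True
        have "max 1 q powr (- 2 * \<delta>) \<le> max 1 l powr (- 2 * \<delta>)"
          using True assms by (intro powr_mono2') auto
        then have "\<delta> * max 1 q powr (- 2 * \<delta>) * l powr (p + \<delta> - 1) \<le> \<delta> * max 1 l powr (- 2 * \<delta>) * l powr (p + \<delta> - 1)"
          using assms by (intro mult_right_mono mult_left_mono) auto
        also have "\<dots> = \<delta> * l powr (\<delta> - 1) * max 1 l powr (- 2 * \<delta>) * l powr p"
          by (simp add: powr_add powr_diff)
        finally show ?thesis using True assms
          by (simp add: ennreal_mult[symmetric] mult_ac)
      next
        case False
        then show ?thesis using elim by (auto simp: indicator_def)
      qed
    qed
  qed
  finally show ?thesis .
qed

text \<open>Near 0 and near infinity the integrand is controlled by the upper limits. On the compact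
  range in between the weight is at most \<open>\<delta> / l0\<close>, and
  \<open>l powr p * F l\<close> is bounded because F is decreasing and finite at \<open>l0\<close>;
  this part therefore vanishes with \<delta>.\<close>

lemma averaging_upper:
  fixes F :: "real \<Rightarrow> ennreal" and p :: real
  assumes p: "1 \<le> p" and c: "Limsup (at_right 0) (\<lambda>l. ennreal (l powr p) * F l)
      + Limsup at_top (\<lambda>l. ennreal (l powr p) * F l) < c"
    and F: "\<And>l l'. l \<le> l' \<Longrightarrow> F l' \<le> F l" and [measurable]: "F \<in> borel_measurable borel"
  shows "\<forall>\<^sub>F \<delta> in at_right 0. (\<integral>\<^sup>+l. ennreal (\<delta> * l powr (\<delta> - 1) * max 1 l powr (- 2 * \<delta>)) *
      (ennreal (l powr p) * F l) * indicator {0<..} l \<partial>lborel) \<le> c"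
proof -
  let ?f = "\<lambda>l. ennreal (l powr p) * F l"
  let ?L0 = "Limsup (at_right 0) ?f" and ?L1 = "Limsup at_top ?f"
  obtain c' where c': "?L0 + ?L1 < c'" "c' < c" using dense[OF c] by auto
  then have "c' < \<infinity>" by (metis infinity_ennreal_def order.strict_trans2 top_greatest)
  have fin: "?L0 + ?L1 < \<infinity>" using c' \<open>c' < \<infinity>\<close> by (meson order.strict_trans)
  obtain A0 where A0: "?L0 = ennreal A0" "0 \<le> A0" using fin by (cases ?L0) (auto simp: top_unique)
  obtain B0 where B0: "?L1 = ennreal B0" "0 \<le> B0" using fin by (cases ?L1) (auto simp: top_unique)
  obtain c0 where c0: "c' = ennreal c0" "0 \<le> c0" using \<open>c' < \<infinity>\<close> by (cases c') auto
  \<comment> \<open>A third of the gap: two thirds are spent on raising the limits to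
    \<open>A\<close> and \<open>B\<close>, the last one is left for the middle range.\<close>
  define d where "d = (c0 - A0 - B0) / 3"
  have d: "d > 0" using c'(1) A0 B0 c0
    by (simp add: d_def ennreal_plus[symmetric] ennreal_less_iff del: ennreal_plus)
  define A where "A = A0 + d" define B where "B = B0 + d"
  have AB: "A \<ge> 0" "B \<ge> 0" "?L0 < ennreal A" "?L1 < ennreal B" "A + B < c0"
    using A0 B0 d by (auto simp: A_def B_def ennreal_less_iff) (simp add: d_def field_simps)
  have ev0: "\<forall>\<^sub>F l in at_right 0. ?f l < ennreal A" using AB(3) by (rule Limsup_lessD)
  have ev1: "\<forall>\<^sub>F l in at_top. ?f l < ennreal B" using AB(4) by (rule Limsup_lessD)
  obtain r where r: "r > 0" "\<And>l. 0 < l \<Longrightarrow> l < r \<Longrightarrow> ?f l < ennreal A"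
    using ev0 unfolding eventually_at_right_field by auto
  \<comment> \<open>Staying below 1 puts the lower range where the weight is
    \<open>\<delta> * l powr (\<delta> - 1)\<close>; likewise \<open>l1\<close> will exceed 1.
    Halving \<open>r\<close> makes the bound valid at the endpoint \<open>l0\<close> itself.\<close>
  define l0 where "l0 = min (r / 2) (1/2)"
  have l0: "0 < l0" "l0 < 1" "\<And>l. 0 < l \<Longrightarrow> l \<le> l0 \<Longrightarrow> ?f l < ennreal A"
    using r by (auto simp: l0_def)
  obtain s where s: "\<And>l. s \<le> l \<Longrightarrow> ?f l < ennreal B"
    using ev1 unfolding eventually_at_top_linorder by auto
  define l1 where "l1 = max s 2"
  have l1: "1 < l1" "\<And>l. l1 \<le> l \<Longrightarrow> ?f l < ennreal B" using s by (auto simp: l1_def)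
  \<comment> \<open>A finite product with the positive factor \<open>l0 powr p\<close> forces
    finiteness, and monotonicity then bounds F on everything above \<open>l0\<close>.\<close>
  have "F l0 \<noteq> \<infinity>" using l0(3)[of l0] l0(1,2)
    by (auto simp: ennreal_mult_top)
  then obtain f0 where f0: "F l0 = ennreal f0" "0 \<le> f0" by (cases "F l0") auto
  define D where "D = l1 powr p * f0"
  have D: "0 \<le> D" using f0 by (simp add: D_def)
  have mid: "?f l \<le> ennreal D" if "l0 \<le> l" "l \<le> l1" for l
  proof -
    have "?f l \<le> ennreal (l1 powr p) * F l0"
      using that l0 p F by (intro mult_mono ennreal_leI powr_mono2) auto
    then show ?thesis using f0 by (simp add: D_def ennreal_mult)
  qed
  have bound: "(\<integral>\<^sup>+l. ennreal (\<delta> * l powr (\<delta> - 1) * max 1 l powr (- 2 * \<delta>)) * ?f l * indicator {0<..} l \<partial>lborel)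
     \<le> ennreal (A + B + D * (\<delta> / l0) * (l1 - l0))" if \<delta>: "0 < \<delta>" for \<delta>
  proof -
    let ?w = "\<lambda>l. \<delta> * l powr (\<delta> - 1) * max 1 l powr (- 2 * \<delta>)"
    have w1: "?w l = \<delta> * l powr (\<delta> - 1)" if "0 < l" "l \<le> 1" for l using that by (simp add: max_def)
    have w2: "?w l = \<delta> * l powr (- \<delta> - 1)" if "1 \<le> l" for l
      using that by (simp add: max_def mult.assoc powr_add[symmetric])
    have w3: "?w l \<le> \<delta> / l0" if "l0 \<le> l" for l
    proof (cases "l \<le> 1")
      case True
      have "l powr (\<delta> - 1) = l powr \<delta> / l" using that l0 by (simp add: powr_diff)
      also have "\<dots> \<le> 1 / l0" using that l0 \<delta> True powr_mono2[of \<delta> l 1] by (intro frac_le) auto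
      finally show ?thesis using w1[of l] True that l0 \<delta> by (simp add: field_simps)
    next
      case False
      have "l powr (- \<delta> - 1) \<le> l powr 0" using False \<delta> by (intro powr_mono) auto
      also have "\<dots> \<le> 1 / l0" using l0 that by auto
      finally have "\<delta> * l powr (- \<delta> - 1) \<le> \<delta> * (1 / l0)" using \<delta> by (intro mult_left_mono) auto
      moreover have "1 \<le> l" using False by simp
      ultimately show ?thesis unfolding w2[OF \<open>1 \<le> l\<close>] by simp
    qed
    have "(\<integral>\<^sup>+l. ennreal (?w l) * ?f l * indicator {0<..} l \<partial>lborel) \<le>
      (\<integral>\<^sup>+l. ennreal (\<delta> * A) * (ennreal (l powr (\<delta> - 1)) * indicator {0..1} l) +
         ennreal (\<delta> * B) * (ennreal (l powr (- \<delta> - 1)) * indicator {1..} l) +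
         ennreal (D * (\<delta> / l0)) * indicator {l0..l1} l \<partial>lborel)"
    proof (rule nn_integral_mono)
      fix l :: real
      show "ennreal (?w l) * ?f l * indicator {0<..} l \<le> ennreal (\<delta> * A) * (ennreal (l powr (\<delta> - 1)) * indicator {0..1} l) +
         ennreal (\<delta> * B) * (ennreal (l powr (- \<delta> - 1)) * indicator {1..} l) +
         ennreal (D * (\<delta> / l0)) * indicator {l0..l1} l"
      proof -
        consider "l \<le> 0" | "0 < l" "l \<le> l0" | "l0 \<le> l" "l \<le> l1" | "l1 \<le> l" by linarith
        then show ?thesis
        proof cases
          case 1 then show ?thesis by simp
        next
          case 2
          have "ennreal (?w l) * ?f l \<le> ennreal (?w l) * ennreal A"
            using l0(3)[of l] 2 by (intro mult_left_mono) auto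
          also have "\<dots> = ennreal (\<delta> * A) * ennreal (l powr (\<delta> - 1))"
            using 2 w1[of l] l0 AB \<delta> by (simp add: ennreal_mult[symmetric] mult_ac)
          finally have "ennreal (?w l) * ?f l \<le> ennreal (\<delta> * A) * ennreal (l powr (\<delta> - 1))" .
          then show ?thesis using 2 l0 by (simp add: add_increasing2)
        next
          case 3
          have "ennreal (?w l) * ?f l \<le> ennreal (\<delta> / l0) * ennreal D"
            using mid[of l] 3 w3[of l] by (intro mult_mono ennreal_leI) auto
          also have "\<dots> = ennreal (D * (\<delta> / l0))"
            using \<delta> l0 D by (simp add: ennreal_mult[symmetric] mult_ac)
          finally show ?thesis using 3 l0 by (simp add: add_increasing)
        next
          case 4
          have "ennreal (?w l) * ?f l \<le> ennreal (?w l) * ennreal B"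
            using l1(2)[of l] 4 by (intro mult_left_mono) auto
          also have "\<dots> = ennreal (\<delta> * B) * ennreal (l powr (- \<delta> - 1))"
            using 4 w2[of l] l1 AB \<delta> by (simp add: ennreal_mult[symmetric] mult_ac)
          finally have "ennreal (?w l) * ?f l \<le> ennreal (\<delta> * B) * ennreal (l powr (- \<delta> - 1))" .
          then show ?thesis using 4 l1 by (simp add: add_increasing add_increasing2)
        qed
      qed
    qed
    also have "\<dots> = ennreal (\<delta> * A) * ennreal (1 / \<delta>) + ennreal (\<delta> * B) * ennreal (1 / \<delta>)
       + ennreal (D * (\<delta> / l0)) * ennreal (l1 - l0)"
      using nn_integral_powr_from_0[of "\<delta> - 1" 1] nn_integral_powr_to_inf[of "- \<delta> - 1" 1] \<delta> l0 l1
      by (simp add: nn_integral_add nn_integral_cmult)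
    also have "\<dots> = ennreal (A + B + D * (\<delta> / l0) * (l1 - l0))"
      using \<delta> l0 l1 D AB by (simp add: ennreal_mult[symmetric] ennreal_plus[symmetric] del: ennreal_plus)
    finally show ?thesis .
  qed
  have "((\<lambda>\<delta>. A + B + D * (\<delta> / l0) * (l1 - l0)) \<longlongrightarrow> A + B + D * (0 / l0) * (l1 - l0)) (at_right 0)"
    using l0 by (intro tendsto_intros) auto
  then have "\<forall>\<^sub>F \<delta> in at_right 0. A + B + D * (\<delta> / l0) * (l1 - l0) < c0"
    using AB(5) by (auto dest: order_tendstoD(2))
  moreover have "\<forall>\<^sub>F \<delta>::real in at_right 0. 0 < \<delta>" by (rule eventually_at_right_less)
  ultimately show ?thesis
  proof eventually_elim
    case (elim \<delta>)
    have "ennreal (A + B + D * (\<delta> / l0) * (l1 - l0)) \<le> ennreal c0" using elim by (intro ennreal_leI) auto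
    also have "\<dots> \<le> c" using c' c0 by auto
    finally show ?case using bound[of \<delta>] elim by (meson order_trans)
  qed
qed

text \<open>Tonelli's theorem exchanges the level and the point z. The distribution function of Q is
  decreasing in the level, as \<open>averaging_upper\<close> requires.\<close>

lemma averaging:
  fixes \<rho> :: "'a \<Rightarrow> ennreal" and Q :: "'a \<Rightarrow> real" and p :: real
  assumes M: "sigma_finite_measure M"
    and [measurable]: "\<rho> \<in> borel_measurable M" "Q \<in> borel_measurable M" and Q: "\<And>z. 0 \<le> Q z"
    and p: "1 \<le> p" 
    and c: "Limsup (at_right 0) (\<lambda>l. ennreal (l powr p) * (\<integral>\<^sup>+z. \<rho> z * indicator {l<..} (Q z) \<partial>M))
      + Limsup at_top (\<lambda>l. ennreal (l powr p) * (\<integral>\<^sup>+z. \<rho> z * indicator {l<..} (Q z) \<partial>M)) < c"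
  shows "\<forall>\<^sub>F \<delta> in at_right 0. (\<integral>\<^sup>+z. ennreal (\<delta> / (p + \<delta>) * Q z powr (p + \<delta>) * max 1 (Q z) powr (- 2 * \<delta>)) * \<rho> z \<partial>M) \<le> c"
proof -
  interpret sigma_finite_measure M by (rule M)
  interpret P: pair_sigma_finite M "lborel :: real measure" ..
  let ?F = "\<lambda>l. \<integral>\<^sup>+z. \<rho> z * indicator {l<..} (Q z) \<partial>M"
  have Fm: "?F \<in> borel_measurable borel"
  proof -
    have "(\<lambda>(l, z). \<rho> z * indicator {(l, z). l < Q z} (l, z)) \<in> borel_measurable (borel \<Otimes>\<^sub>M M)"
      by measurable
    then have "(\<lambda>l. \<integral>\<^sup>+z. \<rho> z * indicator {(l, z). l < Q z} (l, z) \<partial>M) \<in> borel_measurable borel"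
      by (rule borel_measurable_nn_integral)
    then show ?thesis by (simp add: indicator_def)
  qed
  have "?F l' \<le> ?F l" if "l \<le> l'" for l l'
    using that by (intro nn_integral_mono mult_left_mono) (auto simp: indicator_def)
  from averaging_upper[OF p c this Fm]
  have "\<forall>\<^sub>F \<delta> in at_right 0. (\<integral>\<^sup>+l. ennreal (\<delta> * l powr (\<delta> - 1) * max 1 l powr (- 2 * \<delta>)) *
      (ennreal (l powr p) * ?F l) * indicator {0<..} l \<partial>lborel) \<le> c" .
  moreover have "\<forall>\<^sub>F \<delta>::real in at_right 0. 0 < \<delta>" by (rule eventually_at_right_less)
  ultimately show ?thesis
  proof eventually_elim
    case (elim \<delta>)
    let ?w = "\<lambda>l. \<delta> * l powr (\<delta> - 1) * max 1 l powr (- 2 * \<delta>)"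
    have "(\<integral>\<^sup>+z. ennreal (\<delta> / (p + \<delta>) * Q z powr (p + \<delta>) * max 1 (Q z) powr (- 2 * \<delta>)) * \<rho> z \<partial>M)
      \<le> (\<integral>\<^sup>+z. (\<integral>\<^sup>+l. ennreal (?w l * l powr p) * indicator {0<..<Q z} l \<partial>lborel) * \<rho> z \<partial>M)"
      using elim p Q by (intro nn_integral_mono mult_right_mono layer_cake_weight) auto
    also have "\<dots> = (\<integral>\<^sup>+z. (\<integral>\<^sup>+l. ennreal (?w l * l powr p) * indicator {(z, l). 0 < l \<and> l < Q z} (z, l) * \<rho> z \<partial>lborel) \<partial>M)"
      by (intro nn_integral_cong) (auto simp: nn_integral_multc[symmetric] indicator_def intro!: nn_integral_cong)
    also have "\<dots> = (\<integral>\<^sup>+l. (\<integral>\<^sup>+z. ennreal (?w l * l powr p) * indicator {(z, l). 0 < l \<and> l < Q z} (z, l) * \<rho> z \<partial>M) \<partial>lborel)"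
      by (rule P.Fubini'[symmetric]) measurable
    also have "\<dots> = (\<integral>\<^sup>+l. ennreal (?w l) * (ennreal (l powr p) * ?F l) * indicator {0<..} l \<partial>lborel)"
    proof (rule nn_integral_cong)
      fix l :: real
      have "(\<integral>\<^sup>+z. ennreal (?w l * l powr p) * indicator {(z, l). 0 < l \<and> l < Q z} (z, l) * \<rho> z \<partial>M)
        = (\<integral>\<^sup>+z. (ennreal (?w l * l powr p) * indicator {0<..} l) * (\<rho> z * indicator {l<..} (Q z)) \<partial>M)"
        by (intro nn_integral_cong) (auto simp: indicator_def)
      also have "\<dots> = (ennreal (?w l * l powr p) * indicator {0<..} l) * ?F l"
        by (rule nn_integral_cmult) measurable
      also have "\<dots> = ennreal (?w l) * (ennreal (l powr p) * ?F l) * indicator {0<..} l"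
        using elim by (subst ennreal_mult) (auto simp: mult_ac)
      finally show "(\<integral>\<^sup>+z. ennreal (?w l * l powr p) * indicator {(z, l). 0 < l \<and> l < Q z} (z, l) * \<rho> z \<partial>M)
        = ennreal (?w l) * (ennreal (l powr p) * ?F l) * indicator {0<..} l" .
    qed
    also have "\<dots> \<le> c" by (rule elim)
    finally show ?case .
  qed
qed

section \<open>The constant \<open>K\<close> and homogeneous kernels\<close>

lemma cball_in_borel[measurable]: "cball c r \<in> sets borel"
  by (rule borel_closed) simp

lemma nn_integral_lborel_reflect:
  fixes f :: "'a::euclidean_space \<Rightarrow> ennreal"
  assumes [measurable]: "f \<in> borel_measurable borel"
  shows "(\<integral>\<^sup>+x. f (c - x) \<partial>lborel) = (\<integral>\<^sup>+x. f x \<partial>lborel)"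
  by (subst (2) lborel_affine[of "-1" c]) (auto simp: nn_integral_density nn_integral_distr)

text \<open>The pushforward of Lebesgue measure under a linear isometry is translation invariant, and
  Fubini's theorem shows that it is a multiple of Lebesgue measure. The unit ball fixes the factor.\<close>

lemma nn_integral_lborel_orthogonal:
  fixes f :: "real^'n::finite \<Rightarrow> real^'n" and g :: "real^'n \<Rightarrow> ennreal"
  assumes f: "orthogonal_transformation f" and [measurable]: "g \<in> borel_measurable borel"
  shows "(\<integral>\<^sup>+x. g (f x) \<partial>lborel) = (\<integral>\<^sup>+x. g x \<partial>lborel)"
proof -
  have lin: "linear f" using f by (rule orthogonal_transformation_linear)
  have fm[measurable]: "f \<in> borel_measurable borel"
    using lin by (intro borel_measurable_continuous_onI linear_continuous_on linear_conv_bounded_linear[THEN iffD1])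
  have surj: "surj f" using f by (rule orthogonal_transformation_surj)
  define h :: "real^'n \<Rightarrow> ennreal" where "h = indicator (cball 0 1)"
  have [measurable]: "h \<in> borel_measurable borel" by (simp add: h_def)
  have "(\<integral>\<^sup>+x. g (f x) \<partial>lborel) * (\<integral>\<^sup>+y. h y \<partial>lborel) = (\<integral>\<^sup>+x. g (f x) * (\<integral>\<^sup>+y. h y \<partial>lborel) \<partial>lborel)"
    by (simp add: nn_integral_multc)
  also have "\<dots> = (\<integral>\<^sup>+x. (\<integral>\<^sup>+y. g (f x) * h (f x + y) \<partial>lborel) \<partial>lborel)"
    by (simp add: nn_integral_cmult nn_integral_lborel_shift)
  also have "\<dots> = (\<integral>\<^sup>+y. (\<integral>\<^sup>+x. g (f x) * h (f x + y) \<partial>lborel) \<partial>lborel)"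
    by (intro lborel_pair.Fubini'[symmetric]) measurable
  also have "\<dots> = (\<integral>\<^sup>+y. (\<integral>\<^sup>+x. g (f x - y) * h (f x) \<partial>lborel) \<partial>lborel)"
  proof (rule nn_integral_cong)
    fix y
    obtain z where z: "y = f z" using surj by auto
    have "(\<integral>\<^sup>+x. g (f x - y) * h (f x) \<partial>lborel) = (\<integral>\<^sup>+x. g (f (z + x) - y) * h (f (z + x)) \<partial>lborel)"
      by (rule nn_integral_lborel_shift[symmetric]) measurable
    then show "(\<integral>\<^sup>+x. g (f x) * h (f x + y) \<partial>lborel) = (\<integral>\<^sup>+x. g (f x - y) * h (f x) \<partial>lborel)"
      by (simp add: z linear_add[OF lin] add.commute)
  qed
  also have "\<dots> = (\<integral>\<^sup>+x. (\<integral>\<^sup>+y. g (f x - y) * h (f x) \<partial>lborel) \<partial>lborel)"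
    by (intro lborel_pair.Fubini') measurable
  also have "\<dots> = (\<integral>\<^sup>+x. (\<integral>\<^sup>+y. g y \<partial>lborel) * h (f x) \<partial>lborel)"
    by (simp add: nn_integral_multc nn_integral_lborel_reflect)
  also have "\<dots> = (\<integral>\<^sup>+y. g y \<partial>lborel) * (\<integral>\<^sup>+x. h (f x) \<partial>lborel)"
    by (rule nn_integral_cmult) measurable
  also have "(\<integral>\<^sup>+x. h (f x) \<partial>lborel) = (\<integral>\<^sup>+x. h x \<partial>lborel)"
    by (intro nn_integral_cong) (auto simp: h_def indicator_def orthogonal_transformation_norm[OF f])
  finally have eq: "(\<integral>\<^sup>+x. g (f x) \<partial>lborel) * (\<integral>\<^sup>+y. h y \<partial>lborel) = (\<integral>\<^sup>+y. g y \<partial>lborel) * (\<integral>\<^sup>+y. h y \<partial>lborel)" .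
  have h: "(\<integral>\<^sup>+y. h y \<partial>lborel) = emeasure lborel (cball (0::real^'n) 1)" by (simp add: h_def)
  have "emeasure lborel (cball (0::real^'n) 1) \<noteq> 0"
    using open_not_negligible[of "ball (0::real^'n) 1"] negligible_subset[of "cball (0::real^'n) 1" "ball 0 1"]
    by (auto simp: negligible_iff_null_sets null_sets_def)
  moreover have "emeasure lborel (cball (0::real^'n) 1) \<noteq> \<infinity>"
    using emeasure_lborel_cball_finite[of "0::real^'n" 1] by simp
  ultimately show ?thesis using eq unfolding h
    by (metis ennreal_mult_divide_eq infinity_ennreal_def)
qed

text \<open>The surface measure is a pushforward of N times Lebesgue measure on the punctured ball
  under radial projection, so K is a volume integral of a function that is constant along rays. The
  origin can be put back because the integrand is 0 there: \<open>0 /\<^sub>R 0 = 0\<close> and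
  \<open>0 powr p = 0\<close>.\<close>

lemma ennreal_K_const:
  fixes e :: "real^'n::finite"
  assumes "0 < p"
  shows "ennreal (K_const e p) = of_nat CARD('n) *
    (\<integral>\<^sup>+x. ennreal (\<bar>e \<bullet> (x /\<^sub>R norm x)\<bar> powr p) * indicator (cball 0 1) x \<partial>lborel)"
proof -
  let ?B = "cball 0 1 - {0::real^'n}" and ?f = "\<lambda>x::real^'n. x /\<^sub>R norm x"
  let ?I = "\<integral>\<^sup>+x. ennreal (\<bar>e \<bullet> ?f x\<bar> powr p) * indicator (cball 0 1) x \<partial>lborel"
  let ?M = "scale_measure (of_nat DIM(real^'n)) (restrict_space lborel ?B)"
  have B: "?B \<in> sets borel" by measurable
  have "?f \<in> restrict_space borel ?B \<rightarrow>\<^sub>M restrict_space borel (sphere 0 1)"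
    by (rule measurable_restrict_space3) auto
  then have f[measurable]: "?f \<in> ?M \<rightarrow>\<^sub>M restrict_space borel (sphere 0 1)"
    by (subst measurable_cong_sets[OF _ refl, where M' = "restrict_space borel ?B"])
       (simp_all cong: sets_restrict_space_cong)
  have g[measurable]: "(\<lambda>\<sigma>. \<bar>e \<bullet> \<sigma>\<bar> powr p) \<in> borel_measurable (restrict_space borel (sphere 0 1))"
    by (rule measurable_restrict_space1) measurable
  then have g2: "(\<lambda>\<sigma>. \<bar>e \<bullet> \<sigma>\<bar> powr p) \<in> borel_measurable sphere_measure"
    by (simp add: sphere_measure_def)
  have eq: "(\<integral>\<^sup>+\<sigma>. ennreal (\<bar>e \<bullet> \<sigma>\<bar> powr p) \<partial>sphere_measure) = of_nat CARD('n) * ?I"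
  proof -
    have "(\<integral>\<^sup>+\<sigma>. ennreal (\<bar>e \<bullet> \<sigma>\<bar> powr p) \<partial>sphere_measure) = (\<integral>\<^sup>+x. ennreal (\<bar>e \<bullet> ?f x\<bar> powr p) \<partial>?M)"
      unfolding sphere_measure_def by (subst nn_integral_distr[OF f]) auto
    also have "\<dots> = of_nat CARD('n) * (\<integral>\<^sup>+x. ennreal (\<bar>e \<bullet> ?f x\<bar> powr p) \<partial>restrict_space lborel ?B)"
      by (subst nn_integral_scale_measure) (auto intro!: measurable_restrict_space1)
    also have "(\<integral>\<^sup>+x. ennreal (\<bar>e \<bullet> ?f x\<bar> powr p) \<partial>restrict_space lborel ?B) = ?I"
      using assms by (subst nn_integral_restrict_space) (auto intro!: nn_integral_cong simp: indicator_def)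
    finally show ?thesis .
  qed
  \<comment> \<open>Finiteness guarantees that the Bochner integral in \<open>K_const\<close> is the
    true value and not the default 0.\<close>
  have "?I \<le> (\<integral>\<^sup>+x. ennreal (norm e powr p) * indicator (cball 0 1) (x::real^'n) \<partial>lborel)"
  proof (intro nn_integral_mono mult_right_mono ennreal_leI powr_mono2)
    fix x :: "real^'n"
    have "\<bar>e \<bullet> ?f x\<bar> \<le> norm e * norm (?f x)" by (rule Cauchy_Schwarz_ineq2)
    also have "\<dots> \<le> norm e * 1" by (intro mult_left_mono) (cases "x = 0", auto)
    finally show "\<bar>e \<bullet> ?f x\<bar> \<le> norm e" by simp
  qed (use assms in auto)
  also have "\<dots> < \<infinity>"
    using emeasure_lborel_cball_finite[of "0::real^'n" 1] by (simp add: nn_integral_cmult ennreal_mult_less_top)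
  finally have fin: "?I < \<infinity>" .
  have "integrable sphere_measure (\<lambda>\<sigma>. \<bar>e \<bullet> \<sigma>\<bar> powr p)"
    using fin eq g2 by (intro integrableI_nonneg) (auto simp: ennreal_mult_less_top of_nat_less_top)
  then have "ennreal (K_const e p) = (\<integral>\<^sup>+\<sigma>. ennreal (\<bar>e \<bullet> \<sigma>\<bar> powr p) \<partial>sphere_measure)"
    unfolding K_const_def by (intro nn_integral_eq_integral[symmetric]) auto
  then show ?thesis using eq by simp
qed

text \<open>If K were 0, almost every point of the unit ball would lie in the hyperplane orthogonal
  to e, which is null while the ball is not.\<close>

lemma K_const_pos:
  fixes e :: "real^'n::finite"
  assumes "0 < p" "e \<noteq> 0"
  shows "0 < K_const e p"
proof (rule ccontr)
  assume "\<not> 0 < K_const e p"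
  then have "ennreal (K_const e p) = 0" by (simp add: ennreal_neg)
  then have "(\<integral>\<^sup>+x. ennreal (\<bar>e \<bullet> (x /\<^sub>R norm x)\<bar> powr p) * indicator (cball 0 1) x \<partial>lborel) = 0"
    unfolding ennreal_K_const[OF assms(1)] by simp
  moreover have "(\<lambda>x. ennreal (\<bar>e \<bullet> (x /\<^sub>R norm x)\<bar> powr p) * indicator (cball 0 1) x) \<in> borel_measurable lborel"
    by measurable
  ultimately have "AE x in lborel. ennreal (\<bar>e \<bullet> (x /\<^sub>R norm x)\<bar> powr p) * indicator (cball 0 1) x = 0"
    by (simp only: nn_integral_0_iff_AE)
  then have "AE x in lebesgue. ennreal (\<bar>e \<bullet> (x /\<^sub>R norm x)\<bar> powr p) * indicator (cball 0 1) x = 0"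
    by (rule AE_completion)
  moreover have "AE x in lebesgue. e \<bullet> x \<noteq> 0"
  proof -
    have "{x. e \<bullet> x = 0} \<in> null_sets lebesgue"
      using negligible_hyperplane[of e 0] assms by (simp add: negligible_iff_null_sets)
    then show ?thesis by (auto dest: AE_not_in)
  qed
  ultimately have "AE x in lebesgue. x \<notin> ball (0::real^'n) 1"
  proof eventually_elim
    case (elim x) then show ?case by (auto simp: indicator_def split: if_splits)
  qed
  then have "negligible (ball (0::real^'n) 1)"
    by (simp add: negligible_iff_null_sets AE_iff_null_sets)
  then show False using open_not_negligible[of "ball (0::real^'n) 1"] by auto
qed

text \<open>An orthogonal map carrying \<open>norm g *\<^sub>R e\<close> to g preserves Lebesgue
  measure and the unit ball, so the value depends on g only through its norm. This is the
  independence of K from the unit vector.\<close>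

lemma K_const_rotation:
  fixes e g :: "real^'n::finite"
  assumes "norm e = 1" "0 < p"
  shows "of_nat CARD('n) * (\<integral>\<^sup>+x. ennreal (\<bar>g \<bullet> (x /\<^sub>R norm x)\<bar> powr p) * indicator (cball 0 1) x \<partial>lborel)
    = ennreal (norm g powr p) * ennreal (K_const e p)"
proof -
  obtain f where f: "orthogonal_transformation f" "f (norm g *\<^sub>R e) = g"
    using orthogonal_transformation_exists[of "norm g *\<^sub>R e" g] assms by auto
  have lin: "linear f" using f(1) by (rule orthogonal_transformation_linear)
  have [measurable]: "f \<in> borel_measurable borel"
    using lin by (intro borel_measurable_continuous_onI linear_continuous_on linear_conv_bounded_linear[THEN iffD1])
  have n: "norm (f x) = norm x" for x using f(1) by (rule orthogonal_transformation_norm)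
  have "(\<integral>\<^sup>+x. ennreal (\<bar>g \<bullet> (x /\<^sub>R norm x)\<bar> powr p) * indicator (cball 0 1) x \<partial>lborel)
    = (\<integral>\<^sup>+x. ennreal (\<bar>g \<bullet> (f x /\<^sub>R norm (f x))\<bar> powr p) * indicator (cball 0 1) (f x) \<partial>lborel)"
    by (rule nn_integral_lborel_orthogonal[OF f(1), symmetric]) measurable
  also have "\<dots> = (\<integral>\<^sup>+x. ennreal (norm g powr p) * (ennreal (\<bar>e \<bullet> (x /\<^sub>R norm x)\<bar> powr p) * indicator (cball 0 1) x) \<partial>lborel)"
  proof (rule nn_integral_cong)
    fix x
    have "g \<bullet> (f x /\<^sub>R norm (f x)) = f (norm g *\<^sub>R e) \<bullet> f (x /\<^sub>R norm x)"
      using f(2) by (simp add: n linear_scale[OF lin])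
    also have "\<dots> = norm g * (e \<bullet> (x /\<^sub>R norm x))"
      using f(1) unfolding orthogonal_transformation_def by (simp only:) simp
    finally have "\<bar>g \<bullet> (f x /\<^sub>R norm (f x))\<bar> powr p = norm g powr p * \<bar>e \<bullet> (x /\<^sub>R norm x)\<bar> powr p"
      by (simp add: abs_mult powr_mult)
    moreover have "indicator (cball 0 1) (f x) = (indicator (cball 0 1) x :: ennreal)"
      by (auto simp: indicator_def n)
    ultimately show "ennreal (\<bar>g \<bullet> (f x /\<^sub>R norm (f x))\<bar> powr p) * indicator (cball 0 1) (f x)
      = ennreal (norm g powr p) * (ennreal (\<bar>e \<bullet> (x /\<^sub>R norm x)\<bar> powr p) * indicator (cball 0 1) x)"
      by (simp add: ennreal_mult mult_ac)
  qed
  also have "\<dots> = ennreal (norm g powr p) * (\<integral>\<^sup>+x. (ennreal (\<bar>e \<bullet> (x /\<^sub>R norm x)\<bar> powr p) * indicator (cball 0 1) x) \<partial>lborel)"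
    by (rule nn_integral_cmult) measurable
  finally show ?thesis by (simp add: ennreal_K_const[OF assms(2)] mult_ac)
qed

text \<open>A substitute for polar coordinates: |h|^(\<alpha> - N) is (N - \<alpha>) times the
  integral of t^(\<alpha> - N - 1) over t \<ge> |h|, and the integral of f over the ball of radius t
  scales like t^N. Cutting t at r loses mass, so only an inequality results; compared with the exact
  factor N/\<alpha> the loss is (N - \<alpha>)/N, which tends to 1 as \<alpha> tends to 0.\<close>

lemma homogeneous_integral_ge:
  fixes f :: "'a::euclidean_space \<Rightarrow> ennreal" and \<alpha> r :: real
  assumes [measurable]: "f \<in> borel_measurable borel" and hom: "\<And>t x. 0 < t \<Longrightarrow> f (t *\<^sub>R x) = f x"
    and \<alpha>: "0 < \<alpha>" "\<alpha> < DIM('a)" and r: "0 < r"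
  shows "ennreal ((DIM('a) - \<alpha>) / \<alpha> * r powr \<alpha>) * (\<integral>\<^sup>+h. f h * indicator (cball 0 1) h \<partial>lborel)
    \<le> (\<integral>\<^sup>+h. f h * ennreal (norm h powr (\<alpha> - DIM('a))) * indicator (cball 0 r) h \<partial>lborel)"
proof -
  let ?N = "real DIM('a)" and ?I = "\<integral>\<^sup>+h. f h * indicator (cball 0 1) h \<partial>lborel"
  let ?w = "\<lambda>t. ennreal ((?N - \<alpha>) * t powr (\<alpha> - ?N - 1))"
  have "ennreal ((?N - \<alpha>) / \<alpha> * r powr \<alpha>) * ?I = ennreal (?N - \<alpha>) * (\<integral>\<^sup>+t. ennreal (t powr (\<alpha> - 1)) * indicator {0..r} t \<partial>lborel) * ?I"
    using \<alpha> r by (subst nn_integral_powr_from_0) (auto simp: ennreal_mult[symmetric])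
  also have "\<dots> = (\<integral>\<^sup>+t. ennreal (?N - \<alpha>) * (ennreal (t powr (\<alpha> - 1)) * indicator {0..r} t) * ?I \<partial>lborel)"
    by (simp add: nn_integral_cmult nn_integral_multc)
  also have "\<dots> = (\<integral>\<^sup>+t. (\<integral>\<^sup>+h. f h * (?w t * indicator {(h, t). 0 < t \<and> norm h \<le> t \<and> t \<le> r} (h, t)) \<partial>lborel) \<partial>lborel)"
  proof (rule nn_integral_cong)
    fix t :: real
    show "ennreal (?N - \<alpha>) * (ennreal (t powr (\<alpha> - 1)) * indicator {0..r} t) * ?I
      = (\<integral>\<^sup>+h. f h * (?w t * indicator {(h, t). 0 < t \<and> norm h \<le> t \<and> t \<le> r} (h, t)) \<partial>lborel)"
    proof (cases "0 < t \<and> t \<le> r")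
      case True
      have "(\<integral>\<^sup>+h. f h * (?w t * indicator {(h, t). 0 < t \<and> norm h \<le> t \<and> t \<le> r} (h, t)) \<partial>lborel)
        = (\<integral>\<^sup>+h. ?w t * (f h * indicator (cball 0 t) h) \<partial>lborel)"
        using True by (intro nn_integral_cong) (auto simp: indicator_def mult_ac)
      also have "\<dots> = ?w t * (\<integral>\<^sup>+h. f h * indicator (cball 0 t) h \<partial>lborel)"
        by (rule nn_integral_cmult) measurable
      also have "(\<integral>\<^sup>+h. f h * indicator (cball 0 t) h \<partial>lborel)
        = ennreal (t ^ DIM('a)) * (\<integral>\<^sup>+h. f (t *\<^sub>R h) * indicator (cball 0 t) (t *\<^sub>R h) \<partial>lborel)"
        using True by (intro nn_integral_lborel_scale) auto
      also have "(\<integral>\<^sup>+h. f (t *\<^sub>R h) * indicator (cball 0 t) (t *\<^sub>R h) \<partial>lborel) = ?I"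
        using True by (intro nn_integral_cong) (auto simp: hom indicator_def)
      finally have "(\<integral>\<^sup>+h. f h * (?w t * indicator {(h, t). 0 < t \<and> norm h \<le> t \<and> t \<le> r} (h, t)) \<partial>lborel)
        = (?w t * ennreal (t ^ DIM('a))) * ?I" by (simp add: mult.assoc)
      also have "?w t * ennreal (t ^ DIM('a)) = ennreal (?N - \<alpha>) * ennreal (t powr (\<alpha> - 1))"
      proof -
        have "t powr (\<alpha> - ?N - 1) * t ^ DIM('a) = t powr (\<alpha> - ?N - 1 + ?N)"
          using True by (subst powr_add) (simp add: powr_realpow)
        then show ?thesis using \<alpha> True by (simp add: ennreal_mult[symmetric] mult.assoc)
      qed
      finally show ?thesis using True by simp
    next
      case False
      then show ?thesis by (cases "t = 0") (auto simp: indicator_def)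
    qed
  qed
  also have "\<dots> = (\<integral>\<^sup>+h. (\<integral>\<^sup>+t. f h * (?w t * indicator {(h, t). 0 < t \<and> norm h \<le> t \<and> t \<le> r} (h, t)) \<partial>lborel) \<partial>lborel)"
    by (intro lborel_pair.Fubini') measurable
  also have "\<dots> \<le> (\<integral>\<^sup>+h. f h * ennreal (norm h powr (\<alpha> - ?N)) * indicator (cball 0 r) h \<partial>lborel)"
  proof (rule nn_integral_mono_AE)
    have "AE h in lborel. h \<noteq> (0::'a)" by (rule AE_lborel_singleton)
    then show "AE h in lborel. (\<integral>\<^sup>+t. f h * (?w t * indicator {(h, t). 0 < t \<and> norm h \<le> t \<and> t \<le> r} (h, t)) \<partial>lborel)
      \<le> f h * ennreal (norm h powr (\<alpha> - ?N)) * indicator (cball 0 r) h"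
    proof eventually_elim
      case (elim h)
      have "(\<integral>\<^sup>+t. f h * (?w t * indicator {(h, t). 0 < t \<and> norm h \<le> t \<and> t \<le> r} (h, t)) \<partial>lborel)
        \<le> (\<integral>\<^sup>+t. (f h * ennreal (?N - \<alpha>) * indicator (cball 0 r) h) * (ennreal (t powr (\<alpha> - ?N - 1)) * indicator {norm h..} t) \<partial>lborel)"
        using \<alpha> by (intro nn_integral_mono) (auto simp: indicator_def ennreal_mult mult_ac)
      also have "\<dots> = (f h * ennreal (?N - \<alpha>) * indicator (cball 0 r) h) * ennreal (- (norm h powr (\<alpha> - ?N - 1 + 1)) / (\<alpha> - ?N - 1 + 1))"
        using \<alpha> elim by (subst nn_integral_powr_to_inf[symmetric]) (auto simp: nn_integral_cmult)
      also have "\<dots> = f h * indicator (cball 0 r) h * (ennreal (?N - \<alpha>) * ennreal (- (norm h powr (\<alpha> - ?N)) / (\<alpha> - ?N)))"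
        by (simp add: mult_ac)
      also have "ennreal (?N - \<alpha>) * ennreal (- (norm h powr (\<alpha> - ?N)) / (\<alpha> - ?N)) = ennreal (norm h powr (\<alpha> - ?N))"
      proof -
        have "- (norm h powr (\<alpha> - ?N)) / (\<alpha> - ?N) = norm h powr (\<alpha> - ?N) / (?N - \<alpha>)"
          by (metis minus_diff_eq minus_divide_divide)
        then show ?thesis using \<alpha> by (simp add: ennreal_mult[symmetric])
      qed
      finally show ?case by (simp add: mult_ac)
    qed
  qed
  finally show ?thesis .
qed

section \<open>Lower bound by the gradient\<close>

text \<open>At a point of differentiability the difference quotient dominates, for small h, a
  function of the direction alone, to which \<open>homogeneous_integral_ge\<close> applies with
  \<alpha> equal to \<open>a * \<delta> n\<close>. Fatou's lemma in h then handles the varying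
  exponent \<open>p + \<delta> n\<close>, and rotation invariance evaluates the angular
  integral.\<close>

lemma directional_liminf:
  fixes f :: "real^'n::finite \<Rightarrow> real" and e g x :: "real^'n" and a p k :: real and \<kappa> \<delta> :: "nat \<Rightarrow> real"
  assumes f: "(f has_derivative (\<lambda>h. g \<bullet> h)) (at x)" and [measurable]: "f \<in> borel_measurable borel"
    and e: "norm e = 1" and a: "0 < a" and p: "1 \<le> p"
    and \<delta>: "\<And>n. 0 < \<delta> n" "\<delta> \<longlonglongrightarrow> 0" and \<kappa>: "\<And>n. 0 \<le> \<kappa> n" "\<kappa> \<longlonglongrightarrow> k"
  shows "ennreal (k / a) * (ennreal (K_const e p) * ennreal (norm g powr p)) \<le>
    liminf (\<lambda>n. ennreal (\<kappa> n * \<delta> n) * (\<integral>\<^sup>+h. ennreal ((\<bar>f (x + h) - f x\<bar> / norm h) powr (p + \<delta> n) *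
      norm h powr (a * \<delta> n - CARD('n))) * indicator (cball 0 1) h \<partial>lborel))" (is "_ \<le> liminf ?T")
proof -
  let ?N = "real CARD('n)"
  \<comment> \<open>The directional derivative lowered by the error \<eta> of the linear
    approximation. It depends only on the direction of h, and the positive part keeps the base of
    the powers nonnegative.\<close>
  define \<psi> :: "real \<Rightarrow> real^'n \<Rightarrow> real" where "\<psi> = (\<lambda>\<eta> h. max 0 (\<bar>g \<bullet> (h /\<^sub>R norm h)\<bar> - \<eta>))"
  have [measurable]: "\<psi> \<eta> \<in> borel_measurable borel" for \<eta> unfolding \<psi>_def by measurable
  have psi0: "0 \<le> \<psi> \<eta> h" for \<eta> h by (simp add: \<psi>_def)
  have hom: "\<psi> \<eta> (t *\<^sub>R h) = \<psi> \<eta> h" if "0 < t" for \<eta> t h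
  proof -
    have "inverse (t * norm h) * t = inverse (norm h)" using that by (simp add: field_simps)
    then have "(t *\<^sub>R h) /\<^sub>R norm (t *\<^sub>R h) = h /\<^sub>R norm h" using that by simp
    then show ?thesis by (simp only: \<psi>_def)
  qed
  have k: "0 \<le> k" using \<kappa> by (intro LIMSEQ_le_const[OF \<kappa>(2)]) auto
  have step: "(\<integral>\<^sup>+h. ennreal (k * ?N / a * \<psi> \<eta> h powr p) * indicator (cball 0 1) h \<partial>lborel) \<le> liminf ?T"
    if \<eta>: "0 < \<eta>" for \<eta>
  proof -
    obtain d where d: "0 < d" "\<And>y. norm (y - x) < d \<Longrightarrow> norm (f y - f x - g \<bullet> (y - x)) \<le> \<eta> * norm (y - x)"
      using f \<eta> unfolding has_derivative_at_alt by blast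
    define r where "r = min (d / 2) 1"
    have r: "0 < r" "r \<le> 1" "r < d" using d by (auto simp: r_def)
    have low: "\<psi> \<eta> h \<le> \<bar>f (x + h) - f x\<bar> / norm h" if "norm h \<le> r" for h
    proof (cases "h = 0")
      case True then show ?thesis using \<eta> by (simp add: \<psi>_def)
    next
      case False
      have "\<bar>f (x + h) - f x - g \<bullet> h\<bar> \<le> \<eta> * norm h" using d(2)[of "x + h"] that r by simp
      then have "\<bar>g \<bullet> h\<bar> - \<eta> * norm h \<le> \<bar>f (x + h) - f x\<bar>" by linarith
      then have "(\<bar>g \<bullet> h\<bar> - \<eta> * norm h) / norm h \<le> \<bar>f (x + h) - f x\<bar> / norm h"
        by (intro divide_right_mono) auto
      moreover have "\<bar>g \<bullet> (h /\<^sub>R norm h)\<bar> = \<bar>g \<bullet> h\<bar> / norm h"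
        by (simp add: abs_mult divide_inverse mult.commute)
      ultimately show ?thesis using False by (simp add: \<psi>_def diff_divide_distrib)
    qed
    \<comment> \<open>This is \<open>\<kappa> n * \<delta> n\<close> times the factor of
      \<open>homogeneous_integral_ge\<close> for \<alpha> = \<open>a * \<delta> n\<close>; the
      \<delta> cancels and the limit is k N / a, whatever the radius \<open>r\<close> is.\<close>
    define c where "c = (\<lambda>n. \<kappa> n * ((?N - a * \<delta> n) / a * r powr (a * \<delta> n)))"
    have c_lim: "c \<longlonglongrightarrow> k * ((?N - a * 0) / a * r powr (a * 0))"
      unfolding c_def using r a by (intro tendsto_intros \<delta> \<kappa>) auto
    have "\<forall>\<^sub>F n in sequentially. \<delta> n < ?N / a"
      using order_tendstoD(2)[OF \<delta>(2), of "?N / a"] a by simp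
    then have ev: "\<forall>\<^sub>F n in sequentially. (\<integral>\<^sup>+h. ennreal (c n * \<psi> \<eta> h powr (p + \<delta> n)) * indicator (cball 0 1) h \<partial>lborel) \<le> ?T n"
    proof eventually_elim
      case (elim n)
      then have n: "a * \<delta> n < ?N" using a by (simp add: field_simps)
      have c0: "0 \<le> c n" using n \<kappa>(1)[of n] a by (simp add: c_def)
      have "(\<integral>\<^sup>+h. ennreal (c n * \<psi> \<eta> h powr (p + \<delta> n)) * indicator (cball 0 1) h \<partial>lborel)
        = (\<integral>\<^sup>+h. ennreal (c n) * (ennreal (\<psi> \<eta> h powr (p + \<delta> n)) * indicator (cball 0 1) h) \<partial>lborel)"
        using c0 by (simp add: ennreal_mult mult_ac)
      also have "\<dots> = ennreal (c n) * (\<integral>\<^sup>+h. ennreal (\<psi> \<eta> h powr (p + \<delta> n)) * indicator (cball 0 1) h \<partial>lborel)"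
        by (rule nn_integral_cmult) measurable
      also have "ennreal (c n) = ennreal (\<kappa> n * \<delta> n) * ennreal ((?N - a * \<delta> n) / (a * \<delta> n) * r powr (a * \<delta> n))"
        using n \<kappa>(1)[of n] \<delta>(1)[of n] a by (subst ennreal_mult[symmetric]) (auto simp: c_def)
      also have "\<dots> * (\<integral>\<^sup>+h. ennreal (\<psi> \<eta> h powr (p + \<delta> n)) * indicator (cball 0 1) h \<partial>lborel)
        \<le> ennreal (\<kappa> n * \<delta> n) * (\<integral>\<^sup>+h. ennreal (\<psi> \<eta> h powr (p + \<delta> n)) * ennreal (norm h powr (a * \<delta> n - ?N)) * indicator (cball 0 r) h \<partial>lborel)"
      proof -
        have "ennreal ((DIM(real^'n) - a * \<delta> n) / (a * \<delta> n) * r powr (a * \<delta> n)) * (\<integral>\<^sup>+h. ennreal (\<psi> \<eta> h powr (p + \<delta> n)) * indicator (cball 0 1) h \<partial>lborel)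
          \<le> (\<integral>\<^sup>+h. ennreal (\<psi> \<eta> h powr (p + \<delta> n)) * ennreal (norm h powr (a * \<delta> n - DIM(real^'n))) * indicator (cball 0 r) h \<partial>lborel)"
          using a \<delta>(1)[of n] n r by (intro homogeneous_integral_ge) (auto simp: hom)
        then show ?thesis by (simp add: mult.assoc mult_left_mono)
      qed
      also have "\<dots> \<le> ?T n"
        using low r p less_imp_le[OF \<delta>(1)[of n]]
        by (intro mult_left_mono nn_integral_mono)
           (auto simp: indicator_def ennreal_mult[symmetric] \<psi>_def intro!: ennreal_leI mult_right_mono powr_mono2)
      finally show ?case .
    qed
    have "(\<integral>\<^sup>+h. ennreal (k * ?N / a * \<psi> \<eta> h powr p) * indicator (cball 0 1) h \<partial>lborel)
      = (\<integral>\<^sup>+h. liminf (\<lambda>n. ennreal (c n * \<psi> \<eta> h powr (p + \<delta> n)) * indicator (cball 0 1) h) \<partial>lborel)"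
    proof (rule nn_integral_cong)
      fix h
      have "(\<lambda>n. \<psi> \<eta> h powr (p + \<delta> n)) \<longlonglongrightarrow> \<psi> \<eta> h powr (p + 0)"
        using \<delta> by (cases "\<psi> \<eta> h = 0") (simp, intro tendsto_intros, auto)
      then have "(\<lambda>n. c n * \<psi> \<eta> h powr (p + \<delta> n)) \<longlonglongrightarrow> k * ?N / a * \<psi> \<eta> h powr p"
        using tendsto_mult[OF c_lim] r by fastforce
      then have "(\<lambda>n. ennreal (c n * \<psi> \<eta> h powr (p + \<delta> n)) * indicator (cball 0 1) h) \<longlonglongrightarrow> ennreal (k * ?N / a * \<psi> \<eta> h powr p) * indicator (cball 0 1) h"
        by (cases "h \<in> cball 0 1") (auto intro: tendsto_ennrealI)
      then show "ennreal (k * ?N / a * \<psi> \<eta> h powr p) * indicator (cball 0 1) h = liminf (\<lambda>n. ennreal (c n * \<psi> \<eta> h powr (p + \<delta> n)) * indicator (cball 0 1) h)"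
        by (intro lim_imp_Liminf[symmetric]) auto
    qed
    also have "\<dots> \<le> liminf (\<lambda>n. \<integral>\<^sup>+h. ennreal (c n * \<psi> \<eta> h powr (p + \<delta> n)) * indicator (cball 0 1) h \<partial>lborel)"
      by (rule nn_integral_liminf) measurable
    also have "\<dots> \<le> liminf ?T" using ev by (rule Liminf_mono)
    finally show ?thesis .
  qed
  \<comment> \<open>A second use of Fatou's lemma, along \<eta> = 1/(m + 1), removes the error
    \<eta> from \<open>step\<close>.\<close>
  let ?g = "\<lambda>h::real^'n. \<bar>g \<bullet> (h /\<^sub>R norm h)\<bar>"
  have "ennreal (k / a) * (ennreal (K_const e p) * ennreal (norm g powr p)) =
     ennreal (k / a) * (of_nat CARD('n) * (\<integral>\<^sup>+h. ennreal (?g h powr p) * indicator (cball 0 1) h \<partial>lborel))"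
    using K_const_rotation[OF e, of p g] p by (simp add: mult_ac)
  also have "\<dots> = ennreal (k * ?N / a) * (\<integral>\<^sup>+h. ennreal (?g h powr p) * indicator (cball 0 1) h \<partial>lborel)"
    using k a by (simp add: mult.assoc[symmetric] ennreal_mult[symmetric] ennreal_of_nat_eq_real_of_nat)
  also have "\<dots> = (\<integral>\<^sup>+h. ennreal (k * ?N / a) * (ennreal (?g h powr p) * indicator (cball 0 1) h) \<partial>lborel)"
    by (rule nn_integral_cmult[symmetric]) measurable
  also have "\<dots> = (\<integral>\<^sup>+h. liminf (\<lambda>m. ennreal (k * ?N / a * \<psi> (inverse (Suc m)) h powr p) * indicator (cball 0 1) h) \<partial>lborel)"
  proof (rule nn_integral_cong)
    fix h
    have "(\<lambda>m. \<psi> (inverse (real (Suc m))) h) \<longlonglongrightarrow> max 0 (?g h - 0)"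
      unfolding \<psi>_def by (intro tendsto_intros LIMSEQ_inverse_real_of_nat)
    then have "(\<lambda>m. \<psi> (inverse (real (Suc m))) h powr p) \<longlonglongrightarrow> ?g h powr p"
      using p psi0 by (intro tendsto_powr') auto
    then have "(\<lambda>m. k * ?N / a * \<psi> (inverse (real (Suc m))) h powr p) \<longlonglongrightarrow> k * ?N / a * ?g h powr p"
      by (rule tendsto_mult_left)
    then have "(\<lambda>m. ennreal (k * ?N / a * \<psi> (inverse (real (Suc m))) h powr p) * indicator (cball 0 1) h) \<longlonglongrightarrow> ennreal (k * ?N / a * ?g h powr p) * indicator (cball 0 1) h"
      by (cases "h \<in> cball 0 1") (auto intro: tendsto_ennrealI)
    then have "liminf (\<lambda>m. ennreal (k * ?N / a * \<psi> (inverse (real (Suc m))) h powr p) * indicator (cball 0 1) h) = ennreal (k * ?N / a * ?g h powr p) * indicator (cball 0 1) h"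
      by (intro lim_imp_Liminf) auto
    moreover have "ennreal (k * ?N / a * ?g h powr p) = ennreal (k * ?N / a) * ennreal (?g h powr p)"
      using k a by (intro ennreal_mult) auto
    ultimately show "ennreal (k * ?N / a) * (ennreal (?g h powr p) * indicator (cball 0 1) h) = liminf (\<lambda>m. ennreal (k * ?N / a * \<psi> (inverse (Suc m)) h powr p) * indicator (cball 0 1) h)"
      by (simp only: mult.assoc)
  qed
  also have "\<dots> \<le> liminf (\<lambda>m. \<integral>\<^sup>+h. ennreal (k * ?N / a * \<psi> (inverse (Suc m)) h powr p) * indicator (cball 0 1) h \<partial>lborel)"
    by (rule nn_integral_liminf) measurable
  also have "\<dots> \<le> liminf (\<lambda>m::nat. liminf ?T)"
    by (intro Liminf_mono always_eventually allI step) auto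
  also have "\<dots> = liminf ?T" by (rule Liminf_const) simp
  finally show ?thesis .
qed

text \<open>Fatou's lemma in x on top of the pointwise lower limit. Only a lower bound is wanted, so
  no domination of the difference quotients enters.\<close>

lemma gradient_energy_le:
  fixes f :: "real^'n::finite \<Rightarrow> real" and G :: "real^'n \<Rightarrow> real^'n" and e :: "real^'n" and a p k :: real and \<kappa> \<delta> :: "nat \<Rightarrow> real"
  assumes f: "\<And>x. (f has_derivative (\<lambda>h. G x \<bullet> h)) (at x)" and [measurable]: "G \<in> borel_measurable borel"
    and e: "norm e = 1" and a: "0 < a" and p: "1 \<le> p"
    and \<delta>: "\<And>n. 0 < \<delta> n" "\<delta> \<longlonglongrightarrow> 0" and \<kappa>: "\<And>n. 0 \<le> \<kappa> n" "\<kappa> \<longlonglongrightarrow> k"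
    and le: "\<forall>\<^sub>F n in sequentially. ennreal (\<kappa> n * \<delta> n) * (\<integral>\<^sup>+x. \<integral>\<^sup>+h. ennreal ((\<bar>f (x + h) - f x\<bar> / norm h) powr (p + \<delta> n) *
      norm h powr (a * \<delta> n - CARD('n))) * indicator (cball 0 1) h \<partial>lborel \<partial>lborel) \<le> c"
  shows "ennreal (k / a * K_const e p) * (\<integral>\<^sup>+x. ennreal (norm (G x) powr p) \<partial>lborel) \<le> c"
proof -
  have [measurable]: "f \<in> borel_measurable borel"
    using f by (intro borel_measurable_continuous_onI continuous_at_imp_continuous_on ballI has_derivative_continuous)
  have k: "0 \<le> k" using \<kappa> by (intro LIMSEQ_le_const[OF \<kappa>(2)]) auto
  let ?I = "\<lambda>n x. (\<integral>\<^sup>+h. ennreal ((\<bar>f (x + h) - f x\<bar> / norm h) powr (p + \<delta> n) *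
      norm h powr (a * \<delta> n - CARD('n))) * indicator (cball 0 1) h \<partial>lborel)"
  have "ennreal (k / a * K_const e p) * (\<integral>\<^sup>+x. ennreal (norm (G x) powr p) \<partial>lborel)
    = (\<integral>\<^sup>+x. ennreal (k / a * K_const e p) * ennreal (norm (G x) powr p) \<partial>lborel)"
    by (simp add: nn_integral_cmult)
  also have "\<dots> \<le> (\<integral>\<^sup>+x. liminf (\<lambda>n. ennreal (\<kappa> n * \<delta> n) * ?I n x) \<partial>lborel)"
  proof (rule nn_integral_mono)
    fix x
    have "e \<noteq> 0" using e by auto
    then have "ennreal (k / a * K_const e p) * ennreal (norm (G x) powr p) = ennreal (k / a) * (ennreal (K_const e p) * ennreal (norm (G x) powr p))"
      using k a K_const_pos[of p e] p e by (subst ennreal_mult) (auto simp: mult.assoc)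
    also have "\<dots> \<le> liminf (\<lambda>n. ennreal (\<kappa> n * \<delta> n) * ?I n x)"
      by (intro directional_liminf f e a p \<delta> \<kappa>) measurable
    finally show "ennreal (k / a * K_const e p) * ennreal (norm (G x) powr p) \<le> liminf (\<lambda>n. ennreal (\<kappa> n * \<delta> n) * ?I n x)" .
  qed
  also have "\<dots> \<le> liminf (\<lambda>n. \<integral>\<^sup>+x. ennreal (\<kappa> n * \<delta> n) * ?I n x \<partial>lborel)"
    by (rule nn_integral_liminf) measurable
  also have "\<dots> = liminf (\<lambda>n. ennreal (\<kappa> n * \<delta> n) * (\<integral>\<^sup>+x. ?I n x \<partial>lborel))"
    by (simp add: nn_integral_cmult)
  also have "\<dots> \<le> liminf (\<lambda>n::nat. c)" using le by (rule Liminf_mono)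
  also have "\<dots> = c" by (rule Liminf_const) simp
  finally show ?thesis .
qed

section \<open>The functional in terms of differences\<close>

lemma sigma_finite_lebesgue: "sigma_finite_measure (lebesgue :: 'a::euclidean_space measure)"
proof
  obtain A :: "'a set set" where A: "countable A" "A \<subseteq> sets lborel" "\<Union>A = space lborel" "\<forall>a\<in>A. emeasure lborel a \<noteq> \<infinity>"
    using lborel.sigma_finite_countable by auto
  then show "\<exists>A. countable A \<and> A \<subseteq> sets (lebesgue :: 'a measure) \<and> \<Union>A = space lebesgue \<and> (\<forall>a\<in>A. emeasure lebesgue a \<noteq> \<infinity>)"
    by (intro exI[of _ A]) (auto simp: subset_eq)
qed

text \<open>The substitution y = x + h. It is made for a Borel representative v because
  \<open>v (x + h)\<close> is then jointly Borel measurable, as the later uses of Tonelli's theorem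
  require; u itself is only Lebesgue measurable.\<close>

lemma Phi_lam_eq:
  fixes u v :: "real^'n::finite \<Rightarrow> real"
  assumes [measurable]: "u \<in> borel_measurable lebesgue" "v \<in> borel_measurable borel" and uv: "AE x in lborel. u x = v x"
  shows "Phi_lam p \<gamma> l u = ennreal (l powr p) * (\<integral>\<^sup>+z. ennreal (norm (snd z) powr (- real CARD('n) + \<gamma>)) *
     indicator {l<..} (\<bar>v (fst z + snd z) - v (fst z)\<bar> / norm (snd z) powr (1 + \<gamma> / p)) \<partial>(lborel \<Otimes>\<^sub>M lborel))"
proof -
  interpret L: sigma_finite_measure "lebesgue :: (real^'n) measure"
    by (rule sigma_finite_lebesgue)
  let ?\<rho> = "\<lambda>h::real^'n. ennreal (norm h powr (- real CARD('n) + \<gamma>))"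
  let ?A = "\<lambda>u. {(x, y). \<bar>u x - u y\<bar> / norm (x - y) powr (1 + \<gamma> / p) > l}"
  let ?f = "\<lambda>u (x, y). ?\<rho> (x - y) * indicator (?A u) (x, y)"
  have [measurable]: "(\<lambda>x. x) \<in> (lebesgue :: (real^'n) measure) \<rightarrow>\<^sub>M borel" by (intro measurable_completion) simp
  have [measurable]: "fst \<in> (lebesgue \<Otimes>\<^sub>M lebesgue :: ((real^'n) \<times> (real^'n)) measure) \<rightarrow>\<^sub>M borel"
    "snd \<in> (lebesgue \<Otimes>\<^sub>M lebesgue :: ((real^'n) \<times> (real^'n)) measure) \<rightarrow>\<^sub>M borel"
    using measurable_compose[OF measurable_fst] measurable_compose[OF measurable_snd] by (auto simp: comp_def)
  have "(\<lambda>z. \<bar>u (fst z) - u (snd z)\<bar> / norm (fst z - snd z) powr (1 + \<gamma> / p)) \<in> borel_measurable (lebesgue \<Otimes>\<^sub>M lebesgue)"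
    by measurable
  then have "(\<lambda>z. ?\<rho> (fst z - snd z) * indicator {l<..} (\<bar>u (fst z) - u (snd z)\<bar> / norm (fst z - snd z) powr (1 + \<gamma> / p))) \<in> borel_measurable (lebesgue \<Otimes>\<^sub>M lebesgue)"
    by measurable
  also have "(\<lambda>z. ?\<rho> (fst z - snd z) * indicator {l<..} (\<bar>u (fst z) - u (snd z)\<bar> / norm (fst z - snd z) powr (1 + \<gamma> / p))) = ?f u"
    by (auto simp: fun_eq_iff indicator_def)
  finally have "(\<integral>\<^sup>+z. ?f u z \<partial>(lebesgue \<Otimes>\<^sub>M lebesgue)) = (\<integral>\<^sup>+x. \<integral>\<^sup>+y. ?f u (x, y) \<partial>lborel \<partial>lborel)"
    by (subst L.nn_integral_fst[symmetric]) (simp_all add: nn_integral_completion)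
  also have "\<dots> = (\<integral>\<^sup>+x. \<integral>\<^sup>+h. ?\<rho> h * indicator {l<..} (\<bar>v (x + h) - v x\<bar> / norm h powr (1 + \<gamma> / p)) \<partial>lborel \<partial>lborel)"
  proof (rule nn_integral_cong_AE)
    show "AE x in lborel. (\<integral>\<^sup>+y. ?f u (x, y) \<partial>lborel) = (\<integral>\<^sup>+h. ?\<rho> h * indicator {l<..} (\<bar>v (x + h) - v x\<bar> / norm h powr (1 + \<gamma> / p)) \<partial>lborel)"
      using uv
    proof eventually_elim
      case (elim x)
      have "(\<integral>\<^sup>+y. ?f u (x, y) \<partial>lborel) = (\<integral>\<^sup>+y. ?\<rho> (x - y) * indicator {l<..} (\<bar>v x - v y\<bar> / norm (x - y) powr (1 + \<gamma> / p)) \<partial>lborel)"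
        using uv by (intro nn_integral_cong_AE, eventually_elim) (auto simp: elim indicator_def)
      also have "\<dots> = (\<integral>\<^sup>+h. ?\<rho> (x - (x + h)) * indicator {l<..} (\<bar>v x - v (x + h)\<bar> / norm (x - (x + h)) powr (1 + \<gamma> / p)) \<partial>lborel)"
        by (rule nn_integral_lborel_shift[symmetric]) measurable
      finally show ?case by (simp add: abs_minus_commute)
    qed
  qed
  also have "\<dots> = (\<integral>\<^sup>+z. ?\<rho> (snd z) * indicator {l<..} (\<bar>v (fst z + snd z) - v (fst z)\<bar> / norm (snd z) powr (1 + \<gamma> / p)) \<partial>(lborel \<Otimes>\<^sub>M lborel))"
    by (subst lborel.nn_integral_fst[symmetric]) simp_all
  finally show ?thesis unfolding Phi_lam_def by simp
qed

lemma truncated_energy_le: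
  fixes u v :: "real^'n::finite \<Rightarrow> real" and p \<gamma> M :: real
  assumes [measurable]: "u \<in> borel_measurable lebesgue" "v \<in> borel_measurable borel" and uv: "AE x in lborel. u x = v x"
    and p: "1 \<le> p" and \<gamma>: "-1 < \<gamma>" 
    and c: "Limsup (at_right 0) (\<lambda>l. Phi_lam p \<gamma> l u) + Limsup at_top (\<lambda>l. Phi_lam p \<gamma> l u) < c"
    and w: "w = (\<lambda>x. max (- M) (min M (v x)))" and M: "0 \<le> M"
  shows "\<forall>\<^sub>F \<delta> in at_right 0. ennreal (max 1 (2 * M) powr (- 2 * \<delta>) / (p + \<delta>) * \<delta>) *
    (\<integral>\<^sup>+x. \<integral>\<^sup>+h. ennreal ((\<bar>w (x + h) - w x\<bar> / norm h) powr (p + \<delta>) *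
      norm h powr ((2 + \<gamma> / p) * \<delta> - CARD('n))) * indicator (cball 0 1) h \<partial>lborel \<partial>lborel) \<le> c"
proof -
  let ?N = "real CARD('n)" and ?C = "max 1 (2 * M)"
  let ?\<rho> = "\<lambda>z::(real^'n)\<times>(real^'n). ennreal (norm (snd z) powr (- ?N + \<gamma>))"
  let ?Q = "\<lambda>v z. \<bar>v (fst z + snd z) - v (fst z) :: real\<bar> / norm (snd z :: real^'n) powr (1 + \<gamma> / p)"
  have [measurable]: "w \<in> borel_measurable borel" unfolding w by measurable
  have s: "0 < 1 + \<gamma> / p" using p \<gamma> by (auto simp: field_simps)
  have "Limsup F (\<lambda>l. ennreal (l powr p) * (\<integral>\<^sup>+z. ?\<rho> z * indicator {l<..} (?Q w z) \<partial>(lborel \<Otimes>\<^sub>M lborel)))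
    \<le> Limsup F (\<lambda>l. Phi_lam p \<gamma> l u)" for F
  proof (intro Limsup_mono always_eventually allI)
    fix l
    have "?Q w z \<le> ?Q v z" for z
      unfolding w by (intro divide_right_mono) auto
    then have "indicator {l<..} (?Q w z) \<le> (indicator {l<..} (?Q v z) :: ennreal)" for z
      using order_less_le_trans[of l "?Q w z" "?Q v z"] by (auto simp: indicator_def)
    then show "ennreal (l powr p) * (\<integral>\<^sup>+z. ?\<rho> z * indicator {l<..} (?Q w z) \<partial>(lborel \<Otimes>\<^sub>M lborel)) \<le> Phi_lam p \<gamma> l u"
      unfolding Phi_lam_eq[OF assms(1,2) uv] by (intro mult_left_mono nn_integral_mono) auto
  qed
  from add_mono[OF this this] c
  have "Limsup (at_right 0) (\<lambda>l. ennreal (l powr p) * (\<integral>\<^sup>+z. ?\<rho> z * indicator {l<..} (?Q w z) \<partial>(lborel \<Otimes>\<^sub>M lborel)))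
    + Limsup at_top (\<lambda>l. ennreal (l powr p) * (\<integral>\<^sup>+z. ?\<rho> z * indicator {l<..} (?Q w z) \<partial>(lborel \<Otimes>\<^sub>M lborel))) < c"
    by (rule order_le_less_trans)
  then have "\<forall>\<^sub>F \<delta> in at_right 0. (\<integral>\<^sup>+z. ennreal (\<delta> / (p + \<delta>) * ?Q w z powr (p + \<delta>) * max 1 (?Q w z) powr (- 2 * \<delta>)) * ?\<rho> z \<partial>(lborel \<Otimes>\<^sub>M lborel)) \<le> c"
  proof (intro averaging p)
    show "sigma_finite_measure (lborel \<Otimes>\<^sub>M lborel :: ((real^'n) \<times> (real^'n)) measure)"
      unfolding lborel_prod by (rule sigma_finite_lborel)
    show "?\<rho> \<in> borel_measurable (lborel \<Otimes>\<^sub>M lborel)" by measurable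
    show "?Q w \<in> borel_measurable (lborel \<Otimes>\<^sub>M lborel)" by measurable
  qed auto
  moreover have "\<forall>\<^sub>F \<delta>::real in at_right 0. 0 < \<delta>" by (rule eventually_at_right_less)
  ultimately show ?thesis
  proof eventually_elim
    case (elim \<delta>)
    let ?E = "\<lambda>x h. ennreal ((\<bar>w (x + h) - w x\<bar> / norm h) powr (p + \<delta>) *
      norm h powr ((2 + \<gamma> / p) * \<delta> - ?N)) * indicator (cball 0 1) h"
    have "ennreal (?C powr (- 2 * \<delta>) / (p + \<delta>) * \<delta>) * (\<integral>\<^sup>+x. \<integral>\<^sup>+h. ?E x h \<partial>lborel \<partial>lborel)
      = ennreal (?C powr (- 2 * \<delta>) / (p + \<delta>) * \<delta>) * (\<integral>\<^sup>+z. ?E (fst z) (snd z) \<partial>(lborel \<Otimes>\<^sub>M lborel))"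
      by (subst lborel.nn_integral_fst[symmetric]) simp_all
    also have "\<dots> = (\<integral>\<^sup>+z. ennreal (?C powr (- 2 * \<delta>) / (p + \<delta>) * \<delta>) * ?E (fst z) (snd z) \<partial>(lborel \<Otimes>\<^sub>M lborel))"
      by (rule nn_integral_cmult[symmetric]) measurable
    also have "\<dots> \<le> (\<integral>\<^sup>+z. ennreal (\<delta> / (p + \<delta>) * ?Q w z powr (p + \<delta>) * max 1 (?Q w z) powr (- 2 * \<delta>)) * ?\<rho> z \<partial>(lborel \<Otimes>\<^sub>M lborel))"
    proof (rule nn_integral_mono)
      fix z :: "(real^'n)\<times>(real^'n)"
      obtain x h where z: "z = (x, h)" by (cases z)
      show "ennreal (?C powr (- 2 * \<delta>) / (p + \<delta>) * \<delta>) * ?E (fst z) (snd z)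
        \<le> ennreal (\<delta> / (p + \<delta>) * ?Q w z powr (p + \<delta>) * max 1 (?Q w z) powr (- 2 * \<delta>)) * ?\<rho> z"
      proof (cases "h \<noteq> 0 \<and> norm h \<le> 1")
        case False
        then show ?thesis by (auto simp: z)
      next
        case True
        define t where "t = norm h"
        define D where "D = \<bar>w (x + h) - w x\<bar>"
        have t: "0 < t" "t \<le> 1" using True by (auto simp: t_def)
        have D: "0 \<le> D" "D \<le> 2 * M" using M by (auto simp: D_def w)
        \<comment> \<open>Here |h| \<le> 1 and the positivity of 1 + \<gamma>/p enter: the power of
          t is at least 1, so it also absorbs the constant 1 in \<open>max 1 Q\<close>.\<close>
        have one: "1 \<le> t powr - (1 + \<gamma> / p)" using powr_mono2'[of "- (1 + \<gamma> / p)" t 1] t s by simp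
        have Q: "?Q w z = D * t powr - (1 + \<gamma> / p)" by (simp only: z D_def t_def powr_minus divide_inverse fst_conv snd_conv)
        have "D * t powr - (1 + \<gamma> / p) \<le> ?C * t powr - (1 + \<gamma> / p)" using D by (intro mult_right_mono) auto
        moreover have "1 * 1 \<le> ?C * t powr - (1 + \<gamma> / p)" using one by (intro mult_mono) auto
        ultimately have "max 1 (?Q w z) \<le> ?C * t powr - (1 + \<gamma> / p)" unfolding Q mult_1 by (rule max.boundedI[rotated])
        moreover have "0 < max 1 (?Q w z)" by (rule less_le_trans[OF zero_less_one max.cobounded1])
        moreover have "- 2 * \<delta> \<le> 0" using elim(2) by simp
        ultimately have "(?C * t powr - (1 + \<gamma> / p)) powr (- 2 * \<delta>) \<le> max 1 (?Q w z) powr (- 2 * \<delta>)"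
          by (intro powr_mono2')
        moreover have "(t powr - (1 + \<gamma> / p)) powr (- 2 * \<delta>) = t powr (2 * \<delta> * (1 + \<gamma> / p))"
        proof -
          have "- s * (- 2 * d) = 2 * d * s" for s d :: real by simp
          then show ?thesis by (simp only: powr_powr)
        qed
        then have "(?C * t powr - (1 + \<gamma> / p)) powr (- 2 * \<delta>) = ?C powr (- 2 * \<delta>) * t powr (2 * \<delta> * (1 + \<gamma> / p))"
          by (simp only: powr_mult)
        ultimately have 1: "?C powr (- 2 * \<delta>) * t powr (2 * \<delta> * (1 + \<gamma> / p)) \<le> max 1 (?Q w z) powr (- 2 * \<delta>)" by simp
        have 2: "?Q w z powr (p + \<delta>) = D powr (p + \<delta>) * t powr (- (1 + \<gamma> / p) * (p + \<delta>))"
          unfolding Q using D by (simp add: powr_mult powr_powr)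
        have 3: "(D / t) powr (p + \<delta>) = D powr (p + \<delta>) * t powr (- (p + \<delta>))"
          by (simp only: divide_inverse powr_mult powr_minus inverse_powr)
        \<comment> \<open>Origin of the kernel exponent. Since (1 + \<gamma>/p) p = p + \<gamma>,
          the \<gamma> of the original kernel cancels. The powers of Q and of \<open>max 1 Q\<close>
          leave (1 + \<gamma>/p) \<delta>, and one more \<delta> comes from the denominator |h| of
          the difference quotient.\<close>
        have "- (p + \<delta>) + ((2 + \<gamma> / p) * \<delta> - ?N) = - (1 + \<gamma> / p) * (p + \<delta>) + (2 * \<delta> * (1 + \<gamma> / p)) + (- ?N + \<gamma>)"
          using p by (simp add: field_simps)
        then have 4: "t powr (- (p + \<delta>)) * t powr ((2 + \<gamma> / p) * \<delta> - ?N) =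
          t powr (- (1 + \<gamma> / p) * (p + \<delta>)) * t powr (2 * \<delta> * (1 + \<gamma> / p)) * t powr (- ?N + \<gamma>)"
          by (simp only: powr_add[symmetric])
        have "?C powr (- 2 * \<delta>) / (p + \<delta>) * \<delta> * ((D / t) powr (p + \<delta>) * t powr ((2 + \<gamma> / p) * \<delta> - ?N))
          = \<delta> / (p + \<delta>) * D powr (p + \<delta>) * ?C powr (- 2 * \<delta>) * (t powr (- (p + \<delta>)) * t powr ((2 + \<gamma> / p) * \<delta> - ?N))"
          unfolding 3 by (simp add: mult_ac)
        also have "\<dots> = (\<delta> / (p + \<delta>) * ?Q w z powr (p + \<delta>)) * (?C powr (- 2 * \<delta>) * t powr (2 * \<delta> * (1 + \<gamma> / p))) * t powr (- ?N + \<gamma>)"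
          unfolding 4 2 by (simp add: mult_ac)
        also have "\<dots> \<le> (\<delta> / (p + \<delta>) * ?Q w z powr (p + \<delta>)) * max 1 (?Q w z) powr (- 2 * \<delta>) * t powr (- ?N + \<gamma>)"
          using 1 elim(2) p by (intro mult_right_mono mult_left_mono) auto
        finally show ?thesis using True elim(2) p
          by (simp add: z t_def[symmetric] D_def[symmetric] ennreal_mult[symmetric] ennreal_leI)
      qed
    qed
    also have "\<dots> \<le> c" by (rule elim)
    finally show ?case .
  qed
qed

text \<open>For fixed x and h, Jensen's inequality bounds the power of the averaged difference by
  the average of the powers. For fixed h, Tonelli's theorem and translation invariance then
  reproduce the energy of v, since \<rho> has mass one.\<close>

lemma convolution_energy_le:
  fixes v \<rho> w :: "'a::euclidean_space \<Rightarrow> real" and W :: "'a \<Rightarrow> ennreal" and q :: real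
  assumes [measurable]: "v \<in> borel_measurable borel" "W \<in> borel_measurable borel"
    and v: "\<And>x. \<bar>v x\<bar> \<le> M" and q: "1 \<le> q"
    and \<rho>: "\<And>z. 0 \<le> \<rho> z" "integrable lborel \<rho>" "(\<integral>z. \<rho> z \<partial>lborel) = 1"
    and w: "w = (\<lambda>x. \<integral>z. \<rho> z * v (x - z) \<partial>lborel)"
  shows "(\<integral>\<^sup>+x. \<integral>\<^sup>+h. ennreal (\<bar>w (x + h) - w x\<bar> powr q) * W h \<partial>lborel \<partial>lborel)
    \<le> (\<integral>\<^sup>+x. \<integral>\<^sup>+h. ennreal (\<bar>v (x + h) - v x\<bar> powr q) * W h \<partial>lborel \<partial>lborel)"
proof -
  have [measurable]: "\<rho> \<in> borel_measurable borel" using \<rho>(2) by auto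
  have int: "integrable lborel (\<lambda>z. \<rho> z * v (x - z))" for x
    by (rule Bochner_Integration.integrable_bound[OF integrable_mult_right[OF \<rho>(2), of M]])
       (use v \<rho>(1) in \<open>auto simp: abs_mult mult.commute[of M] intro!: mult_left_mono order_trans[OF _ abs_ge_self]\<close>)
  have [measurable]: "w \<in> borel_measurable borel" unfolding w by measurable
  have pt: "ennreal (\<bar>w (x + h) - w x\<bar> powr q) \<le> (\<integral>\<^sup>+z. ennreal (\<rho> z * \<bar>v (x + h - z) - v (x - z)\<bar> powr q) \<partial>lborel)" for x h
  proof -
    have "w (x + h) - w x = (\<integral>z. \<rho> z * (v (x + h - z) - v (x - z)) \<partial>lborel)"
      unfolding w right_diff_distrib by (rule Bochner_Integration.integral_diff[OF int int, symmetric])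
    moreover have "integrable lborel (\<lambda>z. \<rho> z * (v (x + h - z) - v (x - z)))"
      unfolding right_diff_distrib by (rule Bochner_Integration.integrable_diff[OF int int])
    ultimately show ?thesis using powr_integral_le[OF q \<rho>, of "\<lambda>z. v (x + h - z) - v (x - z)"] by simp
  qed
  have "(\<integral>\<^sup>+x. \<integral>\<^sup>+h. ennreal (\<bar>w (x + h) - w x\<bar> powr q) * W h \<partial>lborel \<partial>lborel)
    = (\<integral>\<^sup>+h. \<integral>\<^sup>+x. ennreal (\<bar>w (x + h) - w x\<bar> powr q) * W h \<partial>lborel \<partial>lborel)"
    by (rule lborel_pair.Fubini'[symmetric]) measurable
  also have "\<dots> \<le> (\<integral>\<^sup>+h. \<integral>\<^sup>+x. ennreal (\<bar>v (x + h) - v x\<bar> powr q) * W h \<partial>lborel \<partial>lborel)"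
  proof (rule nn_integral_mono)
    fix h :: 'a
    have "(\<integral>\<^sup>+x. ennreal (\<bar>w (x + h) - w x\<bar> powr q) \<partial>lborel) \<le>
      (\<integral>\<^sup>+x. (\<integral>\<^sup>+z. ennreal (\<rho> z * \<bar>v (x + h - z) - v (x - z)\<bar> powr q) \<partial>lborel) \<partial>lborel)"
      by (intro nn_integral_mono pt)
    also have "\<dots> = (\<integral>\<^sup>+z. (\<integral>\<^sup>+x. ennreal (\<rho> z * \<bar>v (x + h - z) - v (x - z)\<bar> powr q) \<partial>lborel) \<partial>lborel)"
      by (rule lborel_pair.Fubini'[symmetric]) measurable
    also have "\<dots> = (\<integral>\<^sup>+z. ennreal (\<rho> z) * (\<integral>\<^sup>+x. ennreal (\<bar>v (x + h) - v x\<bar> powr q) \<partial>lborel) \<partial>lborel)"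
    proof (rule nn_integral_cong)
      fix z
      have "(\<integral>\<^sup>+x. ennreal (\<rho> z * \<bar>v (x + h - z) - v (x - z)\<bar> powr q) \<partial>lborel)
        = (\<integral>\<^sup>+x. ennreal (\<rho> z) * ennreal (\<bar>v (- z + x + h) - v (- z + x)\<bar> powr q) \<partial>lborel)"
        using \<rho>(1) by (simp add: ennreal_mult algebra_simps)
      also have "\<dots> = ennreal (\<rho> z) * (\<integral>\<^sup>+x. ennreal (\<bar>v (- z + x + h) - v (- z + x)\<bar> powr q) \<partial>lborel)"
        by (rule nn_integral_cmult) measurable
      also have "(\<integral>\<^sup>+x. ennreal (\<bar>v (- z + x + h) - v (- z + x)\<bar> powr q) \<partial>lborel) = (\<integral>\<^sup>+x. ennreal (\<bar>v (x + h) - v x\<bar> powr q) \<partial>lborel)"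
        by (rule nn_integral_lborel_shift) measurable
      finally show "(\<integral>\<^sup>+x. ennreal (\<rho> z * \<bar>v (x + h - z) - v (x - z)\<bar> powr q) \<partial>lborel)
        = ennreal (\<rho> z) * (\<integral>\<^sup>+x. ennreal (\<bar>v (x + h) - v x\<bar> powr q) \<partial>lborel)" .
    qed
    also have "\<dots> = (\<integral>\<^sup>+z. ennreal (\<rho> z) \<partial>lborel) * (\<integral>\<^sup>+x. ennreal (\<bar>v (x + h) - v x\<bar> powr q) \<partial>lborel)"
      by (rule nn_integral_multc) measurable
    also have "(\<integral>\<^sup>+z. ennreal (\<rho> z) \<partial>lborel) = 1"
      using nn_integral_eq_integral[OF \<rho>(2)] \<rho> by simp
    finally show "(\<integral>\<^sup>+x. ennreal (\<bar>w (x + h) - w x\<bar> powr q) * W h \<partial>lborel) \<le> (\<integral>\<^sup>+x. ennreal (\<bar>v (x + h) - v x\<bar> powr q) * W h \<partial>lborel)"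
      by (simp add: nn_integral_multc mult_right_mono)
  qed
  also have "\<dots> = (\<integral>\<^sup>+x. \<integral>\<^sup>+h. ennreal (\<bar>v (x + h) - v x\<bar> powr q) * W h \<partial>lborel \<partial>lborel)"
    by (rule lborel_pair.Fubini') measurable
  finally show ?thesis .
qed

section \<open>Mollification\<close>

text \<open>The derivative \<open>2 * max 0 t\<close> of the squared positive part is Lipschitz with
  constant 2, which makes the first-order remainder at most the square of the increment.\<close>

lemma positive_part_square_expansion:
  fixes t s :: real
  shows "\<bar>(max 0 (t + s))\<^sup>2 - (max 0 t)\<^sup>2 - 2 * max 0 t * s\<bar> \<le> s\<^sup>2"
proof -
  consider "0 \<le> t" "0 \<le> t + s" | "0 \<le> t" "t + s < 0" | "t < 0" "0 \<le> t + s" | "t < 0" "t + s < 0" by linarith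
  then show ?thesis
  proof cases
    case 1
    then show ?thesis by (simp add: max_def power2_eq_square algebra_simps)
  next
    case 2
    have "0 \<le> (t + s)\<^sup>2" by simp
    \<comment> \<open>In this case the expression inside the absolute value is exactly this product;
      the square above says that it is at most \<open>s * s\<close>.\<close>
    moreover have "0 \<le> (- t) * (t + 2 * s)" using 2 by (intro mult_nonpos_nonpos) linarith+
    ultimately have "0 \<le> (t + s)\<^sup>2" "0 \<le> (- t) * (t + 2 * s)" .
    then show ?thesis using 2 by (auto simp: max_def power2_eq_square algebra_simps abs_le_iff)
  next
    case 3
    have "(t + s) * (t + s) \<le> s * s" using 3 by (intro mult_mono) auto
    then show ?thesis using 3 by (simp add: max_def power2_eq_square)
  next
    case 4
    then show ?thesis by (simp add: max_def)
  qed
qed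

text \<open>The normalised kernel is a multiple of the square of the positive part of
  \<open>\<epsilon>\<^sup>2 - \<bar>z\<bar>\<^sup>2\<close>, which is of class \<open>C\<^sup>1\<close> with Lipschitz gradient.\<close>

lemma mollifier_exists:
  fixes \<epsilon> :: real
  assumes "0 < \<epsilon>"
  obtains \<rho> :: "'a::euclidean_space \<Rightarrow> real" and g :: "'a \<Rightarrow> 'a" and C :: real
  where "\<And>z. 0 \<le> \<rho> z" "integrable lborel \<rho>" "(\<integral>z. \<rho> z \<partial>lborel) = 1" "\<And>z. \<epsilon> < norm z \<Longrightarrow> \<rho> z = 0"
    "g \<in> borel_measurable borel" "0 \<le> C" "\<And>z. norm (g z) \<le> C * indicator (cball 0 (\<epsilon> + 1)) z"
    "\<And>z h. norm h \<le> 1 \<Longrightarrow> \<bar>\<rho> (z + h) - \<rho> z - g z \<bullet> h\<bar> \<le> C * (norm h)\<^sup>2 * indicator (cball 0 (\<epsilon> + 1)) z"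
proof -
  define B :: "'a \<Rightarrow> real" where "B = (\<lambda>z. max 0 (\<epsilon>\<^sup>2 - (norm z)\<^sup>2))"
  have Bm[measurable]: "B \<in> borel_measurable borel" unfolding B_def by measurable
  have B0: "0 \<le> B z" "B z \<le> \<epsilon>\<^sup>2" for z by (auto simp: B_def)
  have Bz: "B z = 0" if "\<epsilon> \<le> norm z" for z using that assms power_mono[of \<epsilon> "norm z" 2] by (simp add: B_def)
  have int: "integrable lborel (\<lambda>z. (B z)\<^sup>2)"
  proof (rule Bochner_Integration.integrable_bound[where f="\<lambda>z. (\<epsilon>\<^sup>2)\<^sup>2 * indicator (cball 0 \<epsilon>) z"])
    show "integrable lborel (\<lambda>z::'a. (\<epsilon>\<^sup>2)\<^sup>2 * indicator (cball 0 \<epsilon>) z :: real)"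
      using emeasure_lborel_cball_finite[of "0::'a" \<epsilon>] by (intro integrable_mult_right integrable_real_indicator) auto
    have "norm ((B z)\<^sup>2) \<le> norm ((\<epsilon>\<^sup>2)\<^sup>2 * indicator (cball 0 \<epsilon>) z :: real)" for z
      using B0[of z] Bz[of z] power_mono[of "B z" "\<epsilon>\<^sup>2" 2] by (auto simp: indicator_def)
    then show "AE z in lborel. norm ((B z)\<^sup>2) \<le> norm ((\<epsilon>\<^sup>2)\<^sup>2 * indicator (cball 0 \<epsilon>) z :: real)" by simp
  qed measurable
  define I where "I = (\<integral>z. (B z)\<^sup>2 \<partial>lborel)"
  have "I \<noteq> 0"
  proof
    assume "I = 0"
    then have "AE z in lborel. (B z)\<^sup>2 = 0"
      unfolding I_def using int by (subst (asm) integral_nonneg_eq_0_iff_AE) auto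
    then have "AE z in lborel. z \<notin> ball (0::'a) \<epsilon>"
    proof eventually_elim
      case (elim z)
      then have "\<epsilon>\<^sup>2 \<le> (norm z)\<^sup>2" by (simp add: B_def max_def split: if_splits)
      then show ?case using assms by (auto dest: power2_le_imp_le)
    qed
    then have "emeasure lborel (ball (0::'a) \<epsilon>) = 0" by (subst (asm) AE_iff_null_sets[symmetric]) auto
    then show False using open_not_negligible[of "ball (0::'a) \<epsilon>"] assms
      by (auto simp: negligible_iff_null_sets null_sets_def)
  qed
  moreover have "0 \<le> I" unfolding I_def by (intro integral_nonneg_AE) auto
  ultimately have I: "0 < I" by simp
  \<comment> \<open>The first summand is the constant of the quadratic remainder, the second the
    bound on the gradient; their sum serves for both.\<close>
  define C where "C = ((2 * (\<epsilon> + 1) + 1)\<^sup>2 + 2 * \<epsilon>\<^sup>2) / I + 4 * \<epsilon>\<^sup>2 * (\<epsilon> + 1) / I"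
  define \<rho> where "\<rho> = (\<lambda>z. (B z)\<^sup>2 / I)"
  define g where "g = (\<lambda>z. (- 4 * B z / I) *\<^sub>R z)"
  have C: "0 \<le> C" "((2 * (\<epsilon> + 1) + 1)\<^sup>2 + 2 * \<epsilon>\<^sup>2) / I \<le> C" "4 * \<epsilon>\<^sup>2 * (\<epsilon> + 1) / I \<le> C"
    using I assms by (auto simp: C_def)
  show thesis
  proof
    show "integrable lborel \<rho>" unfolding \<rho>_def using int by simp
    show "(\<integral>z. \<rho> z \<partial>lborel) = 1" unfolding \<rho>_def using I by (simp add: I_def[symmetric])
    show "g \<in> borel_measurable borel" unfolding g_def by measurable
    show "norm (g z) \<le> C * indicator (cball 0 (\<epsilon> + 1)) z" for z
    proof (cases "\<epsilon> \<le> norm z")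
      case True then show ?thesis using C by (simp add: g_def Bz)
    next
      case False
      have "norm (g z) = 4 * B z * norm z / I" using B0[of z] I by (simp add: g_def)
      also have "\<dots> \<le> 4 * \<epsilon>\<^sup>2 * (\<epsilon> + 1) / I" using B0[of z] I False by (intro divide_right_mono mult_mono) auto
      finally show ?thesis using C False by (simp add: indicator_def)
    qed
    fix z h :: 'a assume h: "norm h \<le> 1"
    show "\<bar>\<rho> (z + h) - \<rho> z - g z \<bullet> h\<bar> \<le> C * (norm h)\<^sup>2 * indicator (cball 0 (\<epsilon> + 1)) z"
    proof (cases "norm z \<le> \<epsilon> + 1")
      case False
      then have "\<epsilon> \<le> norm (z + h)" using h norm_diff_triangle_ineq[of z h 0 0] norm_triangle_ineq4[of "z + h" h] by simp
      then show ?thesis using False by (simp add: \<rho>_def g_def Bz)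
    next
      case True
      \<comment> \<open>The increment of \<epsilon>^2 - |z|^2 under the shift by h. Its linear part
        produces \<open>g z \<bullet> h\<close>; its quadratic part is moved into the
        remainder.\<close>
      define s where "s = - (2 * (z \<bullet> h) + (norm h)\<^sup>2)"
      define t where "t = \<epsilon>\<^sup>2 - (norm z)\<^sup>2"
      have 1: "B (z + h) = max 0 (t + s)" "B z = max 0 t"
        by (auto simp: B_def t_def s_def power2_norm_eq_inner inner_add_left inner_add_right inner_commute)
      have "\<bar>z \<bullet> h\<bar> \<le> (\<epsilon> + 1) * norm h"
        using Cauchy_Schwarz_ineq2[of z h] mult_right_mono[OF True norm_ge_zero[of h]] by linarith
      moreover have "(norm h)\<^sup>2 \<le> norm h" using h by (simp add: power2_eq_square mult_left_le)
      moreover have "\<bar>s\<bar> \<le> 2 * \<bar>z \<bullet> h\<bar> + (norm h)\<^sup>2"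
        unfolding s_def using zero_le_power2[of "norm h"] by linarith
      ultimately have "\<bar>s\<bar> \<le> (2 * (\<epsilon> + 1) + 1) * norm h"
        by (simp add: algebra_simps)
      then have s2: "s\<^sup>2 \<le> (2 * (\<epsilon> + 1) + 1)\<^sup>2 * (norm h)\<^sup>2"
        by (metis power_mult_distrib abs_ge_zero power2_abs power_mono)
      have "I * (\<rho> (z + h) - \<rho> z - g z \<bullet> h) = ((max 0 (t + s))\<^sup>2 - (max 0 t)\<^sup>2 - 2 * max 0 t * s) - 2 * B z * (norm h)\<^sup>2"
        unfolding \<rho>_def g_def 1 s_def using I by (simp add: field_simps)
      moreover have "\<bar>\<dots>\<bar> \<le> s\<^sup>2 + 2 * \<epsilon>\<^sup>2 * (norm h)\<^sup>2"
      proof -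
        have "0 \<le> B z * (norm h)\<^sup>2" "B z * (norm h)\<^sup>2 \<le> \<epsilon>\<^sup>2 * (norm h)\<^sup>2"
          using B0[of z] by (auto intro: mult_right_mono)
        then show ?thesis using positive_part_square_expansion[of t s] unfolding mult.assoc abs_le_iff by linarith
      qed
      ultimately have "\<bar>I * (\<rho> (z + h) - \<rho> z - g z \<bullet> h)\<bar> \<le> ((2 * (\<epsilon> + 1) + 1)\<^sup>2 + 2 * \<epsilon>\<^sup>2) * (norm h)\<^sup>2"
        using s2 by (simp add: algebra_simps)
      then have "\<bar>\<rho> (z + h) - \<rho> z - g z \<bullet> h\<bar> \<le> ((2 * (\<epsilon> + 1) + 1)\<^sup>2 + 2 * \<epsilon>\<^sup>2) / I * (norm h)\<^sup>2"
      proof -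
        have "\<bar>y\<bar> \<le> K / I * n" if "\<bar>I * y\<bar> \<le> K * n" for y K n :: real
          using that I by (simp add: abs_mult field_simps)
        then show ?thesis using \<open>\<bar>I * _\<bar> \<le> _\<close> by blast
      qed
      also have "\<dots> \<le> C * (norm h)\<^sup>2" by (intro mult_right_mono C) auto
      finally show ?thesis using True by simp
    qed
  qed (use I C Bz in \<open>auto simp: \<rho>_def\<close>)
qed

text \<open>The shift by h is transferred from v to the kernel, whose first-order remainder is
  quadratic in h and supported in a fixed ball. Multiplied by the bound M and integrated, it stays
  quadratic, so differentiability comes from the kernel alone.\<close>

lemma mollification_smooth:
  fixes v :: "'a::euclidean_space \<Rightarrow> real" and \<epsilon> M :: real
  assumes [measurable]: "v \<in> borel_measurable borel" and v: "\<And>x. \<bar>v x\<bar> \<le> M" and \<epsilon>: "0 < \<epsilon>"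
  obtains \<rho> :: "'a \<Rightarrow> real" and G :: "'a \<Rightarrow> 'a" and B :: real
  where "\<And>z. 0 \<le> \<rho> z" "integrable lborel \<rho>" "(\<integral>z. \<rho> z \<partial>lborel) = 1" "\<And>z. \<epsilon> < norm z \<Longrightarrow> \<rho> z = 0"
    "\<And>x. ((\<lambda>x. \<integral>z. \<rho> z * v (x - z) \<partial>lborel) has_derivative (\<lambda>h. G x \<bullet> h)) (at x)"
    "G \<in> borel_measurable borel" "\<And>x. norm (G x) \<le> B"
proof -
  obtain \<rho> :: "'a \<Rightarrow> real" and g C where \<rho>: "\<And>z. 0 \<le> \<rho> z" "integrable lborel \<rho>" "(\<integral>z. \<rho> z \<partial>lborel) = 1" "\<And>z. \<epsilon> < norm z \<Longrightarrow> \<rho> z = 0"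
    and g: "g \<in> borel_measurable borel" "0 \<le> C" "\<And>z. norm (g z) \<le> C * indicator (cball 0 (\<epsilon> + 1)) z"
    and rem: "\<And>z h. norm h \<le> 1 \<Longrightarrow> \<bar>\<rho> (z + h) - \<rho> z - g z \<bullet> h\<bar> \<le> C * (norm h)\<^sup>2 * indicator (cball 0 (\<epsilon> + 1)) z"
    using mollifier_exists[OF \<epsilon>] by metis
  have [measurable]: "\<rho> \<in> borel_measurable borel" using \<rho>(2) by auto
  note [measurable] = g(1)
  have M: "0 \<le> M" using v[of 0] by linarith
  let ?B = "cball (0::'a) (\<epsilon> + 1)"
  have ind: "integrable lborel (indicator ?B :: 'a \<Rightarrow> real)"
    using emeasure_lborel_cball_finite[of "0::'a" "\<epsilon> + 1"] by (intro integrable_real_indicator) auto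
  define V where "V = (\<integral>z. indicator ?B z \<partial>lborel :: real)"
  have V: "0 \<le> V" unfolding V_def by (intro integral_nonneg_AE) auto
  have g_int: "integrable lborel (\<lambda>z. v (x - z) *\<^sub>R g z)" for x
  proof (rule Bochner_Integration.integrable_bound[OF integrable_mult_right[OF ind, of "M * C"]])
    have "norm (v (x - z) *\<^sub>R g z) \<le> norm (M * C * indicator ?B z)" for z
      using mult_mono[OF v[of "x - z"] g(3)[of z]] M g(2) by (simp add: mult.assoc)
    then show "AE z in lborel. norm (v (x - z) *\<^sub>R g z) \<le> norm (M * C * indicator ?B z)" by simp
  qed measurable
  have \<rho>_int: "integrable lborel (\<lambda>z. \<rho> z * v (x - z))" for x
    by (rule Bochner_Integration.integrable_bound[OF integrable_mult_right[OF \<rho>(2), of M]])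
       (use v \<rho>(1) in \<open>auto simp: abs_mult mult.commute[of M] intro!: mult_left_mono order_trans[OF _ abs_ge_self]\<close>)
  define G where "G = (\<lambda>x. \<integral>z. v (x - z) *\<^sub>R g z \<partial>lborel)"
  show thesis
  proof
    show "G \<in> borel_measurable borel" unfolding G_def by measurable
    show "norm (G x) \<le> M * C * V" for x
    proof -
      have "norm (G x) \<le> (\<integral>z. norm (v (x - z) *\<^sub>R g z) \<partial>lborel)" unfolding G_def by (rule integral_norm_bound)
      also have "\<dots> \<le> (\<integral>z. M * C * indicator ?B z \<partial>lborel)"
      proof (rule integral_mono[OF integrable_norm[OF g_int]])
        show "norm (v (x - z) *\<^sub>R g z) \<le> M * C * indicator ?B z" for z
          using mult_mono[OF v[of "x - z"] g(3)[of z]] M g(2) by (simp add: mult.assoc)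
      qed (use ind in simp)
      finally show ?thesis by (simp add: V_def)
    qed
    fix x
    let ?w = "\<lambda>x. \<integral>z. \<rho> z * v (x - z) \<partial>lborel"
    have bound: "\<bar>?w (x + h) - ?w x - G x \<bullet> h\<bar> \<le> M * C * V * (norm h)\<^sup>2" if h: "norm h \<le> 1" for h
    proof -
      \<comment> \<open>Translating the variable of integration by h leaves the same values
        \<open>v (x - z)\<close> under both integrals, so that only the kernel is
        differenced.\<close>
      have 1: "?w (x + h) = (\<integral>z. \<rho> (z + h) * v (x - z) \<partial>lborel)"
        using lborel_integral_shift[of "\<lambda>z. \<rho> z * v (x + h - z)" h] by (simp add: add.commute)
      have 2: "integrable lborel (\<lambda>z. \<rho> (z + h) * v (x - z))"
        using lborel_integrable_shift[of "\<lambda>z. \<rho> z * v (x + h - z)" h] \<rho>_int[of "x + h"] by (simp add: add.commute)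
      have 3: "integrable lborel (\<lambda>z. \<rho> (z + h) * v (x - z) - \<rho> z * v (x - z) - (v (x - z) *\<^sub>R g z) \<bullet> h)"
        by (intro Bochner_Integration.integrable_diff integrable_inner_left 2 \<rho>_int g_int)
      have eq: "?w (x + h) - ?w x - G x \<bullet> h = (\<integral>z. \<rho> (z + h) * v (x - z) - \<rho> z * v (x - z) - (v (x - z) *\<^sub>R g z) \<bullet> h \<partial>lborel)"
      proof -
        have "(\<integral>z. v (x - z) *\<^sub>R g z \<partial>lborel) \<bullet> h = (\<integral>z. (v (x - z) *\<^sub>R g z) \<bullet> h \<partial>lborel)"
          by (rule integral_inner_left[symmetric]) (rule g_int)
        moreover have "(\<integral>z. \<rho> (z + h) * v (x - z) - \<rho> z * v (x - z) \<partial>lborel) = ?w (x + h) - ?w x"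
          unfolding 1 by (rule Bochner_Integration.integral_diff[OF 2 \<rho>_int])
        moreover have "(\<integral>z. \<rho> (z + h) * v (x - z) - \<rho> z * v (x - z) - (v (x - z) *\<^sub>R g z) \<bullet> h \<partial>lborel)
          = (\<integral>z. \<rho> (z + h) * v (x - z) - \<rho> z * v (x - z) \<partial>lborel) - (\<integral>z. (v (x - z) *\<^sub>R g z) \<bullet> h \<partial>lborel)"
          by (rule Bochner_Integration.integral_diff[OF Bochner_Integration.integrable_diff[OF 2 \<rho>_int] integrable_inner_left[OF g_int]])
        ultimately show ?thesis unfolding G_def by (simp only:)
      qed
      have "\<bar>?w (x + h) - ?w x - G x \<bullet> h\<bar> \<le> (\<integral>z. \<bar>\<rho> (z + h) * v (x - z) - \<rho> z * v (x - z) - (v (x - z) *\<^sub>R g z) \<bullet> h\<bar> \<partial>lborel)"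
        unfolding eq by (rule integral_abs_bound)
      also have "\<dots> \<le> (\<integral>z. M * (C * (norm h)\<^sup>2 * indicator ?B z) \<partial>lborel)"
      proof (rule integral_mono)
        show "integrable lborel (\<lambda>z. \<bar>\<rho> (z + h) * v (x - z) - \<rho> z * v (x - z) - (v (x - z) *\<^sub>R g z) \<bullet> h\<bar>)"
          using 3 by (rule integrable_abs)
        show "integrable lborel (\<lambda>z. M * (C * (norm h)\<^sup>2 * indicator ?B z))" using ind by simp
        fix z
        have alg: "a * y - b * y - y * c = y * (a - b - c)" for a b c y :: real by (simp add: algebra_simps)
        show "\<bar>\<rho> (z + h) * v (x - z) - \<rho> z * v (x - z) - (v (x - z) *\<^sub>R g z) \<bullet> h\<bar> \<le> M * (C * (norm h)\<^sup>2 * indicator ?B z)"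
          unfolding inner_scaleR_left alg abs_mult by (rule mult_mono[OF v rem[OF h] M abs_ge_zero])
      qed
      also have "\<dots> = M * C * V * (norm h)\<^sup>2" by (simp add: V_def)
      finally show ?thesis .
    qed
    show "(?w has_derivative (\<lambda>h. G x \<bullet> h)) (at x)"
      unfolding has_derivative_at_alt
    proof (intro conjI allI impI)
      show "bounded_linear (\<lambda>h. G x \<bullet> h)" by (rule bounded_linear_inner_right)
      fix e :: real assume e: "0 < e"
      define D where "D = M * C * V"
      have D: "0 \<le> D" using M g(2) V by (simp add: D_def)
      show "\<exists>d>0. \<forall>y. norm (y - x) < d \<longrightarrow> norm (?w y - ?w x - G x \<bullet> (y - x)) \<le> e * norm (y - x)"
      proof (intro exI[of _ "min 1 (e / (D + 1))"] conjI allI impI)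
        fix y assume y: "norm (y - x) < min 1 (e / (D + 1))"
        have "norm (?w y - ?w x - G x \<bullet> (y - x)) \<le> D * (norm (y - x))\<^sup>2"
          using bound[of "y - x"] y by (simp add: D_def)
        also have "\<dots> = (D * norm (y - x)) * norm (y - x)" by (simp add: power2_eq_square)
        also have "\<dots> \<le> e * norm (y - x)"
        proof (rule mult_right_mono)
          have "D * norm (y - x) \<le> D * (e / (D + 1))" using y D by (intro mult_left_mono) auto
          also have "\<dots> \<le> e" using e D by (simp add: field_simps)
          finally show "D * norm (y - x) \<le> e" .
        qed simp
        finally show "norm (?w y - ?w x - G x \<bullet> (y - x)) \<le> e * norm (y - x)" .
      qed (use e D in auto)
    qed
  qed (use \<rho> in auto)
qed

text \<open>The bound on the energy of G involves neither M nor \<epsilon>, which is what allows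
  both approximations to be removed afterwards. The pointwise bound B may depend on them; it only
  justifies integrations by parts.\<close>

lemma mollified_gradient_bound:
  fixes u v :: "real^'n::finite \<Rightarrow> real" and e :: "real^'n" and p \<gamma> M \<epsilon> :: real
  assumes [measurable]: "u \<in> borel_measurable lebesgue" "v \<in> borel_measurable borel" and uv: "AE x in lborel. u x = v x"
    and p: "1 \<le> p" and \<gamma>: "-1 < \<gamma>" and e: "norm e = 1" and M: "0 \<le> M" and \<epsilon>: "0 < \<epsilon>"
  obtains \<rho> :: "real^'n \<Rightarrow> real" and G :: "real^'n \<Rightarrow> real^'n" and B :: real
  where "\<And>z. 0 \<le> \<rho> z" "integrable lborel \<rho>" "(\<integral>z. \<rho> z \<partial>lborel) = 1" "\<And>z. \<epsilon> < norm z \<Longrightarrow> \<rho> z = 0"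
    "\<And>x. ((\<lambda>x. \<integral>z. \<rho> z * max (- M) (min M (v (x - z))) \<partial>lborel) has_derivative (\<lambda>h. G x \<bullet> h)) (at x)"
    "G \<in> borel_measurable borel" "\<And>x. norm (G x) \<le> B"
    "ennreal (K_const e p / (\<gamma> + 2 * p)) * (\<integral>\<^sup>+x. ennreal (norm (G x) powr p) \<partial>lborel)
      \<le> Limsup (at_right 0) (\<lambda>l. Phi_lam p \<gamma> l u) + Limsup at_top (\<lambda>l. Phi_lam p \<gamma> l u)"
proof -
  define w where "w = (\<lambda>x. max (- M) (min M (v x)))"
  have [measurable]: "w \<in> borel_measurable borel" unfolding w_def by measurable
  have wM: "\<bar>w x\<bar> \<le> M" for x using M by (auto simp: w_def)
  obtain \<rho> :: "real^'n \<Rightarrow> real" and G B where \<rho>: "\<And>z. 0 \<le> \<rho> z" "integrable lborel \<rho>" "(\<integral>z. \<rho> z \<partial>lborel) = 1"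
      "\<And>z. \<epsilon> < norm z \<Longrightarrow> \<rho> z = 0"
    and D: "\<And>x. ((\<lambda>x. \<integral>z. \<rho> z * w (x - z) \<partial>lborel) has_derivative (\<lambda>h. G x \<bullet> h)) (at x)"
    and G: "G \<in> borel_measurable borel" "\<And>x. norm (G x) \<le> B"
    by (rule mollification_smooth[OF \<open>w \<in> borel_measurable borel\<close> wM \<epsilon>]) blast
  define f where "f = (\<lambda>x. \<integral>z. \<rho> z * w (x - z) \<partial>lborel)"
  let ?L = "Limsup (at_right 0) (\<lambda>l. Phi_lam p \<gamma> l u) + Limsup at_top (\<lambda>l. Phi_lam p \<gamma> l u)"
  define a where "a = 2 + \<gamma> / p"
  have a: "0 < a" using p \<gamma> by (auto simp: a_def field_simps)
  define \<delta> where "\<delta> = (\<lambda>n::nat. inverse (real (Suc n)))"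
  have \<delta>: "0 < \<delta> n" "\<delta> \<longlonglongrightarrow> 0" for n unfolding \<delta>_def by (auto intro: LIMSEQ_inverse_real_of_nat simp del: of_nat_Suc)
  \<comment> \<open>The factor of \<open>truncated_energy_le\<close> without its \<delta>. The power
    of the truncation constant tends to 1, so the limit is 1/p for every M.\<close>
  define \<kappa> where "\<kappa> = (\<lambda>n. max 1 (2 * M) powr (- 2 * \<delta> n) / (p + \<delta> n))"
  have \<kappa>0: "0 \<le> \<kappa> n" for n using \<delta>(1)[of n] p by (simp add: \<kappa>_def)
  have "\<kappa> \<longlonglongrightarrow> max 1 (2 * M) powr (- 2 * 0) / (p + 0)"
    unfolding \<kappa>_def using p by (intro tendsto_intros \<delta>) auto
  then have \<kappa>: "\<kappa> \<longlonglongrightarrow> 1 / p" by (simp add: max_def split: if_splits)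
  have lim: "filterlim \<delta> (at_right 0) sequentially"
    using \<delta> by (intro tendsto_imp_filterlim_at_right always_eventually) auto
  \<comment> \<open>The averaging argument needs room above the sum of the upper limits, so the
    bound is shown for every larger c and \<open>dense_ge\<close> closes the gap.\<close>
  have "ennreal (1 / p / a * K_const e p) * (\<integral>\<^sup>+x. ennreal (norm (G x) powr p) \<partial>lborel) \<le> c" if c: "?L < c" for c
  proof (rule gradient_energy_le[OF _ G(1) e a p \<delta> \<kappa>0 \<kappa>])
    show "(f has_derivative (\<lambda>h. G x \<bullet> h)) (at x)" for x unfolding f_def by (rule D)
    show "\<forall>\<^sub>F n in sequentially. ennreal (\<kappa> n * \<delta> n) * (\<integral>\<^sup>+x. \<integral>\<^sup>+h. ennreal ((\<bar>f (x + h) - f x\<bar> / norm h) powr (p + \<delta> n) *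
      norm h powr (a * \<delta> n - CARD('n))) * indicator (cball 0 1) h \<partial>lborel \<partial>lborel) \<le> c"
      using eventually_compose_filterlim[OF truncated_energy_le[OF assms(1,2) uv p \<gamma> c w_def M] lim]
    proof eventually_elim
      case (elim n)
      \<comment> \<open>All powers of |h| are collected in one weight, so that the remaining factor
        is the power of a difference to which \<open>convolution_energy_le\<close> applies.\<close>
      let ?W = "\<lambda>h::real^'n. ennreal (norm h powr (a * \<delta> n - CARD('n)) / norm h powr (p + \<delta> n)) * indicator (cball 0 1) h"
      have eq: "ennreal ((\<bar>g (x + h) - g x\<bar> / norm h) powr (p + \<delta> n) * norm h powr (a * \<delta> n - CARD('n))) * indicator (cball 0 1) h
        = ennreal (\<bar>g (x + h) - g x\<bar> powr (p + \<delta> n)) * ?W h" for g :: "real^'n \<Rightarrow> real" and x h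
        by (simp add: powr_divide ennreal_mult[symmetric] mult.assoc[symmetric])
      have "(\<integral>\<^sup>+x. \<integral>\<^sup>+h. ennreal (\<bar>f (x + h) - f x\<bar> powr (p + \<delta> n)) * ?W h \<partial>lborel \<partial>lborel)
        \<le> (\<integral>\<^sup>+x. \<integral>\<^sup>+h. ennreal (\<bar>w (x + h) - w x\<bar> powr (p + \<delta> n)) * ?W h \<partial>lborel \<partial>lborel)"
        using p less_imp_le[OF \<delta>(1)[of n]] wM \<rho> by (intro convolution_energy_le[OF _ _ _ _ _ _ _ f_def]) auto
      then have "ennreal (\<kappa> n * \<delta> n) * (\<integral>\<^sup>+x. \<integral>\<^sup>+h. ennreal (\<bar>f (x + h) - f x\<bar> powr (p + \<delta> n)) * ?W h \<partial>lborel \<partial>lborel)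
        \<le> ennreal (\<kappa> n * \<delta> n) * (\<integral>\<^sup>+x. \<integral>\<^sup>+h. ennreal (\<bar>w (x + h) - w x\<bar> powr (p + \<delta> n)) * ?W h \<partial>lborel \<partial>lborel)"
        by (rule mult_left_mono) simp
      also have "\<dots> \<le> c"
        using elim unfolding eq[symmetric] by (simp only: a_def \<kappa>_def)
      finally show ?case unfolding eq .
    qed
  qed
  then have bound: "ennreal (1 / p / a * K_const e p) * (\<integral>\<^sup>+x. ennreal (norm (G x) powr p) \<partial>lborel) \<le> ?L"
    by (rule dense_ge)
  have eq: "1 / p / a * K_const e p = K_const e p / (\<gamma> + 2 * p)"
  proof -
    have "p * a = \<gamma> + 2 * p" using p by (simp add: a_def field_simps)
    then show ?thesis by simp
  qed
  show thesis
    by (rule that[OF \<rho> _ G bound[unfolded eq]]) (use D in \<open>simp_all add: w_def\<close>)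
qed

section \<open>Convergence of truncated mollifications against continuous functions of compact
  support\<close>

lemma compact_support_uniformly_continuous:
  fixes \<psi> :: "'a::euclidean_space \<Rightarrow> real"
  assumes c: "continuous_on UNIV \<psi>" and s: "\<And>x. R < norm x \<Longrightarrow> \<psi> x = 0" and e: "0 < e"
  obtains d where "0 < d" "\<And>x z. norm z < d \<Longrightarrow> \<bar>\<psi> (x + z) - \<psi> x\<bar> < e"
proof -
  have "uniformly_continuous_on (cball 0 (R + 1)) \<psi>"
    by (intro compact_uniformly_continuous continuous_on_subset[OF c]) auto
  then obtain d where d: "0 < d" "\<And>x y. x \<in> cball 0 (R + 1) \<Longrightarrow> y \<in> cball 0 (R + 1) \<Longrightarrow> dist y x < d \<Longrightarrow> dist (\<psi> y) (\<psi> x) < e"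
    using e unfolding uniformly_continuous_on_def by blast
  show thesis
  proof
    show "0 < min d 1" using d by simp
    fix x z :: 'a assume z: "norm z < min d 1"
    show "\<bar>\<psi> (x + z) - \<psi> x\<bar> < e"
    proof (cases "norm x \<le> R \<or> norm (x + z) \<le> R")
      case True
      have "norm (x + z) \<le> norm x + norm z" "norm x \<le> norm (x + z) + norm z"
        using norm_triangle_ineq[of x z] norm_triangle_ineq4[of "x + z" z] by simp_all
      then have "x \<in> cball 0 (R + 1)" "x + z \<in> cball 0 (R + 1)" using True z by auto
      then show ?thesis using d(2)[of x "x + z"] z by (simp add: dist_norm)
    next
      case False then show ?thesis using s[of x] s[of "x + z"] e by simp
    qed
  qed
qed

lemma continuous_compact_support_bounded:
  fixes \<psi> :: "'a::euclidean_space \<Rightarrow> real"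
  assumes c: "continuous_on UNIV \<psi>" and s: "\<And>x. R < norm x \<Longrightarrow> \<psi> x = 0"
  obtains D where "0 \<le> D" "\<And>x. \<bar>\<psi> x\<bar> \<le> D * indicator (cball 0 R) x"
proof -
  have "bounded (\<psi> ` cball 0 R)"
    by (intro compact_imp_bounded compact_continuous_image continuous_on_subset[OF c]) auto
  then obtain D where D: "\<forall>x\<in>cball 0 R. \<bar>\<psi> x\<bar> \<le> D" by (auto simp: bounded_iff)
  show thesis
  proof
    show "0 \<le> max 0 D" by simp
    show "\<bar>\<psi> x\<bar> \<le> max 0 D * indicator (cball 0 R) x" for x
      using bspec[OF D, of x] s[of x] by (cases "norm x \<le> R") (auto simp: indicator_def)
  qed
qed

lemma continuous_compact_support_integrable:
  fixes \<psi> :: "'a::euclidean_space \<Rightarrow> real"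
  assumes c: "continuous_on UNIV \<psi>" and s: "\<And>x. R < norm x \<Longrightarrow> \<psi> x = 0"
  shows "integrable lborel \<psi>"
proof -
  obtain D where D: "0 \<le> D" "\<And>x. \<bar>\<psi> x\<bar> \<le> D * indicator (cball 0 R) x"
    using continuous_compact_support_bounded[OF c s] by metis
  have "integrable lborel (\<lambda>x::'a. D * indicator (cball 0 R) x :: real)"
    using emeasure_lborel_cball_finite[of "0::'a" R] by (intro integrable_mult_right integrable_real_indicator) auto
  moreover have "\<psi> \<in> borel_measurable lborel" using borel_measurable_continuous_onI[OF c] by simp
  ultimately show ?thesis
    by (rule Bochner_Integration.integrable_bound) (use D in \<open>auto intro!: AE_I2 order_trans[OF D(2)]\<close>)
qed

text \<open>By Fubini's theorem the convolution moves to the other factor: the integral becomes the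
  \<rho>-average of \<open>J z\<close>, the integral of v against \<psi> shifted by z. Where \<rho>
  lives, J differs from \<open>J 0\<close> by at most \<omega> times the local L^1 norm of v. The
  bound M serves integrability only and is absent from the estimate, which is therefore uniform in
  the truncation level.\<close>

lemma mollification_test:
  fixes v \<rho> \<psi> :: "'a::euclidean_space \<Rightarrow> real"
  assumes [measurable]: "v \<in> borel_measurable borel" and vM: "\<And>x. \<bar>v x\<bar> \<le> M"
    and \<rho>: "\<And>z. 0 \<le> \<rho> z" "integrable lborel \<rho>" "(\<integral>z. \<rho> z \<partial>lborel) = 1" "\<And>z. d < norm z \<Longrightarrow> \<rho> z = 0"
    and \<psi>: "continuous_on UNIV \<psi>" "\<And>x. R < norm x \<Longrightarrow> \<psi> x = 0"
    and d: "0 < d" "d \<le> 1" and \<omega>: "\<And>x z. norm z \<le> d \<Longrightarrow> \<bar>\<psi> (x + z) - \<psi> x\<bar> \<le> \<omega>"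
    and I: "integrable lborel (\<lambda>x. indicator (cball 0 (R + 1)) x * \<bar>v x\<bar>)"
  shows "\<bar>(\<integral>x. (\<integral>z. \<rho> z * v (x - z) \<partial>lborel) * \<psi> x \<partial>lborel) - (\<integral>x. v x * \<psi> x \<partial>lborel)\<bar>
    \<le> \<omega> * (\<integral>x. indicator (cball 0 (R + 1)) x * \<bar>v x\<bar> \<partial>lborel)"
proof -
  have [measurable]: "\<rho> \<in> borel_measurable borel" using \<rho>(2) by auto
  have [measurable]: "\<psi> \<in> borel_measurable borel" using \<psi>(1) by (rule borel_measurable_continuous_onI)
  have \<psi>i: "integrable lborel \<psi>" by (rule continuous_compact_support_integrable[OF \<psi>])
  have M: "0 \<le> M" using vM[of 0] by linarith
  have \<omega>0: "0 \<le> \<omega>" using \<omega>[of 0 0] d by simp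
  let ?V = "\<integral>x. indicator (cball 0 (R + 1)) x * \<bar>v x\<bar> \<partial>lborel"
  have int1: "integrable (lborel \<Otimes>\<^sub>M lborel) (\<lambda>(x, z). \<rho> z * v (x - z) * \<psi> x)"
  proof (rule integrableI_bounded)
    have "(\<integral>\<^sup>+y. ennreal (norm (case y of (x, z) \<Rightarrow> \<rho> z * v (x - z) * \<psi> x)) \<partial>(lborel \<Otimes>\<^sub>M lborel))
      \<le> (\<integral>\<^sup>+y. ennreal (\<rho> (snd y)) * ennreal (M * \<bar>\<psi> (fst y)\<bar>) \<partial>(lborel \<Otimes>\<^sub>M lborel))"
      using vM \<rho>(1) M by (intro nn_integral_mono) (auto simp: ennreal_mult[symmetric] abs_mult mult.assoc intro!: ennreal_leI mult_left_mono mult_right_mono)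
    also have "\<dots> = (\<integral>\<^sup>+x. \<integral>\<^sup>+z. ennreal (\<rho> z) * ennreal (M * \<bar>\<psi> x\<bar>) \<partial>lborel \<partial>lborel)"
      by (subst lborel.nn_integral_fst[symmetric]) simp_all
    also have "\<dots> = (\<integral>\<^sup>+z. ennreal (\<rho> z) \<partial>lborel) * (\<integral>\<^sup>+x. ennreal (M * \<bar>\<psi> x\<bar>) \<partial>lborel)"
      by (simp add: nn_integral_multc nn_integral_cmult)
    also have "\<dots> = ennreal (\<integral>z. \<rho> z \<partial>lborel) * ennreal (\<integral>x. M * \<bar>\<psi> x\<bar> \<partial>lborel)"
      using \<rho> \<psi>i M by (subst (1 2) nn_integral_eq_integral) auto
    also have "\<dots> < \<infinity>" by (simp add: ennreal_mult_less_top)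
    finally show "(\<integral>\<^sup>+y. ennreal (norm (case y of (x, z) \<Rightarrow> \<rho> z * v (x - z) * \<psi> x)) \<partial>(lborel \<Otimes>\<^sub>M lborel)) < \<infinity>" .
  qed measurable
  have vp: "integrable lborel (\<lambda>x. v x * \<psi> (x + z))" for z
  proof (rule Bochner_Integration.integrable_bound)
    have "integrable lborel (\<lambda>x. \<psi> (z + x))" using \<psi>i by (subst lborel_integrable_shift) auto
    then show "integrable lborel (\<lambda>x. M * \<psi> (z + x))" by simp
    show "AE x in lborel. norm (v x * \<psi> (x + z)) \<le> norm (M * \<psi> (z + x))"
      using vM M by (intro AE_I2) (auto simp: abs_mult add.commute intro!: mult_right_mono)
  qed measurable
  define J where "J = (\<lambda>z. \<integral>x. v x * \<psi> (x + z) \<partial>lborel)"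
  have [measurable]: "J \<in> borel_measurable borel" unfolding J_def by measurable
  have J: "\<bar>J z - J 0\<bar> \<le> \<omega> * ?V" if z: "norm z \<le> d" for z
  proof -
    have "J z - J 0 = (\<integral>x. v x * \<psi> (x + z) - v x * \<psi> (x + 0) \<partial>lborel)"
      unfolding J_def by (rule Bochner_Integration.integral_diff[OF vp vp, symmetric])
    then have "\<bar>J z - J 0\<bar> \<le> (\<integral>x. \<bar>v x * \<psi> (x + z) - v x * \<psi> (x + 0)\<bar> \<partial>lborel)"
      by (metis integral_abs_bound)
    also have "\<dots> \<le> (\<integral>x. \<omega> * (indicator (cball 0 (R + 1)) x * \<bar>v x\<bar>) \<partial>lborel)"
    proof (rule integral_mono)
      show "integrable lborel (\<lambda>x. \<bar>v x * \<psi> (x + z) - v x * \<psi> (x + 0)\<bar>)"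
        by (intro integrable_abs Bochner_Integration.integrable_diff vp)
      show "integrable lborel (\<lambda>x. \<omega> * (indicator (cball 0 (R + 1)) x * \<bar>v x\<bar>))" using I by (rule integrable_mult_right)
      fix x
      have "\<bar>v x * \<psi> (x + z) - v x * \<psi> (x + 0)\<bar> = \<bar>\<psi> (x + z) - \<psi> x\<bar> * \<bar>v x\<bar>"
      proof -
        have "y * a - y * b = (a - b) * y" for y a b :: real by (simp add: algebra_simps)
        then show ?thesis by (simp only: abs_mult add_0_right)
      qed
      also have "\<dots> \<le> (\<omega> * indicator (cball 0 (R + 1)) x) * \<bar>v x\<bar>"
      proof (rule mult_right_mono)
        show "\<bar>\<psi> (x + z) - \<psi> x\<bar> \<le> \<omega> * indicator (cball 0 (R + 1)) x"
        proof (cases "norm x \<le> R + 1")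
          case True then show ?thesis using \<omega>[OF z] by simp
        next
          case False
          then have "R < norm (x + z)" using norm_triangle_ineq4[of "x + z" z] z d by simp
          then show ?thesis using False \<psi>(2)[of x] \<psi>(2)[of "x + z"] by simp
        qed
      qed simp
      finally show "\<bar>v x * \<psi> (x + z) - v x * \<psi> (x + 0)\<bar> \<le> \<omega> * (indicator (cball 0 (R + 1)) x * \<bar>v x\<bar>)"
        by (simp only: mult.assoc)
    qed
    also have "\<dots> = \<omega> * ?V" by simp
    finally show ?thesis .
  qed
  have "(\<integral>x. (\<integral>z. \<rho> z * v (x - z) \<partial>lborel) * \<psi> x \<partial>lborel) = (\<integral>x. (\<integral>z. \<rho> z * v (x - z) * \<psi> x \<partial>lborel) \<partial>lborel)"
    by simp
  also have "\<dots> = (\<integral>z. (\<integral>x. \<rho> z * v (x - z) * \<psi> x \<partial>lborel) \<partial>lborel)"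
    by (rule lborel_pair.Fubini_integral[OF int1, symmetric])
  also have "\<dots> = (\<integral>z. \<rho> z * J z \<partial>lborel)"
  proof (rule Bochner_Integration.integral_cong[OF refl])
    fix z
    have "(\<integral>x. v (x - z) * \<psi> x \<partial>lborel) = (\<integral>x. v (z + x - z) * \<psi> (z + x) \<partial>lborel)"
      by (rule lborel_integral_shift[symmetric]) measurable
    then show "(\<integral>x. \<rho> z * v (x - z) * \<psi> x \<partial>lborel) = \<rho> z * J z"
      by (simp add: J_def mult.assoc add.commute)
  qed
  finally have eq: "(\<integral>x. (\<integral>z. \<rho> z * v (x - z) \<partial>lborel) * \<psi> x \<partial>lborel) = (\<integral>z. \<rho> z * J z \<partial>lborel)" .
  have rb: "\<bar>\<rho> z * (J z - J 0)\<bar> \<le> \<rho> z * (\<omega> * ?V)" for z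
    using J[of z] \<rho>(1)[of z] \<rho>(4)[of z] by (cases "norm z \<le> d") (auto simp: abs_mult intro!: mult_left_mono)
  have rJ: "integrable lborel (\<lambda>z. \<rho> z * (J z - J 0))"
    by (rule Bochner_Integration.integrable_bound[OF integrable_mult_left[OF \<rho>(2), of "\<omega> * ?V"]])
       (use rb in \<open>auto intro!: AE_I2 order_trans[OF rb]\<close>)
  have "(\<integral>z. \<rho> z * J z \<partial>lborel) = (\<integral>z. \<rho> z * (J z - J 0) + \<rho> z * J 0 \<partial>lborel)" by (simp add: algebra_simps)
  also have "\<dots> = (\<integral>z. \<rho> z * (J z - J 0) \<partial>lborel) + (\<integral>z. \<rho> z * J 0 \<partial>lborel)"
    by (rule Bochner_Integration.integral_add[OF rJ integrable_mult_left[OF \<rho>(2)]])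
  also have "(\<integral>z. \<rho> z * J 0 \<partial>lborel) = J 0" using \<rho>(3) by simp
  finally have "\<bar>(\<integral>z. \<rho> z * J z \<partial>lborel) - J 0\<bar> \<le> (\<integral>z. \<bar>\<rho> z * (J z - J 0)\<bar> \<partial>lborel)"
    using integral_abs_bound[of lborel "\<lambda>z. \<rho> z * (J z - J 0)"] by simp
  also have "\<dots> \<le> (\<integral>z. \<rho> z * (\<omega> * ?V) \<partial>lborel)"
    by (intro integral_mono integrable_abs rJ integrable_mult_left \<rho>(2) rb)
  also have "\<dots> = \<omega> * ?V" using \<rho>(3) by simp
  finally show ?thesis unfolding eq by (simp add: J_def)
qed

text \<open>Removing the truncation is dominated convergence with majorant |v| |\<psi>|. The error
  of the mollification is uniform in the truncation level, because |T j x| \<le> |v x| lets one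
  local L^1 norm of v serve for all j.\<close>

lemma truncated_mollifications_converge:
  fixes v \<psi> :: "'a::euclidean_space \<Rightarrow> real" and \<rho> :: "nat \<Rightarrow> 'a \<Rightarrow> real"
  assumes [measurable]: "v \<in> borel_measurable borel"
    and I: "\<And>R. integrable lborel (\<lambda>x. indicator (cball 0 R) x * \<bar>v x\<bar>)"
    and \<rho>: "\<And>j z. 0 \<le> \<rho> j z" "\<And>j. integrable lborel (\<rho> j)" "\<And>j. (\<integral>z. \<rho> j z \<partial>lborel) = 1"
      "\<And>j z. inverse (real (Suc j)) < norm z \<Longrightarrow> \<rho> j z = 0"
    and \<psi>: "continuous_on UNIV \<psi>" "\<And>x. R < norm x \<Longrightarrow> \<psi> x = 0"
  shows "(\<lambda>j. \<integral>x. (\<integral>z. \<rho> j z * max (- real j) (min (real j) (v (x - z))) \<partial>lborel) * \<psi> x \<partial>lborel) \<longlonglongrightarrow> (\<integral>x. v x * \<psi> x \<partial>lborel)"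
proof -
  define T where "T = (\<lambda>j x. max (- real j) (min (real j) (v x)))"
  have [measurable]: "T j \<in> borel_measurable borel" for j unfolding T_def by measurable
  have [measurable]: "\<psi> \<in> borel_measurable borel" using \<psi>(1) by (rule borel_measurable_continuous_onI)
  have TM: "\<bar>T j x\<bar> \<le> real j" and Tv: "\<bar>T j x\<bar> \<le> \<bar>v x\<bar>" for j x by (auto simp: T_def)
  obtain D where D: "0 \<le> D" "\<And>x. \<bar>\<psi> x\<bar> \<le> D * indicator (cball 0 R) x"
    using continuous_compact_support_bounded[OF \<psi>] by metis
  have lim1: "(\<lambda>j. \<integral>x. T j x * \<psi> x \<partial>lborel) \<longlonglongrightarrow> (\<integral>x. v x * \<psi> x \<partial>lborel)"
  proof (rule integral_dominated_convergence)
    show "integrable lborel (\<lambda>x. D * (indicator (cball 0 R) x * \<bar>v x\<bar>))" using I by (rule integrable_mult_right)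
    show "AE x in lborel. norm (T j x * \<psi> x) \<le> D * (indicator (cball 0 R) x * \<bar>v x\<bar>)" for j
    proof (rule AE_I2)
      fix x
      have "\<bar>T j x\<bar> * \<bar>\<psi> x\<bar> \<le> \<bar>v x\<bar> * (D * indicator (cball 0 R) x)" by (intro mult_mono Tv D) auto
      then show "norm (T j x * \<psi> x) \<le> D * (indicator (cball 0 R) x * \<bar>v x\<bar>)" by (simp add: abs_mult mult_ac)
    qed
    show "AE x in lborel. (\<lambda>j. T j x * \<psi> x) \<longlonglongrightarrow> v x * \<psi> x"
    proof (rule AE_I2, rule tendsto_mult_right, rule tendsto_eventually)
      fix x
      obtain n :: nat where "\<bar>v x\<bar> \<le> real n" using real_arch_simple by blast
      then have "\<And>j. n \<le> j \<Longrightarrow> T j x = v x" by (force simp: T_def min_def max_def)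
      then show "\<forall>\<^sub>F j in sequentially. T j x = v x" unfolding eventually_sequentially by blast
    qed
  qed measurable
  let ?V = "\<integral>x. indicator (cball 0 (R + 1)) x * \<bar>v x\<bar> \<partial>lborel"
  have V0: "0 \<le> ?V" by (intro integral_nonneg_AE) auto
  have "(\<lambda>j. (\<integral>x. (\<integral>z. \<rho> j z * T j (x - z) \<partial>lborel) * \<psi> x \<partial>lborel) - (\<integral>x. T j x * \<psi> x \<partial>lborel)) \<longlonglongrightarrow> 0"
  proof (rule LIMSEQ_I)
    fix r :: real assume r: "0 < r"
    have aux: "0 < r / (V + 1) / 2 \<and> r / (V + 1) / 2 * V < r" if "0 < r" "0 \<le> V" for r V :: real
      using that by (auto simp: field_simps intro!: add_nonneg_pos)
    define e where "e = r / (?V + 1) / 2"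
    have e: "0 < e" "e * ?V < r" unfolding e_def using aux[OF r V0] by auto
    obtain d where d: "0 < d" "\<And>x z. norm z < d \<Longrightarrow> \<bar>\<psi> (x + z) - \<psi> x\<bar> < e"
      using compact_support_uniformly_continuous[OF \<psi> e(1)] by metis
    obtain n where n: "inverse (real (Suc n)) < d" using reals_Archimedean[OF d(1)] by auto
    show "\<exists>no. \<forall>j\<ge>no. norm ((\<integral>x. (\<integral>z. \<rho> j z * T j (x - z) \<partial>lborel) * \<psi> x \<partial>lborel) - (\<integral>x. T j x * \<psi> x \<partial>lborel) - 0) < r"
    proof (intro exI[of _ n] allI impI)
      fix j assume j: "n \<le> j"
      have j2: "inverse (real (Suc j)) < d"
      proof (rule order_le_less_trans[OF _ n])
        show "inverse (real (Suc j)) \<le> inverse (real (Suc n))" using j by (intro le_imp_inverse_le) auto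
      qed
      have Ij: "integrable lborel (\<lambda>x. indicator (cball 0 (R + 1)) x * \<bar>T j x\<bar>)"
        by (rule Bochner_Integration.integrable_bound[OF I[of "R + 1"]]) (use Tv in \<open>auto simp: abs_mult intro!: mult_left_mono\<close>)
      have "\<bar>(\<integral>x. (\<integral>z. \<rho> j z * T j (x - z) \<partial>lborel) * \<psi> x \<partial>lborel) - (\<integral>x. T j x * \<psi> x \<partial>lborel)\<bar>
        \<le> e * (\<integral>x. indicator (cball 0 (R + 1)) x * \<bar>T j x\<bar> \<partial>lborel)"
      proof (rule mollification_test[OF _ TM \<rho> \<psi> _ _ _ Ij])
        show "inverse (real (Suc j)) \<le> 1" by (rule inverse_le_1_iff[THEN iffD2]) simp
        show "\<bar>\<psi> (x + z) - \<psi> x\<bar> \<le> e" if "norm z \<le> inverse (real (Suc j))" for x z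
          using d(2)[of z x] that j2 by linarith
      qed auto
      also have "\<dots> \<le> e * ?V"
        using e(1) by (intro mult_left_mono integral_mono Ij I Tv) auto
      also have "\<dots> < r" by (rule e)
      finally show "norm ((\<integral>x. (\<integral>z. \<rho> j z * T j (x - z) \<partial>lborel) * \<psi> x \<partial>lborel) - (\<integral>x. T j x * \<psi> x \<partial>lborel) - 0) < r" by simp
    qed
  qed
  from tendsto_add[OF this lim1] show ?thesis by (simp add: T_def)
qed

section \<open>Integration by parts and total variation\<close>

lemma borel_measurable_vec_nth[measurable (raw)]:
  fixes f :: "'a \<Rightarrow> real^'n::finite"
  assumes "f \<in> borel_measurable M"
  shows "(\<lambda>x. f x $ i) \<in> borel_measurable M"
  using assms by (rule measurable_compose) (intro borel_measurable_continuous_onI linear_continuous_on bounded_linear_vec_nth)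

lemma directional_lipschitz:
  fixes f :: "'a::real_normed_vector \<Rightarrow> real"
  assumes f: "\<And>x. (f has_derivative f' x) (at x)" and D: "\<And>x. \<bar>f' x b\<bar> \<le> D"
  shows "\<bar>f (x + t *\<^sub>R b) - f x\<bar> \<le> D * \<bar>t\<bar>"
proof -
  have "((\<lambda>s. f (x + s *\<^sub>R b)) has_derivative (\<lambda>s. f' (x + s0 *\<^sub>R b) (s *\<^sub>R b))) (at s0 within UNIV)" for s0
    by (rule has_derivative_compose[OF _ f]) (auto intro!: derivative_eq_intros)
  moreover have "f' (x + s0 *\<^sub>R b) (s *\<^sub>R b) = f' (x + s0 *\<^sub>R b) b * s" for s0 s
    using linear_scale[OF has_derivative_linear[OF f]] by (simp add: mult.commute)
  ultimately have "((\<lambda>s. f (x + s *\<^sub>R b)) has_real_derivative f' (x + s0 *\<^sub>R b) b) (at s0 within UNIV)" for s0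
    unfolding has_field_derivative_def by (simp add: mult.commute[of _ "f' _ b"] fun_eq_iff)
  from field_differentiable_bound[OF convex_UNIV this, of D t 0] D show ?thesis by simp
qed

lemma difference_quotient_tendsto:
  fixes f :: "'a::real_normed_vector \<Rightarrow> real"
  assumes f: "(f has_derivative f') (at x)" and t: "t \<longlonglongrightarrow> 0" "\<And>n. t n \<noteq> 0"
  shows "(\<lambda>n. (f (x + t n *\<^sub>R b) - f x) / t n) \<longlonglongrightarrow> f' b"
proof -
  have "((\<lambda>s. f (x + s *\<^sub>R b)) has_derivative (\<lambda>s. f' (s *\<^sub>R b))) (at 0)"
    by (rule has_derivative_compose[where g=f and f="\<lambda>s. x + s *\<^sub>R b"]) (use f in \<open>auto intro!: derivative_eq_intros\<close>)
  moreover have "f' (s *\<^sub>R b) = f' b * s" for s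
    using linear_scale[OF has_derivative_linear[OF f]] by (simp add: mult.commute)
  ultimately have "((\<lambda>s. f (x + s *\<^sub>R b)) has_real_derivative f' b) (at 0)"
    unfolding has_field_derivative_def by (simp add: mult.commute[of _ "f' b"] fun_eq_iff)
  then have "((\<lambda>h. (f (x + h *\<^sub>R b) - f x) / h) \<longlongrightarrow> f' b) (at 0)"
    by (simp add: DERIV_def)
  then show ?thesis
    by (rule filterlim_compose) (use t in \<open>auto simp: filterlim_at\<close>)
qed

text \<open>Difference quotients replace derivatives: by translation invariance the forward quotient
  of \<phi> against v equals the backward quotient of v against \<phi>. Both sides converge by
  dominated convergence, the quotients being bounded through the mean value theorem.\<close>

lemma integration_by_parts_direction:
  fixes v \<phi> :: "'a::euclidean_space \<Rightarrow> real"
  assumes v: "\<And>x. (v has_derivative v' x) (at x)" "\<And>x. \<bar>v x\<bar> \<le> M" "\<And>x. \<bar>v' x b\<bar> \<le> B"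
    and \<phi>: "\<And>x. (\<phi> has_derivative \<phi>' x) (at x)" "continuous_on UNIV (\<lambda>x. \<phi>' x b)" "\<And>x. R < norm x \<Longrightarrow> \<phi> x = 0"
    and b: "norm b = 1"
  shows "(\<integral>x. v x * \<phi>' x b \<partial>lborel) = - (\<integral>x. v' x b * \<phi> x \<partial>lborel)"
proof -
  have vc: "continuous_on UNIV v" using v(1) by (intro continuous_at_imp_continuous_on ballI has_derivative_continuous)
  have \<phi>c: "continuous_on UNIV \<phi>" using \<phi>(1) by (intro continuous_at_imp_continuous_on ballI has_derivative_continuous)
  have [measurable]: "v \<in> borel_measurable borel" "\<phi> \<in> borel_measurable borel" "(\<lambda>x. \<phi>' x b) \<in> borel_measurable borel"
    using vc \<phi>c \<phi>(2) by (auto intro: borel_measurable_continuous_onI)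
  define t where "t = (\<lambda>n::nat. inverse (real (Suc n)))"
  have t: "t \<longlonglongrightarrow> 0" "\<And>n. t n \<noteq> 0" "\<And>n. 0 < t n" "\<And>n. t n \<le> 1"
    unfolding t_def by (auto intro: LIMSEQ_inverse_real_of_nat simp: inverse_le_1_iff simp del: of_nat_Suc)
  have \<phi>'0: "\<phi>' x b = 0" if x: "R < norm x" for x
  proof -
    have "open (- cball (0::'a) R)" by auto
    then have "(\<phi> has_derivative (\<lambda>_. 0)) (at x)"
      using x \<phi>(3) by (intro has_derivative_transform_within_open[OF has_derivative_const[of 0], where s="- cball 0 R"]) auto
    then have "\<phi>' x = (\<lambda>_. 0)" by (rule has_derivative_unique[OF \<phi>(1)])
    then show ?thesis by simp
  qed
  obtain D where D: "0 \<le> D" "\<And>x. \<bar>\<phi>' x b\<bar> \<le> D * indicator (cball 0 R) x"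
    using continuous_compact_support_bounded[OF \<phi>(2) \<phi>'0] by metis
  have D': "\<bar>\<phi>' x b\<bar> \<le> D" for x using D(1) D(2)[of x] by (cases "norm x \<le> R") auto
  have M: "0 \<le> M" using v(2)[of 0] by linarith
  have \<phi>i: "integrable lborel \<phi>" by (rule continuous_compact_support_integrable[OF \<phi>c \<phi>(3)])
  \<comment> \<open>The directional derivative is a pointwise limit of Borel difference quotients,
    hence Borel without any continuity.\<close>
  have vm[measurable]: "(\<lambda>x. v' x b) \<in> borel_measurable borel"
    by (rule borel_measurable_LIMSEQ_real[OF difference_quotient_tendsto[OF v(1) t(1,2)]]) measurable
  have vq: "\<bar>v (x - t n *\<^sub>R b) - v x\<bar> \<le> B * t n" for x n
    using directional_lipschitz[OF v(1) v(3), of x "- t n"] t(3)[of n] by simp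
  have pq: "\<bar>\<phi> (x + t n *\<^sub>R b) - \<phi> x\<bar> \<le> D * t n" for x n
    using directional_lipschitz[OF \<phi>(1) D', of x "t n"] t(3)[of n] by simp
  have lim1: "(\<lambda>n. \<integral>x. v x * ((\<phi> (x + t n *\<^sub>R b) - \<phi> x) / t n) \<partial>lborel) \<longlonglongrightarrow> (\<integral>x. v x * \<phi>' x b \<partial>lborel)"
  proof (rule integral_dominated_convergence)
    show "integrable lborel (\<lambda>x::'a. M * D * indicator (cball 0 (R + 1)) x :: real)"
      using emeasure_lborel_cball_finite[of "0::'a" "R + 1"] by (intro integrable_mult_right integrable_real_indicator) auto
    show "AE x in lborel. (\<lambda>n. v x * ((\<phi> (x + t n *\<^sub>R b) - \<phi> x) / t n)) \<longlonglongrightarrow> v x * \<phi>' x b"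
      by (intro AE_I2 tendsto_mult_left difference_quotient_tendsto \<phi> t)
    show "AE x in lborel. norm (v x * ((\<phi> (x + t n *\<^sub>R b) - \<phi> x) / t n)) \<le> M * D * indicator (cball 0 (R + 1)) x" for n
    proof (rule AE_I2)
      fix x
      have "\<bar>(\<phi> (x + t n *\<^sub>R b) - \<phi> x) / t n\<bar> \<le> D * indicator (cball 0 (R + 1)) x"
      proof (cases "norm x \<le> R + 1")
        case True then show ?thesis using pq[of x n] t(3)[of n] by (simp add: field_simps)
      next
        case False
        then have "R < norm (x + t n *\<^sub>R b)" using norm_triangle_ineq4[of "x + t n *\<^sub>R b" "t n *\<^sub>R b"] t(3,4)[of n] b by simp
        then show ?thesis using False \<phi>(3)[of x] \<phi>(3)[of "x + t n *\<^sub>R b"] by simp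
      qed
      then have "\<bar>v x\<bar> * \<bar>(\<phi> (x + t n *\<^sub>R b) - \<phi> x) / t n\<bar> \<le> M * (D * indicator (cball 0 (R + 1)) x)"
        by (intro mult_mono v M) auto
      then show "norm (v x * ((\<phi> (x + t n *\<^sub>R b) - \<phi> x) / t n)) \<le> M * D * indicator (cball 0 (R + 1)) x"
        by (simp add: abs_mult mult.assoc)
    qed
  qed measurable
  have lim2: "(\<lambda>n. \<integral>x. (v (x - t n *\<^sub>R b) - v x) / t n * \<phi> x \<partial>lborel) \<longlonglongrightarrow> (\<integral>x. - v' x b * \<phi> x \<partial>lborel)"
  proof (rule integral_dominated_convergence)
    show "integrable lborel (\<lambda>x. B * \<bar>\<phi> x\<bar>)" using \<phi>i by simp
    show "AE x in lborel. (\<lambda>n. (v (x - t n *\<^sub>R b) - v x) / t n * \<phi> x) \<longlonglongrightarrow> - v' x b * \<phi> x"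
    proof (intro AE_I2 tendsto_mult_right)
      fix x
      have "(\<lambda>n. (v (x + (- t n) *\<^sub>R b) - v x) / (- t n)) \<longlonglongrightarrow> v' x b"
        using tendsto_minus[OF t(1)] t(2) by (intro difference_quotient_tendsto v) auto
      from tendsto_minus[OF this] show "(\<lambda>n. (v (x - t n *\<^sub>R b) - v x) / t n) \<longlonglongrightarrow> - v' x b" by simp
    qed
    show "AE x in lborel. norm ((v (x - t n *\<^sub>R b) - v x) / t n * \<phi> x) \<le> B * \<bar>\<phi> x\<bar>" for n
    proof (rule AE_I2)
      fix x
      have "\<bar>(v (x - t n *\<^sub>R b) - v x) / t n\<bar> \<le> B" using vq[of x n] t(3)[of n] by (simp add: field_simps)
      then have "\<bar>(v (x - t n *\<^sub>R b) - v x) / t n\<bar> * \<bar>\<phi> x\<bar> \<le> B * \<bar>\<phi> x\<bar>" by (rule mult_right_mono) simp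
      then show "norm ((v (x - t n *\<^sub>R b) - v x) / t n * \<phi> x) \<le> B * \<bar>\<phi> x\<bar>" by (simp only: real_norm_def abs_mult)
    qed
  qed measurable
  have eqn: "(\<integral>x. v x * ((\<phi> (x + t n *\<^sub>R b) - \<phi> x) / t n) \<partial>lborel) = (\<integral>x. (v (x - t n *\<^sub>R b) - v x) / t n * \<phi> x \<partial>lborel)" for n
  proof -
    have vi: "integrable lborel (\<lambda>x. v (x + c) * \<phi> x)" for c
      by (rule Bochner_Integration.integrable_bound[OF integrable_mult_right[OF \<phi>i, of M]])
         (use v(2) M in \<open>auto simp: abs_mult intro!: mult_right_mono\<close>)
    have s1: "(\<integral>x. v x * \<phi> (x + t n *\<^sub>R b) \<partial>lborel) = (\<integral>x. v (x - t n *\<^sub>R b) * \<phi> x \<partial>lborel)"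
      using lborel_integral_shift[of "\<lambda>x. v x * \<phi> (x + t n *\<^sub>R b)" "- t n *\<^sub>R b"] by simp
    have s2: "integrable lborel (\<lambda>x. v x * \<phi> (x + t n *\<^sub>R b))"
      using lborel_integrable_shift[of "\<lambda>x. v x * \<phi> (x + t n *\<^sub>R b)" "- t n *\<^sub>R b"] vi[of "- t n *\<^sub>R b"] by simp
    have "(\<integral>x. v x * ((\<phi> (x + t n *\<^sub>R b) - \<phi> x) / t n) \<partial>lborel) = (\<integral>x. (v x * \<phi> (x + t n *\<^sub>R b) - v x * \<phi> x) / t n \<partial>lborel)"
      by (simp add: right_diff_distrib)
    also have "\<dots> = ((\<integral>x. v x * \<phi> (x + t n *\<^sub>R b) \<partial>lborel) - (\<integral>x. v x * \<phi> x \<partial>lborel)) / t n"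
      using s2 vi[of 0] by simp
    also have "\<dots> = (\<integral>x. (v (x - t n *\<^sub>R b) * \<phi> x - v x * \<phi> x) / t n \<partial>lborel)"
      using vi[of 0] vi[of "- t n *\<^sub>R b"] by (simp add: s1)
    also have "\<dots> = (\<integral>x. (v (x - t n *\<^sub>R b) - v x) / t n * \<phi> x \<partial>lborel)"
      by (simp add: left_diff_distrib)
    finally show ?thesis .
  qed
  have "(\<integral>x. v x * \<phi>' x b \<partial>lborel) = (\<integral>x. - v' x b * \<phi> x \<partial>lborel)"
    by (rule LIMSEQ_unique[OF lim1[unfolded eqn] lim2])
  then show ?thesis by simp
qed

section \<open>Test functions and lower semicontinuity of the total variation\<close>

lemma test_functionD:
  fixes \<phi> :: "real^'n::finite \<Rightarrow> 'b::real_normed_vector"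
  assumes "test_function \<phi>"
  shows "(\<phi> has_derivative frechet_derivative \<phi> (at x)) (at x)"
    and "continuous_on UNIV \<phi>" and "continuous_on UNIV (partial_deriv i \<phi>)"
    and "\<exists>R. \<forall>x. R < norm x \<longrightarrow> \<phi> x = 0"
proof -
  have C: "C_k k \<phi>" for k using assms by (simp add: test_function_def)
  have "\<phi> differentiable (at x)" for x using C[of 1] by simp
  then show "(\<phi> has_derivative frechet_derivative \<phi> (at x)) (at x)" by (simp add: frechet_derivative_works)
  show "continuous_on UNIV \<phi>" using C[of 0] by simp
  show "continuous_on UNIV (partial_deriv i \<phi>)" using C[of 1] by simp
  have "bounded (closure {x. \<phi> x \<noteq> 0})" using assms by (auto simp: test_function_def intro: compact_imp_bounded)
  then obtain R where R: "\<forall>x\<in>closure {x. \<phi> x \<noteq> 0}. norm x \<le> R" by (auto simp: bounded_iff)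
  show "\<exists>R. \<forall>x. R < norm x \<longrightarrow> \<phi> x = 0"
    using R closure_subset[of "{x. \<phi> x \<noteq> 0}"] by (intro exI[of _ R]) (auto simp: subset_eq not_le[symmetric])
qed

lemma partial_deriv_zero_outside:
  fixes \<phi> :: "real^'n::finite \<Rightarrow> 'b::real_normed_vector"
  assumes "test_function \<phi>" "\<And>x. R < norm x \<Longrightarrow> \<phi> x = 0" "R < norm x"
  shows "partial_deriv i \<phi> x = 0"
proof -
  have "open (- cball (0::real^'n) R)" by auto
  then have "(\<phi> has_derivative (\<lambda>_. 0)) (at x)"
    using assms by (intro has_derivative_transform_within_open[OF has_derivative_const[of 0], where s="- cball 0 R"]) auto
  then show ?thesis using has_derivative_unique[OF test_functionD(1)[OF assms(1)]] by (simp add: partial_deriv_def)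
qed

lemma partial_deriv_component:
  fixes \<phi> :: "real^'n::finite \<Rightarrow> real^'m::finite"
  assumes "test_function \<phi>"
  shows "((\<lambda>y. \<phi> y $ j) has_derivative (\<lambda>h. frechet_derivative \<phi> (at x) h $ j)) (at x)"
    and "partial_deriv i (\<lambda>y. \<phi> y $ j) x = partial_deriv i \<phi> x $ j"
proof -
  show d: "((\<lambda>y. \<phi> y $ j) has_derivative (\<lambda>h. frechet_derivative \<phi> (at x) h $ j)) (at x)"
    by (intro bounded_linear.has_derivative[OF bounded_linear_vec_nth] test_functionD assms)
  show "partial_deriv i (\<lambda>y. \<phi> y $ j) x = partial_deriv i \<phi> x $ j"
    unfolding partial_deriv_def frechet_derivative_at[OF d, symmetric] ..
qed

text \<open>For a fixed test field, integration by parts bounds the integral of \<open>w j\<close>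
  against the divergence by the L^1 norm of \<open>G j\<close>, hence by S. The divergence is
  continuous with compact support, so \<open>lim\<close> carries the bound to v, and the supremum
  over the fields is taken last.\<close>

lemma total_variation_le:
  fixes u v :: "real^'n::finite \<Rightarrow> real" and w :: "nat \<Rightarrow> real^'n \<Rightarrow> real" and G :: "nat \<Rightarrow> real^'n \<Rightarrow> real^'n"
  assumes um: "u \<in> borel_measurable lebesgue" and vm: "v \<in> borel_measurable borel" and uv: "AE x in lebesgue. u x = v x"
    and w: "\<And>j x. (w j has_derivative (\<lambda>h. G j x \<bullet> h)) (at x)" "\<And>j x. \<bar>w j x\<bar> \<le> M j" "\<And>j x. norm (G j x) \<le> B j"
    and [measurable]: "\<And>j. G j \<in> borel_measurable borel"
    and S: "\<And>j. (\<integral>\<^sup>+x. ennreal (norm (G j x)) \<partial>lborel) \<le> S"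
    and lim: "\<And>\<psi> R. continuous_on UNIV \<psi> \<Longrightarrow> (\<And>x. R < norm x \<Longrightarrow> \<psi> x = 0) \<Longrightarrow>
      (\<lambda>j. \<integral>x. w j x * \<psi> x \<partial>lborel) \<longlonglongrightarrow> (\<integral>x. v x * \<psi> x \<partial>lborel)"
  shows "total_variation u \<le> S"
  unfolding total_variation_def
proof (rule SUP_least)
  fix \<phi> :: "real^'n \<Rightarrow> real^'n" assume "\<phi> \<in> {\<phi>. test_function \<phi> \<and> (AE x in lebesgue. norm (\<phi> x) \<le> 1)}"
  then have \<phi>: "test_function \<phi>" and le1: "AE x in lebesgue. norm (\<phi> x) \<le> 1" by auto
  note [measurable] = vm
  obtain R where R: "\<And>x. R < norm x \<Longrightarrow> \<phi> x = 0" using test_functionD(4)[OF \<phi>] by auto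
  have c: "continuous_on UNIV (divergence \<phi>)"
    unfolding divergence_def partial_deriv_component(2)[OF \<phi>]
    by (intro continuous_intros test_functionD(3)[OF \<phi>])
  have d0: "divergence \<phi> x = 0" if "R < norm x" for x
    unfolding divergence_def partial_deriv_component(2)[OF \<phi>] using partial_deriv_zero_outside[OF \<phi> R that] by simp
  have \<phi>m[measurable]: "\<phi> \<in> borel_measurable borel" by (intro borel_measurable_continuous_onI test_functionD[OF \<phi>])
  have dm[measurable]: "divergence \<phi> \<in> borel_measurable borel" by (intro borel_measurable_continuous_onI c)
  have vm': "v \<in> borel_measurable lebesgue" and dm': "divergence \<phi> \<in> borel_measurable lebesgue"
    by (intro measurable_completion; use vm dm in simp)+
  have "(LINT x|lebesgue. u x * divergence \<phi> x) = (LINT x|lebesgue. v x * divergence \<phi> x)"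
    using uv by (intro integral_cong_AE) (auto intro!: borel_measurable_times um vm' dm')
  also have "\<dots> = (\<integral>x. v x * divergence \<phi> x \<partial>lborel)"
    by (rule integral_completion) measurable
  finally have eq: "(LINT x|lebesgue. u x * divergence \<phi> x) = (\<integral>x. v x * divergence \<phi> x \<partial>lborel)" .
  have ni: "integrable lborel (\<lambda>x. norm (\<phi> x))"
    by (rule continuous_compact_support_integrable[where R=R]) (use R in \<open>auto intro!: continuous_on_norm test_functionD[OF \<phi>]\<close>)
  have "AE x in lborel. norm (\<phi> x) \<le> 1"
    using le1 by (subst (asm) AE_completion_iff) auto
  have bound: "ennreal \<bar>\<integral>x. w j x * divergence \<phi> x \<partial>lborel\<bar> \<le> S" for j
  proof -
    have ip: "integrable lborel (\<lambda>x. w j x * partial_deriv i (\<lambda>y. \<phi> y $ i) x)" for i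
    proof -
      have cp: "continuous_on UNIV (partial_deriv i (\<lambda>y. \<phi> y $ i))"
        unfolding partial_deriv_component(2)[OF \<phi>, abs_def] by (intro continuous_intros test_functionD(3)[OF \<phi>])
      have wc: "continuous_on UNIV (w j)" using w(1) by (intro continuous_at_imp_continuous_on ballI has_derivative_continuous)
      show ?thesis
      proof (rule continuous_compact_support_integrable[where R=R])
        show "continuous_on UNIV (\<lambda>x. w j x * partial_deriv i (\<lambda>y. \<phi> y $ i) x)" by (intro continuous_on_mult wc cp)
        show "w j x * partial_deriv i (\<lambda>y. \<phi> y $ i) x = 0" if "R < norm x" for x
          using partial_deriv_zero_outside[OF \<phi> R that] by (simp add: partial_deriv_component(2)[OF \<phi>])
      qed
    qed
    have iG: "integrable lborel (\<lambda>x. G j x $ i * \<phi> x $ i)" for i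
    proof (rule Bochner_Integration.integrable_bound[OF integrable_mult_right[OF ni, of "B j"]])
      have "\<bar>G j x $ i\<bar> * \<bar>\<phi> x $ i\<bar> \<le> B j * norm (\<phi> x)" for x
        using component_le_norm_cart[of "G j x" i] component_le_norm_cart[of "\<phi> x" i] w(3)[of j x] norm_ge_zero[of "G j x"]
        by (intro mult_mono) (auto simp del: norm_ge_zero)
      then show "AE x in lborel. norm (G j x $ i * \<phi> x $ i) \<le> norm (B j * norm (\<phi> x))"
        by (intro AE_I2) (metis abs_mult order_trans abs_ge_self real_norm_def)
    qed measurable
    have parts: "(\<integral>x. w j x * partial_deriv i (\<lambda>y. \<phi> y $ i) x \<partial>lborel) = - (\<integral>x. G j x $ i * \<phi> x $ i \<partial>lborel)" for i
    proof -
      have gb: "\<bar>G j x \<bullet> axis i 1\<bar> \<le> B j" for x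
        using component_le_norm_cart[of "G j x" i] w(3)[of j x] by (simp add: inner_axis)
      have cc: "continuous_on UNIV (\<lambda>x. frechet_derivative \<phi> (at x) (axis i 1) $ i)"
        using test_functionD(3)[OF \<phi>, of i] unfolding partial_deriv_def by (intro continuous_intros)
      have R': "\<phi> x $ i = 0" if "R < norm x" for x using R[OF that] by simp
      have "(\<integral>x. w j x * frechet_derivative \<phi> (at x) (axis i 1) $ i \<partial>lborel) = - (\<integral>x. (G j x \<bullet> axis i 1) * \<phi> x $ i \<partial>lborel)"
        by (rule integration_by_parts_direction[OF w(1,2) gb partial_deriv_component(1)[OF \<phi>] cc R']) auto
      then show ?thesis by (simp add: partial_deriv_component(2)[OF \<phi>] partial_deriv_def inner_axis)
    qed
    have "(\<integral>x. w j x * divergence \<phi> x \<partial>lborel) = (\<Sum>i\<in>UNIV. \<integral>x. w j x * partial_deriv i (\<lambda>y. \<phi> y $ i) x \<partial>lborel)"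
      unfolding divergence_def sum_distrib_left using ip by (intro Bochner_Integration.integral_sum) auto
    also have "\<dots> = - (\<integral>x. G j x \<bullet> \<phi> x \<partial>lborel)"
      unfolding parts inner_vec_def using iG by (simp add: sum_negf Bochner_Integration.integral_sum)
    finally have "\<bar>\<integral>x. w j x * divergence \<phi> x \<partial>lborel\<bar> = norm (\<integral>x. G j x \<bullet> \<phi> x \<partial>lborel)" by simp
    then have "ennreal \<bar>\<integral>x. w j x * divergence \<phi> x \<partial>lborel\<bar> \<le> (\<integral>\<^sup>+x. ennreal (norm (G j x \<bullet> \<phi> x)) \<partial>lborel)"
      using integral_norm_bound_ennreal[of lborel "\<lambda>x. G j x \<bullet> \<phi> x"] iG unfolding inner_vec_def by simp
    also have "\<dots> \<le> (\<integral>\<^sup>+x. ennreal (norm (G j x)) \<partial>lborel)"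
      using \<open>AE x in lborel. norm (\<phi> x) \<le> 1\<close>
    proof (intro nn_integral_mono_AE, eventually_elim)
      case (elim x)
      have "\<bar>G j x \<bullet> \<phi> x\<bar> \<le> norm (G j x) * norm (\<phi> x)" by (rule Cauchy_Schwarz_ineq2)
      also have "\<dots> \<le> norm (G j x) * 1" using elim by (intro mult_left_mono) auto
      finally show ?case by (intro ennreal_leI) simp
    qed
    also have "\<dots> \<le> S" by (rule S)
    finally show ?thesis .
  qed
  have "(\<lambda>j. ennreal \<bar>\<integral>x. w j x * divergence \<phi> x \<partial>lborel\<bar>) \<longlonglongrightarrow> ennreal \<bar>\<integral>x. v x * divergence \<phi> x \<partial>lborel\<bar>"
    by (intro tendsto_ennrealI tendsto_rabs lim[OF c d0])
  then show "ennreal \<bar>LINT x|lebesgue. u x * divergence \<phi> x\<bar> \<le> S"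
    unfolding eq by (rule LIMSEQ_le_const2) (use bound in auto)
qed

section \<open>Smooth bump functions\<close>

text \<open>For \<open>m = 0\<close> this is the classical function exp(-1/t) extended by 0. The
  powers of 1/t are the factors that its derivatives produce, so the family is closed under
  differentiation up to linear combinations.\<close>

definition flat_exp :: "nat \<Rightarrow> real \<Rightarrow> real" where
  "flat_exp m t = (if t \<le> 0 then 0 else inverse t ^ m * exp (- inverse t))"

lemma flat_exp_tendsto_0: "(flat_exp m \<longlongrightarrow> 0) (at_right 0)"
proof -
  have "((\<lambda>t::real. inverse t ^ m / exp (inverse t)) \<longlongrightarrow> 0) (at_right 0)"
    by (rule filterlim_compose[OF tendsto_power_div_exp_0 filterlim_inverse_at_top_right])
  moreover have "\<forall>\<^sub>F t::real in at_right 0. 0 < t" by (rule eventually_at_right_less)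
  then have "\<forall>\<^sub>F t::real in at_right 0. inverse t ^ m / exp (inverse t) = flat_exp m t"
    by eventually_elim (simp add: flat_exp_def exp_minus divide_inverse)
  ultimately show ?thesis by (rule Lim_transform_eventually)
qed

text \<open>Only t = 0 is delicate: there the right difference quotient of \<open>flat_exp m\<close>
  is \<open>flat_exp (Suc m)\<close>, which tends to 0, and the left one is identically 0.\<close>

lemma flat_exp_has_derivative:
  "(flat_exp m has_real_derivative flat_exp (m + 2) t - m * flat_exp (m + 1) t) (at t)"
proof -
  consider "t < 0" | "t = 0" | "0 < t" by linarith
  then show ?thesis
  proof cases
    case 1
    have "((\<lambda>_. 0) has_real_derivative 0) (at t)" by simp
    then have "(flat_exp m has_real_derivative 0) (at t)"
      by (rule has_field_derivative_transform_within_open[where S="{..<0}"]) (use 1 in \<open>auto simp: flat_exp_def\<close>)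
    then show ?thesis using 1 by (simp add: flat_exp_def)
  next
    case 2
    have "((\<lambda>s. flat_exp m s / s) \<longlongrightarrow> 0) (at_right 0)"
    proof (rule Lim_transform_eventually[OF flat_exp_tendsto_0[of "Suc m"]])
      have "\<forall>\<^sub>F t::real in at_right 0. 0 < t" by (rule eventually_at_right_less)
      then show "\<forall>\<^sub>F s in at_right 0. flat_exp (Suc m) s = flat_exp m s / s"
        by eventually_elim (simp add: flat_exp_def field_simps)
    qed
    moreover have "((\<lambda>s. flat_exp m s / s) \<longlongrightarrow> 0) (at_left 0)"
    proof (rule Lim_transform_eventually[OF tendsto_const])
      have "\<forall>\<^sub>F t::real in at_left 0. t < 0" by (auto simp: eventually_at_filter)
      then show "\<forall>\<^sub>F s in at_left 0. 0 = flat_exp m s / s"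
        by eventually_elim (simp add: flat_exp_def)
    qed
    ultimately have "((\<lambda>s. flat_exp m s / s) \<longlongrightarrow> 0) (at 0)" by (simp add: filterlim_at_split)
    then show ?thesis using 2 by (simp add: DERIV_def flat_exp_def)
  next
    case 3
    have d: "(inverse has_real_derivative - (inverse t ^ Suc (Suc 0))) (at t)"
      using 3 by (intro DERIV_inverse) auto
    have "((\<lambda>t. inverse t ^ m * exp (- inverse t)) has_real_derivative flat_exp (m + 2) t - m * flat_exp (m + 1) t) (at t)"
      by (rule DERIV_cong[OF DERIV_mult[OF DERIV_power[OF d, of m] DERIV_chain2[OF DERIV_exp DERIV_minus[OF d]]]])
         (use 3 in \<open>cases m; simp add: flat_exp_def algebra_simps\<close>)
    then show ?thesis
      by (rule has_field_derivative_transform_within_open[where S="{0<..}"]) (use 3 in \<open>auto simp: flat_exp_def\<close>)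
  qed
qed

lemma flat_exp_0_bounds: "0 \<le> flat_exp 0 t" "flat_exp 0 t \<le> 1" "t \<le> 0 \<Longrightarrow> flat_exp 0 t = 0"
  by (auto simp: flat_exp_def)

text \<open>This class is closed under partial derivatives, hence contained in every \<open>C_k\<close>.\<close>

inductive smooth_generated :: "(real^'n::finite \<Rightarrow> real) \<Rightarrow> bool" where
  const: "smooth_generated (\<lambda>x. c)"
| flat: "smooth_generated (\<lambda>x. flat_exp m (a * x $ i + b))"
| add: "smooth_generated f \<Longrightarrow> smooth_generated g \<Longrightarrow> smooth_generated (\<lambda>x. f x + g x)"
| mult: "smooth_generated f \<Longrightarrow> smooth_generated g \<Longrightarrow> smooth_generated (\<lambda>x. f x * g x)"

lemma smooth_generated_deriv:
  fixes f :: "real^'n::finite \<Rightarrow> real"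
  assumes "smooth_generated f"
  shows "(\<forall>x. f differentiable (at x)) \<and> (\<forall>i. smooth_generated (partial_deriv i f))"
  using assms
proof induction
  case (const c)
  have "partial_deriv i (\<lambda>x::real^'n. c) = (\<lambda>x. 0)" for i :: 'n
    by (auto simp: partial_deriv_def fun_eq_iff frechet_derivative_at[OF has_derivative_const, symmetric])
  then show ?case by (auto intro: smooth_generated.const)
next
  case (flat m a i b)
  define D where "D = (\<lambda>t. flat_exp (m + 2) t - m * flat_exp (m + 1) t)"
  have d: "((\<lambda>x::real^'n. flat_exp m (a * x $ i + b)) has_derivative (\<lambda>h. (a * h $ i) * D (a * x $ i + b))) (at x)" for x
  proof -
    have "((\<lambda>x::real^'n. a * x $ i + b) has_derivative (\<lambda>h. a * h $ i)) (at x)"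
      by (auto intro!: derivative_eq_intros bounded_linear_imp_has_derivative bounded_linear_vec_nth)
    then show ?thesis
      using DERIV_compose_FDERIV[of "flat_exp m" "D (a * x $ i + b)" "\<lambda>x. a * x $ i + b" x "\<lambda>h. a * h $ i" UNIV]
        flat_exp_has_derivative[of m "a * x $ i + b"] by (simp add: D_def)
  qed
  have "partial_deriv j (\<lambda>x::real^'n. flat_exp m (a * x $ i + b))
    = (\<lambda>x. (a * axis j 1 $ i) * (flat_exp (m + 2) (a * x $ i + b) + (- real m) * flat_exp (m + 1) (a * x $ i + b)))" for j
    by (auto simp: partial_deriv_def fun_eq_iff frechet_derivative_at[OF d, symmetric] D_def)
  moreover have "smooth_generated (\<lambda>x::real^'n. (a * axis j 1 $ i) * (flat_exp (m + 2) (a * x $ i + b) + (- real m) * flat_exp (m + 1) (a * x $ i + b)))" for j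
    by (intro smooth_generated.intros)
  ultimately show ?case using d by (auto simp: differentiable_def)
next
  case (add f g)
  have f: "(f has_derivative frechet_derivative f (at x)) (at x)" and g: "(g has_derivative frechet_derivative g (at x)) (at x)" for x
    using add by (auto simp: frechet_derivative_works[symmetric])
  have "partial_deriv i (\<lambda>x. f x + g x) = (\<lambda>x. partial_deriv i f x + partial_deriv i g x)" for i
    by (auto simp: partial_deriv_def fun_eq_iff frechet_derivative_at[OF has_derivative_add[OF f g], symmetric])
  then show ?case using add by (auto intro: smooth_generated.add)
next
  case (mult f g)
  have f: "(f has_derivative frechet_derivative f (at x)) (at x)" and g: "(g has_derivative frechet_derivative g (at x)) (at x)" for x
    using mult by (auto simp: frechet_derivative_works[symmetric])
  have "partial_deriv i (\<lambda>x. f x * g x) = (\<lambda>x. f x * partial_deriv i g x + partial_deriv i f x * g x)" for i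
    by (auto simp: partial_deriv_def fun_eq_iff frechet_derivative_at[OF has_derivative_mult[OF f g], symmetric])
  then show ?case using mult by (auto intro!: smooth_generated.add smooth_generated.mult)
qed

lemma smooth_generated_C_k: "smooth_generated f \<Longrightarrow> C_k k f"
proof (induction k arbitrary: f)
  case 0
  then show ?case using smooth_generated_deriv[OF 0]
    by (auto intro!: continuous_at_imp_continuous_on differentiable_imp_continuous_within)
next
  case (Suc k)
  then show ?case using smooth_generated_deriv[OF Suc.prems] by simp
qed

lemma smooth_generated_prod:
  "finite A \<Longrightarrow> (\<And>i. i \<in> A \<Longrightarrow> smooth_generated (f i)) \<Longrightarrow> smooth_generated (\<lambda>x. \<Prod>i\<in>A. f i x)"
  by (induction A rule: finite_induct) (auto intro: smooth_generated.const smooth_generated.mult)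

text \<open>The two arguments are k (x_i - l_i) and k (u_i - x_i), written in the form
  \<open>a * x $ i + b\<close> of the rule \<open>smooth_generated.flat\<close>. As k grows, the
  product sharpens to the indicator of the open box.\<close>

definition box_bump :: "real \<Rightarrow> real^'n::finite \<Rightarrow> real^'n \<Rightarrow> real^'n \<Rightarrow> real" where
  "box_bump k l u x = (\<Prod>i\<in>UNIV. flat_exp 0 (k * x $ i + - k * l $ i) * flat_exp 0 (- k * x $ i + k * u $ i))"

lemma box_bump_bounds: "0 \<le> box_bump k l u x" "box_bump k l u x \<le> 1"
  unfolding box_bump_def using flat_exp_0_bounds
  by (auto intro!: prod_nonneg prod_le_1 mult_nonneg_nonneg mult_le_one)

lemma box_bump_outside:
  assumes "0 < k" "x \<notin> box l u"
  shows "box_bump k l u x = 0"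
proof -
  obtain i where i: "x $ i \<le> l $ i \<or> u $ i \<le> x $ i" using assms(2) by (auto simp: mem_box_cart not_less)
  have "k * x $ i + - k * l $ i = k * (x $ i - l $ i)" "- k * x $ i + k * u $ i = k * (u $ i - x $ i)"
    by (simp_all add: algebra_simps)
  then have "k * x $ i + - k * l $ i \<le> 0 \<or> - k * x $ i + k * u $ i \<le> 0"
    using i assms(1) by (auto simp: mult_le_0_iff)
  then have "flat_exp 0 (k * x $ i + - k * l $ i) * flat_exp 0 (- k * x $ i + k * u $ i) = 0"
    using flat_exp_0_bounds(3) by auto
  then show ?thesis unfolding box_bump_def by (intro prod_zero) auto
qed

lemma box_bump_tendsto: "(\<lambda>n. box_bump (real (Suc n)) l u x) \<longlonglongrightarrow> indicator (box l u) x"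
proof (cases "x \<in> box l u")
  case False
  then show ?thesis by (simp add: box_bump_outside del: of_nat_Suc)
next
  case True
  have lim: "(\<lambda>n. flat_exp 0 (real (Suc n) * s)) \<longlonglongrightarrow> 1" if s: "0 < s" for s
  proof -
    have "(\<lambda>n. exp (- (inverse (real (Suc n)) * inverse s))) \<longlonglongrightarrow> exp (- (0 * inverse s))"
      by (intro tendsto_intros LIMSEQ_inverse_real_of_nat)
    moreover have "flat_exp 0 (real (Suc n) * s) = exp (- (inverse (real (Suc n)) * inverse s))" for n
      using s by (simp add: flat_exp_def not_le inverse_mult_distrib mult_pos_pos del: of_nat_Suc)
    ultimately show ?thesis by simp
  qed
  have "(\<lambda>n. box_bump (real (Suc n)) l u x) \<longlonglongrightarrow> (\<Prod>i\<in>(UNIV :: 'a set). 1 * 1)"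
    unfolding box_bump_def
  proof (intro tendsto_prod tendsto_mult)
    fix i :: 'a
    have "l $ i < x $ i" "x $ i < u $ i" using True by (auto simp: mem_box_cart)
    then show "(\<lambda>n. flat_exp 0 (real (Suc n) * x $ i + - real (Suc n) * l $ i)) \<longlonglongrightarrow> 1"
      "(\<lambda>n. flat_exp 0 (- real (Suc n) * x $ i + real (Suc n) * u $ i)) \<longlonglongrightarrow> 1"
      using lim[of "x $ i - l $ i"] lim[of "u $ i - x $ i"] by (simp_all add: algebra_simps)
  qed
  then show ?thesis using True by simp
qed

lemma box_bump_test_function:
  assumes "0 < k"
  shows "test_function (box_bump k l u)"
proof -
  have "smooth_generated (box_bump k l u)"
    unfolding box_bump_def[abs_def]
    by (intro smooth_generated_prod smooth_generated.mult smooth_generated.flat) auto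
  moreover have "{x. box_bump k l u x \<noteq> 0} \<subseteq> cbox l u"
    using box_bump_outside[OF assms] box_subset_cbox by blast
  then have "bounded {x. box_bump k l u x \<noteq> 0}" using bounded_cbox bounded_subset by blast
  ultimately show ?thesis unfolding test_function_def using smooth_generated_C_k by (auto simp: compact_closure)
qed

text \<open>The measures with densities given by the positive and the negative part of g agree and
  are finite on open boxes, an intersection-stable generator that exhausts the space, so they
  coincide. On the set where g is positive the second one vanishes, hence so does the integral of
  the positive part.\<close>

lemma AE_nonpos_if_box_integrals_zero:
  fixes g :: "'a::euclidean_space \<Rightarrow> real"
  assumes [measurable]: "g \<in> borel_measurable borel"
    and I: "\<And>l u. integrable lborel (\<lambda>x. indicator (box l u) x * g x)"
    and 0: "\<And>l u. (\<integral>x. indicator (box l u) x * g x \<partial>lborel) = 0"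
  shows "AE x in lborel. g x \<le> 0"
proof -
  let ?P = "density lborel (\<lambda>x. ennreal (g x))" and ?M = "density lborel (\<lambda>x. ennreal (- g x))"
  have box: "emeasure ?P (box l u) = emeasure ?M (box l u)" "emeasure ?P (box l u) < \<infinity>" for l u
  proof -
    let ?f = "\<lambda>x. indicator (box l u) x * g x"
    have e: "emeasure ?P (box l u) = (\<integral>\<^sup>+x. ennreal (?f x) \<partial>lborel)" "emeasure ?M (box l u) = (\<integral>\<^sup>+x. ennreal (- ?f x) \<partial>lborel)"
      by (auto simp: emeasure_density indicator_def intro!: nn_integral_cong)
    have fin: "(\<integral>\<^sup>+x. ennreal (?f x) \<partial>lborel) < \<infinity>" "(\<integral>\<^sup>+x. ennreal (- ?f x) \<partial>lborel) < \<infinity>"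
      using I[of l u] unfolding real_integrable_def by (auto simp: top.not_eq_extremum)
    have "enn2real (\<integral>\<^sup>+x. ennreal (?f x) \<partial>lborel) = enn2real (\<integral>\<^sup>+x. ennreal (- ?f x) \<partial>lborel)"
      using real_lebesgue_integral_def[OF I[of l u]] 0[of l u] by simp
    then show "emeasure ?P (box l u) = emeasure ?M (box l u)" "emeasure ?P (box l u) < \<infinity>"
      unfolding e using fin by (metis ennreal_enn2real infinity_ennreal_def)+
  qed
  have "?P = ?M"
  proof (rule measure_eqI_generator_eq)
    let ?E = "range (\<lambda>(a, b). box a b::'a set)"
    show "Int_stable ?E" by (auto simp: Int_stable_def box_Int_box)
    show "?E \<subseteq> Pow UNIV" "sets ?P = sigma_sets UNIV ?E" "sets ?M = sigma_sets UNIV ?E"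
      by (simp_all add: borel_eq_box)
    let ?A = "\<lambda>n::nat. box (- (real n *\<^sub>R One)) (real n *\<^sub>R One) :: 'a set"
    show "range ?A \<subseteq> ?E" "(\<Union>i. ?A i) = UNIV" unfolding UN_box_eq_UNIV by auto
    show "emeasure ?P (?A i) \<noteq> \<infinity>" for i using box(2)[of "- (real i *\<^sub>R One)" "real i *\<^sub>R One"] by simp
    show "emeasure ?P X = emeasure ?M X" if "X \<in> ?E" for X using that box(1) by auto
  qed
  then have "emeasure ?P {x. 0 < g x} = emeasure ?M {x. 0 < g x}" by simp
  moreover have "emeasure ?M {x. 0 < g x} = (\<integral>\<^sup>+x. ennreal (- g x) * indicator {x. 0 < g x} x \<partial>lborel)"
    by (rule emeasure_density) auto
  moreover have "\<dots> = integral\<^sup>N lborel (\<lambda>x::'a. 0)"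
    by (intro nn_integral_cong) (auto simp: indicator_def ennreal_neg)
  moreover have "emeasure ?P {x. 0 < g x} = (\<integral>\<^sup>+x. ennreal (g x) * indicator {x. 0 < g x} x \<partial>lborel)"
    by (rule emeasure_density) auto
  ultimately have "(\<integral>\<^sup>+x. ennreal (g x) * indicator {x. 0 < g x} x \<partial>lborel) = 0" by simp
  then have "AE x in lborel. ennreal (g x) * indicator {x. 0 < g x} x = 0"
    by (subst (asm) nn_integral_0_iff_AE) auto
  then show ?thesis by eventually_elim (auto simp: indicator_def ennreal_eq_0_iff split: if_splits)
qed

text \<open>The fundamental lemma of the calculus of variations. The bumps are dominated by the
  indicator of their box and converge to it, so all box integrals of g vanish; the sign argument is
  then applied to g and to -g.\<close>

lemma AE_zero_if_test_integrals_zero: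
  fixes g :: "real^'n::finite \<Rightarrow> real"
  assumes [measurable]: "g \<in> borel_measurable borel"
    and I: "\<And>l u. integrable lborel (\<lambda>x. indicator (cbox l u) x * g x)"
    and 0: "\<And>\<phi> :: real^'n \<Rightarrow> real. test_function \<phi> \<Longrightarrow> (\<integral>x. g x * \<phi> x \<partial>lborel) = 0"
  shows "AE x in lborel. g x = 0"
proof -
  have Ib: "integrable lborel (\<lambda>x. indicator (box l u) x * g x)" for l u
    by (rule Bochner_Integration.integrable_bound[OF I[of l u]])
       (use box_subset_cbox[of l u] in \<open>auto simp: indicator_def\<close>)
  have zero: "(\<integral>x. indicator (box l u) x * g x \<partial>lborel) = 0" for l u
  proof -
    have m[measurable]: "box_bump k l u \<in> borel_measurable borel" if "0 < k" for k
      using box_bump_test_function[OF that, of l u] by (auto simp: test_function_def dest: spec[of _ 0] intro!: borel_measurable_continuous_onI)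
    have "(\<lambda>n. \<integral>x. g x * box_bump (real (Suc n)) l u x \<partial>lborel) \<longlonglongrightarrow> (\<integral>x. g x * indicator (box l u) x \<partial>lborel)"
    proof (rule integral_dominated_convergence)
      show "integrable lborel (\<lambda>x. \<bar>indicator (box l u) x * g x\<bar>)" using Ib by (rule integrable_abs)
      show "AE x in lborel. (\<lambda>n. g x * box_bump (real (Suc n)) l u x) \<longlonglongrightarrow> g x * indicator (box l u) x"
        by (intro AE_I2 tendsto_mult_left box_bump_tendsto)
      show "AE x in lborel. norm (g x * box_bump (real (Suc n)) l u x) \<le> \<bar>indicator (box l u) x * g x\<bar>" for n
        using box_bump_bounds[of "real (Suc n)" l u] box_bump_outside[of "real (Suc n)" _ l u]
        by (intro AE_I2) (auto simp: indicator_def abs_mult mult_left_le simp del: of_nat_Suc)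
      show "(\<lambda>x. g x * box_bump (real (Suc n)) l u x) \<in> borel_measurable lborel" for n
        using m[of "real (Suc n)"] by measurable
    qed measurable
    moreover have "(\<integral>x. g x * box_bump (real (Suc n)) l u x \<partial>lborel) = 0" for n
      by (intro 0 box_bump_test_function) simp
    ultimately show ?thesis by (simp add: LIMSEQ_const_iff mult.commute)
  qed
  have "AE x in lborel. g x \<le> 0" by (rule AE_nonpos_if_box_integrals_zero[OF _ Ib zero]) measurable
  moreover have "AE x in lborel. - g x \<le> 0"
    by (rule AE_nonpos_if_box_integrals_zero) (use Ib zero in auto)
  ultimately show ?thesis by eventually_elim auto
qed

section \<open>Uniform convexity and limits in \<open>L\<^sup>p\<close>\<close>

text \<open>The gap in the midpoint convexity of the p-th power of the norm. Its integral measures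
  how far two functions of nearly minimal energy can be from each other.\<close>

definition midpoint_defect :: "real \<Rightarrow> 'b::real_normed_vector \<Rightarrow> 'b \<Rightarrow> real" where
  "midpoint_defect p a b = (norm a powr p + norm b powr p) / 2 - norm ((1/2) *\<^sub>R (a + b)) powr p"

text \<open>The tangent at the midpoint lies below the power at s and, by the mean value theorem and
  the strictly increasing derivative, strictly below it at t. The two linear terms cancel.\<close>

lemma powr_midpoint_less:
  fixes s t p :: real
  assumes "0 \<le> s" "s < t" "1 < p"
  shows "((s + t) / 2) powr p < (s powr p + t powr p) / 2"
proof -
  define m where "m = (s + t) / 2"
  have m: "0 < m" "m < t" "0 \<le> m" using assms by (auto simp: m_def)
  have "\<exists>z. m < z \<and> z < t \<and> t powr p - m powr p = (t - m) * (p * z powr (p - 1))"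
    using m by (intro MVT2) (auto intro!: has_real_derivative_powr)
  then obtain z where z: "m < z" "z < t" "t powr p - m powr p = (t - m) * (p * z powr (p - 1))" by auto
  have "m powr (p - 1) < z powr (p - 1)" using m z assms by (intro powr_less_mono2) auto
  then have "(t - m) * (p * m powr (p - 1)) < t powr p - m powr p" unfolding z(3) using m assms by simp
  moreover have "m powr p + p * m powr (p - 1) * (s - m) \<le> s powr p" using assms m by (intro powr_above_tangent) auto
  moreover have "p * m powr (p - 1) * (s - m) = - ((t - m) * (p * m powr (p - 1)))"
    by (simp add: m_def field_simps)
  ultimately show ?thesis unfolding m_def[symmetric] by simp
qed

lemma powr_midpoint_le:
  fixes s t p :: real
  assumes "0 \<le> s" "0 \<le> t" "1 < p"
  shows "((s + t) / 2) powr p \<le> (s powr p + t powr p) / 2"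
  using powr_midpoint_less[of s t p] powr_midpoint_less[of t s p] assms
  by (cases s t rule: linorder_cases) (auto simp: add.commute)

lemma midpoint_defect_nonneg:
  assumes "1 < p"
  shows "0 \<le> midpoint_defect p a b"
proof -
  have "norm ((1/2) *\<^sub>R (a + b)) powr p \<le> ((norm a + norm b) / 2) powr p"
    using norm_triangle_ineq[of a b] assms by (intro powr_mono2) auto
  also have "\<dots> \<le> (norm a powr p + norm b powr p) / 2" using assms by (intro powr_midpoint_le) auto
  finally show ?thesis by (simp add: midpoint_defect_def)
qed

text \<open>Strict convexity of the power forces equal norms. With equal norms, a strict triangle
  inequality would make the defect positive, and equality in it makes the vectors positively
  parallel, by the inner product structure.\<close>

lemma midpoint_defect_eq_0:
  fixes a b :: "'b::real_inner"
  assumes p: "1 < p" and 0: "midpoint_defect p a b = 0"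
  shows "a = b"
proof -
  have 1: "norm ((1/2) *\<^sub>R (a + b)) powr p \<le> ((norm a + norm b) / 2) powr p"
    using norm_triangle_ineq[of a b] p by (intro powr_mono2) auto
  have n: "norm a = norm b"
    using powr_midpoint_less[of "norm a" "norm b" p] powr_midpoint_less[of "norm b" "norm a" p] p 0 1
    by (cases "norm a" "norm b" rule: linorder_cases) (auto simp: midpoint_defect_def add.commute)
  have "norm (a + b) = norm a + norm b"
  proof (rule ccontr)
    assume "norm (a + b) \<noteq> norm a + norm b"
    then have "norm ((1/2) *\<^sub>R (a + b)) < norm b" using norm_triangle_ineq[of a b] n by simp
    then have "norm ((1/2) *\<^sub>R (a + b)) powr p < norm b powr p" using p by (intro powr_less_mono2) auto
    then show False using 0 n by (simp add: midpoint_defect_def)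
  qed
  then have "norm a *\<^sub>R b = norm b *\<^sub>R a" by (simp only: norm_triangle_eq)
  then show ?thesis using n by (cases "norm a = 0") auto
qed

lemma midpoint_defect_scale:
  assumes "0 \<le> r"
  shows "midpoint_defect p (r *\<^sub>R a) (r *\<^sub>R b) = r powr p * midpoint_defect p a b"
proof -
  have "(1/2) *\<^sub>R (r *\<^sub>R a + r *\<^sub>R b) = r *\<^sub>R ((1/2) *\<^sub>R (a + b))" by (simp add: algebra_simps)
  then have "norm ((1/2) *\<^sub>R (r *\<^sub>R a + r *\<^sub>R b)) powr p = r powr p * norm ((1/2) *\<^sub>R (a + b)) powr p"
    using assms by (simp only: norm_scaleR powr_mult abs_of_nonneg)
  then show ?thesis using assms by (simp add: midpoint_defect_def powr_mult algebra_simps)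
qed

text \<open>The constant exists by compactness of the unit sphere and homogeneity.\<close>

lemma uniform_convexity:
  fixes p \<kappa> :: real
  assumes p: "1 < p" and \<kappa>: "0 < \<kappa>"
  obtains C where "0 \<le> C"
    "\<And>a b :: 'b::euclidean_space. norm (a - b) powr p \<le> \<kappa> * (norm a powr p + norm b powr p) + C * midpoint_defect p a b"
proof -
  \<comment> \<open>On the unit sphere, pairs outside K satisfy the estimate through the
    \<kappa>-term alone. On K the two entries differ, so the continuous defect has a positive
    minimum \<open>c0\<close> there, and \<open>2 powr p / c0\<close> times the defect suffices
    because |a - b| \<le> 2. For empty K any positive \<open>c0\<close> will do.\<close>
  define K where "K = {z::'b\<times>'b. norm z = 1 \<and> \<kappa> * (norm (fst z) powr p + norm (snd z) powr p) \<le> norm (fst z - snd z) powr p}"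
  let ?D = "\<lambda>z::'b\<times>'b. midpoint_defect p (fst z) (snd z)"
  have K: "K = sphere 0 1 \<inter> {z. \<kappa> * (norm (fst z) powr p + norm (snd z) powr p) \<le> norm (fst z - snd z) powr p}"
    by (auto simp: K_def)
  have cp: "continuous_on UNIV (\<lambda>z. norm (f z) powr p)" if "continuous_on UNIV f" for f :: "'b\<times>'b \<Rightarrow> 'b"
    using p that by (intro continuous_on_powr' continuous_intros) auto
  have cc: "closed {z::'b\<times>'b. \<kappa> * (norm (fst z) powr p + norm (snd z) powr p) \<le> norm (fst z - snd z) powr p}"
    by (intro closed_Collect_le continuous_on_mult continuous_on_add cp continuous_on_const continuous_on_fst continuous_on_snd continuous_on_diff continuous_on_id)
  have Kc: "compact K" unfolding K by (intro compact_Int_closed cc) auto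
  have Dc: "continuous_on K ?D" unfolding midpoint_defect_def
    by (rule continuous_on_subset[OF _ subset_UNIV]) (intro continuous_on_divide continuous_on_add continuous_on_diff continuous_on_scaleR cp continuous_on_const continuous_on_fst continuous_on_snd continuous_on_id, auto)
  obtain c0 where c0: "0 < c0" "\<And>z. z \<in> K \<Longrightarrow> c0 \<le> ?D z"
  proof (cases "K = {}")
    case True then show ?thesis using that[of 1] by auto
  next
    case False
    obtain z0 where z0: "z0 \<in> K" "\<And>z. z \<in> K \<Longrightarrow> ?D z0 \<le> ?D z"
      using continuous_attains_inf[OF Kc False Dc] by auto
    have "?D z0 \<noteq> 0"
    proof
      assume "?D z0 = 0"
      then have eq: "fst z0 = snd z0" by (rule midpoint_defect_eq_0[OF p])
      then have "\<kappa> * (2 * norm (snd z0) powr p) \<le> 0" using z0(1) p by (simp add: K_def)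
      then have "norm (snd z0) powr p \<le> 0" using \<kappa> by (simp add: mult_le_0_iff)
      then have "snd z0 = 0" using p by (simp add: powr_nonneg_iff)
      then show False using z0(1) eq by (simp add: K_def norm_prod_def)
    qed
    then show ?thesis using that[of "?D z0"] z0 midpoint_defect_nonneg[OF p, of "fst z0" "snd z0"] by (auto simp: less_le)
  qed
  define C where "C = 2 powr p / c0"
  have C: "0 \<le> C" using c0 by (simp add: C_def)
  have sph: "norm (a - b) powr p \<le> \<kappa> * (norm a powr p + norm b powr p) + C * midpoint_defect p a b"
    if ab: "norm (a, b) = 1" for a b :: 'b
  proof (cases "(a, b) \<in> K")
    case False
    then show ?thesis using ab C midpoint_defect_nonneg[OF p, of a b] by (simp add: K_def add_increasing2)
  next
    case True
    have "norm a \<le> 1" "norm b \<le> 1" using norm_fst_le[of a b] norm_snd_le[of b a] ab by auto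
    then have "norm (a - b) \<le> 2" using norm_triangle_ineq4[of a b] by linarith
    then have "norm (a - b) powr p \<le> 2 powr p" using p by (intro powr_mono2) auto
    also have "\<dots> = C * c0" using c0 by (simp add: C_def)
    also have "\<dots> \<le> C * midpoint_defect p a b" using c0(2)[OF True] C by (intro mult_left_mono) auto
    finally show ?thesis using \<kappa> by (simp add: add_increasing)
  qed
  show thesis
  proof (rule that[OF C])
    fix a b :: 'b
    show "norm (a - b) powr p \<le> \<kappa> * (norm a powr p + norm b powr p) + C * midpoint_defect p a b"
    proof (cases "(a, b) = 0")
      case True then show ?thesis by (simp add: zero_prod_def midpoint_defect_def)
    next
      case False
      define r where "r = norm (a, b)"
      have r: "0 < r" using False unfolding r_def by (simp only: zero_less_norm_iff) simp
      define a' b' where "a' = a /\<^sub>R r" and "b' = b /\<^sub>R r"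
      have ab: "a = r *\<^sub>R a'" "b = r *\<^sub>R b'" using r by (auto simp: a'_def b'_def)
      have "(a', b') = (a, b) /\<^sub>R r" by (simp add: a'_def b'_def)
      then have "norm (a', b') = 1" using r by (simp only: norm_scaleR) (simp add: r_def[symmetric])
      from mult_left_mono[OF sph[OF this], of "r powr p"]
      have le: "r powr p * norm (a' - b') powr p \<le> r powr p * (\<kappa> * (norm a' powr p + norm b' powr p) + C * midpoint_defect p a' b')" by simp
      have "norm (a - b) powr p = r powr p * norm (a' - b') powr p"
        using r unfolding ab by (simp add: scaleR_diff_right[symmetric] powr_mult del: scaleR_diff_right)
      also note le
      also have "r powr p * (\<kappa> * (norm a' powr p + norm b' powr p) + C * midpoint_defect p a' b')
        = \<kappa> * (norm a powr p + norm b powr p) + C * midpoint_defect p a b"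
        unfolding ab using r by (simp add: midpoint_defect_scale powr_mult algebra_simps)
      finally show ?thesis .
    qed
  qed
qed

text \<open>Completeness of L^p with an explicit rate. A subsequence with summable weighted
  increments converges almost everywhere, and Fatou's lemma in the second index turns the Cauchy
  bound into a bound for the distance to the limit.\<close>

lemma Lp_Cauchy_limit:
  fixes w :: "nat \<Rightarrow> 'a \<Rightarrow> 'b::euclidean_space" and p :: real
  assumes p: "1 \<le> p" and [measurable]: "\<And>n. w n \<in> borel_measurable M"
    and C: "\<And>e. 0 < e \<Longrightarrow> \<exists>n0. \<forall>n\<ge>n0. \<forall>m\<ge>n. (\<integral>\<^sup>+x. ennreal (norm (w n x - w m x) powr p) \<partial>M) \<le> ennreal e"
  obtains G and r :: "nat \<Rightarrow> nat" where "G \<in> borel_measurable M" "\<And>k. k \<le> r k"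
    "\<And>k. (\<integral>\<^sup>+x. ennreal (norm (w (r k) x - G x) powr p) \<partial>M) \<le> ennreal ((1/2) ^ k)"
    "AE x in M. (\<lambda>k. w (r k) x) \<longlonglongrightarrow> G x"
proof -
  \<comment> \<open>The factor (2^k)^(-p) makes the powers of 2^k |f k - f (Suc k)| have a finite
    integral sum. Almost everywhere these powers then tend to 0, so that the increments are
    eventually at most (1/2)^k.\<close>
  define \<eta> where "\<eta> = (\<lambda>k::nat. (1/2) ^ k * (1 / (2 ^ k) powr p) :: real)"
  have \<eta>: "0 < \<eta> k" for k by (simp add: \<eta>_def)
  have "\<exists>n0. \<forall>k. \<forall>n\<ge>n0 k. \<forall>m\<ge>n. (\<integral>\<^sup>+x. ennreal (norm (w n x - w m x) powr p) \<partial>M) \<le> ennreal (\<eta> k)"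
    using C[OF \<eta>] by (intro choice allI) auto
  then obtain n0 :: "nat \<Rightarrow> nat" where n0: "\<And>k n m. n0 k \<le> n \<Longrightarrow> n \<le> m \<Longrightarrow> (\<integral>\<^sup>+x. ennreal (norm (w n x - w m x) powr p) \<partial>M) \<le> ennreal (\<eta> k)"
    by blast
  \<comment> \<open>Adding partial sums makes \<open>r\<close> increasing and at least both
    \<open>k\<close> and \<open>n0 k\<close>.\<close>
  define r where "r = (\<lambda>k. k + (\<Sum>i\<le>k. n0 i))"
  have r: "k \<le> r k" "n0 k \<le> r k" for k
    using member_le_sum[of k "{..k}" n0] by (auto simp: r_def)
  have rm: "r k \<le> r l" if "k \<le> l" for k l
    unfolding r_def using that by (intro add_mono sum_mono2) auto
  define f where "f = (\<lambda>k. w (r k))"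
  have [measurable]: "f k \<in> borel_measurable M" for k by (simp add: f_def)
  have fd: "(\<integral>\<^sup>+x. ennreal (norm (f k x - f l x) powr p) \<partial>M) \<le> ennreal (\<eta> k)" if "k \<le> l" for k l
    unfolding f_def by (rule n0[OF r(2) rm[OF that]])
  have le: "(\<integral>\<^sup>+x. ennreal ((2 ^ k * norm (f k x - f (Suc k) x)) powr p) \<partial>M) \<le> ennreal ((1/2) ^ k)" for k
  proof -
    have "(\<integral>\<^sup>+x. ennreal ((2 ^ k * norm (f k x - f (Suc k) x)) powr p) \<partial>M)
      = ennreal ((2 ^ k) powr p) * (\<integral>\<^sup>+x. ennreal (norm (f k x - f (Suc k) x) powr p) \<partial>M)"
      by (simp add: powr_mult ennreal_mult nn_integral_cmult)
    also have "\<dots> \<le> ennreal ((2 ^ k) powr p) * ennreal (\<eta> k)" by (intro mult_left_mono fd) auto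
    also have "\<dots> = ennreal ((1/2) ^ k)" by (simp add: \<eta>_def ennreal_mult[symmetric])
    finally show ?thesis .
  qed
  have "(\<integral>\<^sup>+x. (\<Sum>k. ennreal ((2 ^ k * norm (f k x - f (Suc k) x)) powr p)) \<partial>M)
    = (\<Sum>k. \<integral>\<^sup>+x. ennreal ((2 ^ k * norm (f k x - f (Suc k) x)) powr p) \<partial>M)"
    by (rule nn_integral_suminf) measurable
  also have "\<dots> \<le> (\<Sum>k. ennreal ((1/2) ^ k))" by (intro suminf_le le summableI)
  also have "\<dots> = ennreal (\<Sum>k. (1/2) ^ k)"
    by (intro suminf_ennreal2 summable_geometric zero_le_power) auto
  also have "\<dots> < \<infinity>" by (simp only: infinity_ennreal_def ennreal_less_top)
  finally have "(\<integral>\<^sup>+x. (\<Sum>k. ennreal ((2 ^ k * norm (f k x - f (Suc k) x)) powr p)) \<partial>M) \<noteq> \<infinity>"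
    by (rule less_imp_neq)
  then have "AE x in M. (\<Sum>k. ennreal ((2 ^ k * norm (f k x - f (Suc k) x)) powr p)) \<noteq> \<infinity>"
    by (intro nn_integral_PInf_AE) measurable
  then have conv: "AE x in M. convergent (\<lambda>k. f k x)"
  proof eventually_elim
    case (elim x)
    then have "summable (\<lambda>k. (2 ^ k * norm (f k x - f (Suc k) x)) powr p)"
      by (intro summable_suminf_not_top) auto
    then have "(\<lambda>k. (2 ^ k * norm (f k x - f (Suc k) x)) powr p) \<longlonglongrightarrow> 0" by (rule summable_LIMSEQ_zero)
    then have "\<forall>\<^sub>F k in sequentially. (2 ^ k * norm (f k x - f (Suc k) x)) powr p < 1"
      by (rule order_tendstoD) simp
    then have "\<forall>\<^sub>F k in sequentially. norm (f (Suc k) x - f k x) \<le> (1/2) ^ k"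
    proof eventually_elim
      case (elim k)
      have "2 ^ k * norm (f k x - f (Suc k) x) \<le> 1"
      proof (rule ccontr)
        assume "\<not> ?thesis"
        then have "1 powr p \<le> (2 ^ k * norm (f k x - f (Suc k) x)) powr p" using p by (intro powr_mono2) auto
        then show False using elim by simp
      qed
      then show ?case by (simp add: field_simps norm_minus_commute)
    qed
    then have "summable (\<lambda>k. f (Suc k) x - f k x)"
      by (rule summable_comparison_test_ev) (rule summable_geometric, simp)
    then have "convergent (\<lambda>n. \<Sum>k<n. f (Suc k) x - f k x)" by (simp add: summable_iff_convergent)
    moreover have "(\<Sum>k<n. f (Suc k) x - f k x) = f n x - f 0 x" for n
      by (rule sum_lessThan_telescope[of "\<lambda>k. f k x"])
    ultimately have "convergent (\<lambda>n. f n x - f 0 x)" by simp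
    then have "convergent (\<lambda>n. (f n x - f 0 x) + f 0 x)"
      by (rule convergent_add[OF _ convergent_const])
    then show ?case by simp
  qed
  define G where "G = (\<lambda>x. lim (\<lambda>k. f k x))"
  have [measurable]: "G \<in> borel_measurable M" unfolding G_def by (rule borel_measurable_lim_metric) measurable
  have lim: "AE x in M. (\<lambda>k. f k x) \<longlonglongrightarrow> G x"
    using conv by eventually_elim (simp add: G_def convergent_LIMSEQ_iff)
  show thesis
  proof (rule that[of G r])
    show "AE x in M. (\<lambda>k. w (r k) x) \<longlonglongrightarrow> G x" using lim by (simp add: f_def)
    fix k
    have "(\<integral>\<^sup>+x. ennreal (norm (f k x - G x) powr p) \<partial>M) = (\<integral>\<^sup>+x. liminf (\<lambda>l. ennreal (norm (f k x - f l x) powr p)) \<partial>M)"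
    proof (rule nn_integral_cong_AE, use lim in eventually_elim)
      case (elim x)
      have "(\<lambda>l. norm (f k x - f l x)) \<longlonglongrightarrow> norm (f k x - G x)" by (intro tendsto_intros elim)
      then have "(\<lambda>l. norm (f k x - f l x) powr p) \<longlonglongrightarrow> norm (f k x - G x) powr p"
        by (rule tendsto_powr'[OF _ tendsto_const]) (use p in auto)
      then show ?case by (intro lim_imp_Liminf[symmetric] tendsto_ennrealI) auto
    qed
    also have "\<dots> \<le> liminf (\<lambda>l. \<integral>\<^sup>+x. ennreal (norm (f k x - f l x) powr p) \<partial>M)"
      by (rule nn_integral_liminf) measurable
    also have "\<dots> \<le> liminf (\<lambda>l. ennreal (\<eta> k))"
      using fd by (intro Liminf_mono eventually_sequentiallyI[of k])
    also have "\<dots> = ennreal (\<eta> k)" by (rule Liminf_const) simp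
    also have "\<dots> \<le> ennreal ((1/2) ^ k)"
    proof (rule ennreal_leI)
      have "1 powr p \<le> (2 ^ k) powr p" using p by (intro powr_mono2) auto
      then have "(1/2) ^ k * (1 / (2 ^ k) powr p) \<le> (1/2::real) ^ k * 1"
        by (intro mult_left_mono) (auto simp: divide_le_eq_1)
      then show "\<eta> k \<le> (1/2) ^ k" by (simp add: \<eta>_def)
    qed
    finally show "(\<integral>\<^sup>+x. ennreal (norm (w (r k) x - G x) powr p) \<partial>M) \<le> ennreal ((1/2) ^ k)" by (simp add: f_def)
  qed (use r in auto)
qed

text \<open>Near-minimisers of the \<open>L\<^sup>p\<close> norm over a decreasing sequence of midpoint-convex sets
  form a Cauchy sequence by uniform convexity; this replaces weak compactness.\<close>

lemma Lp_minimising_limit: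
  fixes C :: "nat \<Rightarrow> ('a \<Rightarrow> 'b::euclidean_space) set" and p S :: real
  assumes p: "1 < p"
    and meas: "\<And>n F. F \<in> C n \<Longrightarrow> F \<in> borel_measurable M"
    and decr: "\<And>m n. m \<le> n \<Longrightarrow> C n \<subseteq> C m"
    and mid: "\<And>n F H. F \<in> C n \<Longrightarrow> H \<in> C n \<Longrightarrow> (\<lambda>x. (1/2) *\<^sub>R (F x + H x)) \<in> C n"
    and S: "0 \<le> S" and ex: "\<And>n. \<exists>F\<in>C n. (\<integral>\<^sup>+x. ennreal (norm (F x) powr p) \<partial>M) \<le> ennreal S"
  obtains G f where "G \<in> borel_measurable M" "\<And>k. f k \<in> C k"
    "\<And>k. (\<integral>\<^sup>+x. ennreal (norm (f k x - G x) powr p) \<partial>M) \<le> ennreal ((1/2) ^ k)"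
    "(\<integral>\<^sup>+x. ennreal (norm (G x) powr p) \<partial>M) \<le> ennreal S"
proof -
  let ?E = "\<lambda>F. \<integral>\<^sup>+x. ennreal (norm (F x) powr p) \<partial>M"
  \<comment> \<open>The sets shrink, so these infima increase with n; being at most S they converge,
    and their increments, which control the midpoint defects, become small.\<close>
  define dd where "dd = (\<lambda>n. INF F\<in>C n. ?E F)"
  have ddS: "dd n \<le> ennreal S" for n
  proof -
    obtain F where "F \<in> C n" "?E F \<le> ennreal S" using ex by blast
    then show ?thesis unfolding dd_def by (meson INF_lower2)
  qed
  define d where "d = (\<lambda>n. enn2real (dd n))"
  have dd: "dd n = ennreal (d n)" for n
    unfolding d_def using order_le_less_trans[OF ddS[of n] ennreal_less_top] by simp
  have d0: "0 \<le> d n" for n by (simp add: d_def)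
  have dS: "d n \<le> S" for n using ddS[of n] S by (simp add: dd)
  have "incseq dd" unfolding incseq_def dd_def by (auto intro!: INF_superset_mono decr)
  then have dm: "incseq d" unfolding incseq_def dd using d0 by simp
  have "\<exists>F\<in>C n. ?E F < ennreal (d n + inverse (real (Suc n)))" for n
  proof -
    have "dd n < ennreal (d n + inverse (real (Suc n)))" unfolding dd using d0[of n] by (intro ennreal_lessI) (auto simp: add_nonneg_pos)
    then show ?thesis unfolding dd_def by (simp only: INF_less_iff)
  qed
  then obtain w where w: "\<And>n. w n \<in> C n" "\<And>n. ?E (w n) < ennreal (d n + inverse (real (Suc n)))" by metis
  have wm[measurable]: "w n \<in> borel_measurable M" for n using w(1) meas by blast
  define I where "I = (\<lambda>n. enn2real (?E (w n)))"
  have EI: "?E (w n) = ennreal (I n)" for n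
    unfolding I_def using order_less_trans[OF w(2)[of n] ennreal_less_top] by simp
  have I0: "0 \<le> I n" for n by (simp add: I_def)
  have I: "I n \<le> d n + inverse (real (Suc n))" for n
  proof -
    have "0 \<le> d n + inverse (real (Suc n))" using d0[of n] by (intro add_nonneg_nonneg) auto
    then show ?thesis using less_imp_le[OF w(2)[of n]] unfolding EI by (simp only: ennreal_le_iff)
  qed
  have inv1: "inverse (real (Suc n)) \<le> 1" for n by (simp add: inverse_le_1_iff del: of_nat_Suc)
  have IS: "I n \<le> S + 1" for n using I[of n] dS[of n] inv1[of n] by linarith
  have int: "integrable M (\<lambda>x. norm (w n x) powr p)" and intI: "(\<integral>x. norm (w n x) powr p \<partial>M) = I n" for n
  proof -
    show i: "integrable M (\<lambda>x. norm (w n x) powr p)" using EI[of n] by (intro integrableI_nonneg) auto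
    show "(\<integral>x. norm (w n x) powr p \<partial>M) = I n" using nn_integral_eq_integral[OF i] EI[of n] I0[of n] by simp
  qed
  have defect: "integrable M (\<lambda>x. midpoint_defect p (w n x) (w m x))"
     "(\<integral>x. midpoint_defect p (w n x) (w m x) \<partial>M) \<le> (d m - d n) / 2 + inverse (real (Suc n))" if nm: "n \<le> m" for n m
  proof -
    let ?H = "\<lambda>x. (1/2) *\<^sub>R (w n x + w m x)"
    \<comment> \<open>Both functions lie in \<open>C n\<close>, hence so does their midpoint, whose
      energy is therefore at least \<open>d n\<close>. The energies of \<open>w n\<close> and
      \<open>w m\<close> being close to \<open>d n\<close> and \<open>d m\<close>, the integrated
      defect is at most half of \<open>d m - d n\<close> plus an error.\<close>
    have H: "?H \<in> C n" using w(1)[of m] decr[OF nm] by (intro mid w) auto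
    have Hi: "integrable M (\<lambda>x. norm (?H x) powr p)"
    proof (rule Bochner_Integration.integrable_bound)
      show "integrable M (\<lambda>x. (norm (w n x) powr p + norm (w m x) powr p) / 2)" using int by auto
      show "AE x in M. norm (norm (?H x) powr p) \<le> norm ((norm (w n x) powr p + norm (w m x) powr p) / 2)"
      proof (rule AE_I2)
        fix x
        show "norm (norm (?H x) powr p) \<le> norm ((norm (w n x) powr p + norm (w m x) powr p) / 2)"
          using midpoint_defect_nonneg[OF p, of "w n x" "w m x"] unfolding midpoint_defect_def by simp
      qed
    qed measurable
    have "dd n \<le> ?E ?H" unfolding dd_def by (rule INF_lower[OF H])
    also have "\<dots> = ennreal (\<integral>x. norm (?H x) powr p \<partial>M)" by (rule nn_integral_eq_integral[OF Hi]) auto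
    finally have "d n \<le> (\<integral>x. norm (?H x) powr p \<partial>M)" unfolding dd by (subst (asm) ennreal_le_iff) (auto intro: integral_nonneg_AE)
    moreover have "(\<integral>x. midpoint_defect p (w n x) (w m x) \<partial>M) = (I n + I m) / 2 - (\<integral>x. norm (?H x) powr p \<partial>M)"
      unfolding midpoint_defect_def using int Hi by (simp add: intI[symmetric])
    moreover have "inverse (real (Suc m)) \<le> inverse (real (Suc n))" using nm by (intro le_imp_inverse_le) auto
    moreover have "x \<le> (b - a) / 2 + i" if "a \<le> h" "x = (s + t) / 2 - h" "j \<le> i" "s \<le> a + i" "t \<le> b + j" for x a b h i j s t :: real
      using that by (simp add: field_simps)
    ultimately show "(\<integral>x. midpoint_defect p (w n x) (w m x) \<partial>M) \<le> (d m - d n) / 2 + inverse (real (Suc n))"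
      using I[of n] I[of m] by blast
    show "integrable M (\<lambda>x. midpoint_defect p (w n x) (w m x))"
      unfolding midpoint_defect_def using int Hi by auto
  qed
  have Cauchy: "\<exists>n0. \<forall>n\<ge>n0. \<forall>m\<ge>n. (\<integral>\<^sup>+x. ennreal (norm (w n x - w m x) powr p) \<partial>M) \<le> ennreal e" if e: "0 < e" for e
  proof -
    \<comment> \<open>All energies are at most S + 1, so the \<kappa>-term of uniform convexity
      contributes at most e/2; \<open>e'\<close> is chosen so that the defect term contributes at
      most the other half.\<close>
    define \<kappa> where "\<kappa> = e / (4 * (S + 1))"
    have \<kappa>: "0 < \<kappa>" "\<kappa> * (2 * (S + 1)) = e / 2" using e S by (auto simp: \<kappa>_def field_simps)
    obtain B where B: "0 \<le> B" "\<And>a b :: 'b. norm (a - b) powr p \<le> \<kappa> * (norm a powr p + norm b powr p) + B * midpoint_defect p a b"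
      using uniform_convexity[OF p \<kappa>(1)] by metis
    define e' where "e' = e / (2 * (B + 1))"
    have e': "0 < e'" "B * e' \<le> e / 2" using e B(1) by (auto simp: e'_def field_simps)
    obtain L where "d \<longlonglongrightarrow> L" using incseq_convergent[OF dm, of S] dS by blast
    then have "Cauchy d" by (rule LIMSEQ_imp_Cauchy)
    then obtain n1 where n1: "\<And>n m. n1 \<le> n \<Longrightarrow> n1 \<le> m \<Longrightarrow> norm (d n - d m) < e'" using CauchyD[OF _ e'(1)] by blast
    obtain n2 where n2: "inverse (real (Suc n2)) < e' / 2" using reals_Archimedean[of "e' / 2"] e' by auto
    show ?thesis
    proof (intro exI[of _ "max n1 n2"] allI impI)
      fix n m assume n: "max n1 n2 \<le> n" and nm: "n \<le> m"
      have "inverse (real (Suc n)) \<le> inverse (real (Suc n2))" using n by (intro le_imp_inverse_le) auto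
      then have "inverse (real (Suc n)) < e' / 2" using n2 by (rule order_le_less_trans)
      moreover have "norm (d n - d m) < e'" using n nm by (intro n1) auto
      then have "(d m - d n) / 2 < e' / 2" by (simp add: abs_less_iff)
      ultimately have "(d m - d n) / 2 + inverse (real (Suc n)) < e' / 2 + e' / 2" by (intro add_strict_mono)
      then have de: "(d m - d n) / 2 + inverse (real (Suc n)) \<le> e'" by simp
      let ?R = "\<lambda>x. \<kappa> * (norm (w n x) powr p + norm (w m x) powr p) + B * midpoint_defect p (w n x) (w m x)"
      have Ri: "integrable M ?R" using int defect(1)[OF nm] by auto
      have "(\<integral>\<^sup>+x. ennreal (norm (w n x - w m x) powr p) \<partial>M) \<le> (\<integral>\<^sup>+x. ennreal (?R x) \<partial>M)"
        by (intro nn_integral_mono ennreal_leI B)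
      also have "\<dots> = ennreal (\<integral>x. ?R x \<partial>M)"
      proof (rule nn_integral_eq_integral[OF Ri], rule AE_I2)
        show "0 \<le> ?R x" for x
          using B(1) \<kappa>(1) midpoint_defect_nonneg[OF p] by (intro add_nonneg_nonneg mult_nonneg_nonneg) auto
      qed
      also have "(\<integral>x. ?R x \<partial>M) = \<kappa> * (I n + I m) + B * (\<integral>x. midpoint_defect p (w n x) (w m x) \<partial>M)"
        using int defect(1)[OF nm] by (simp add: intI)
      also have "\<dots> \<le> \<kappa> * (2 * (S + 1)) + B * e'"
        using IS[of n] IS[of m] \<kappa>(1) B(1) defect(2)[OF nm] de by (intro add_mono mult_left_mono) auto
      also have "\<dots> \<le> e" using \<kappa>(2) e'(2) by linarith
      finally show "(\<integral>\<^sup>+x. ennreal (norm (w n x - w m x) powr p) \<partial>M) \<le> ennreal e" by (simp add: ennreal_leI)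
    qed
  qed
  obtain G and r :: "nat \<Rightarrow> nat" where G: "G \<in> borel_measurable M" and r: "\<And>k. k \<le> r k"
    and Gl: "\<And>k. (\<integral>\<^sup>+x. ennreal (norm (w (r k) x - G x) powr p) \<partial>M) \<le> ennreal ((1/2) ^ k)"
    and ae: "AE x in M. (\<lambda>k. w (r k) x) \<longlonglongrightarrow> G x"
  proof (rule Lp_Cauchy_limit[OF less_imp_le[OF p] wm Cauchy], goal_cases)
    case (2 G r)
    show thesis by (rule that[OF 2(2-)])
  qed
  show thesis
  proof (rule that[OF G _ Gl])
    show "w (r k) \<in> C k" for k using w(1)[of "r k"] decr[OF r[of k]] by auto
    have "?E G = (\<integral>\<^sup>+x. liminf (\<lambda>k. ennreal (norm (w (r k) x) powr p)) \<partial>M)"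
    proof (rule nn_integral_cong_AE, use ae in eventually_elim)
      case (elim x)
      have "(\<lambda>k. norm (w (r k) x) powr p) \<longlonglongrightarrow> norm (G x) powr p"
        by (rule tendsto_powr'[OF tendsto_norm[OF elim] tendsto_const]) (use p in auto)
      then show ?case by (intro lim_imp_Liminf[symmetric] tendsto_ennrealI) auto
    qed
    also have "\<dots> \<le> liminf (\<lambda>k. ?E (w (r k)))" by (rule nn_integral_liminf) measurable
    also have "\<dots> \<le> liminf (\<lambda>k. ennreal (S + inverse (real (Suc k))))"
    proof (intro Liminf_mono always_eventually allI)
      fix k
      have "inverse (real (Suc (r k))) \<le> inverse (real (Suc k))" using r[of k] by (intro le_imp_inverse_le) auto
      then show "?E (w (r k)) \<le> ennreal (S + inverse (real (Suc k)))"
        unfolding EI using I[of "r k"] dS[of "r k"] by (intro ennreal_leI) linarith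
    qed
    also have "\<dots> = ennreal (S + 0)"
      by (intro lim_imp_Liminf tendsto_ennrealI tendsto_add tendsto_const LIMSEQ_inverse_real_of_nat) auto
    finally show "?E G \<le> ennreal S" by simp
  qed
qed

section \<open>Weak gradients\<close>

lemma le_one_plus_powr:
  fixes y p :: real
  assumes "0 \<le> y" "1 \<le> p"
  shows "y \<le> 1 + y powr p"
proof (cases "y \<le> 1")
  case False
  then have "y powr 1 \<le> y powr p" using assms by (intro powr_mono) auto
  then show ?thesis using False by simp
qed (use assms in \<open>auto intro: add_increasing2\<close>)

text \<open>Takes the place of Hoelder's inequality on a ball: if the p-energy is at most
  \<kappa>^p, the integral of the right-hand side over the ball is of order \<kappa>.\<close>

lemma le_plus_scaled_powr:
  fixes y p \<kappa> :: real
  assumes "0 \<le> y" "1 \<le> p" "0 < \<kappa>"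
  shows "y \<le> \<kappa> + \<kappa> powr (1 - p) * y powr p"
proof -
  have "y / \<kappa> \<le> 1 + (y / \<kappa>) powr p" using assms by (intro le_one_plus_powr) auto
  then have "\<kappa> * (y / \<kappa>) \<le> \<kappa> * (1 + (y / \<kappa>) powr p)" using assms by (intro mult_left_mono) auto
  also have "\<dots> = \<kappa> + \<kappa> powr (1 - p) * y powr p" using assms by (simp add: powr_divide powr_diff field_simps)
  finally show ?thesis using assms by simp
qed

lemma integrable_cball_of_powr:
  fixes F :: "'a::euclidean_space \<Rightarrow> 'b::euclidean_space"
  assumes p: "1 \<le> p" and [measurable]: "F \<in> borel_measurable borel" and I: "integrable lborel (\<lambda>x. norm (F x) powr p)"
  shows "integrable lborel (\<lambda>x. indicator (cball 0 R) x * norm (F x))"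
proof (rule Bochner_Integration.integrable_bound)
  have "integrable lborel (indicator (cball (0::'a) R) :: 'a \<Rightarrow> real)"
    using emeasure_lborel_cball_finite[of "0::'a" R] by (intro integrable_real_indicator) auto
  then show "integrable lborel (\<lambda>x. indicator (cball 0 R) x + norm (F x) powr p)"
    using I by (rule Bochner_Integration.integrable_add)
  show "AE x in lborel. norm (indicator (cball 0 R) x * norm (F x)) \<le> norm (indicator (cball 0 R) x + norm (F x) powr p)"
    using le_one_plus_powr[OF norm_ge_zero p] by (intro AE_I2) (auto simp: indicator_def)
qed measurable

text \<open>The set \<open>C n\<close> consists of the fields that satisfy the weak gradient
  identity up to the error \<open>\<eta> \<phi> i n\<close>. The constraint bounds the absolute
  value of an affine expression, so it passes to midpoints, and \<open>G n\<close> meets it through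
  integration by parts. The limit of near-minimisers satisfies the identity exactly because the
  errors tend to 0 for each test function.\<close>

lemma weak_gradient_limit:
  fixes v :: "real^'n::finite \<Rightarrow> real" and w :: "nat \<Rightarrow> real^'n \<Rightarrow> real" and G :: "nat \<Rightarrow> real^'n \<Rightarrow> real^'n" and p S :: real
  assumes p: "1 < p" and S0: "0 \<le> S"
    and w: "\<And>j x. (w j has_derivative (\<lambda>h. G j x \<bullet> h)) (at x)" "\<And>j x. \<bar>w j x\<bar> \<le> M j" "\<And>j x. norm (G j x) \<le> B j"
    and Gm[measurable]: "\<And>j. G j \<in> borel_measurable borel"
    and S: "\<And>j. (\<integral>\<^sup>+x. ennreal (norm (G j x) powr p) \<partial>lborel) \<le> ennreal S"
    and lim: "\<And>\<psi> R. continuous_on UNIV \<psi> \<Longrightarrow> (\<And>x. R < norm x \<Longrightarrow> \<psi> x = 0) \<Longrightarrow>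
      (\<lambda>j. \<integral>x. w j x * \<psi> x \<partial>lborel) \<longlonglongrightarrow> (\<integral>x. v x * \<psi> x \<partial>lborel)"
  obtains H where "H \<in> borel_measurable borel" "(\<integral>\<^sup>+x. ennreal (norm (H x) powr p) \<partial>lborel) \<le> ennreal S"
    "\<And>\<phi> :: real^'n \<Rightarrow> real. \<And>i. test_function \<phi> \<Longrightarrow>
      (\<integral>x. v x * partial_deriv i \<phi> x \<partial>lborel) = - (\<integral>x. H x $ i * \<phi> x \<partial>lborel)"
proof -
  let ?v = "\<lambda>\<phi> i. \<integral>x. v x * partial_deriv i \<phi> x \<partial>lborel"
  define t where "t = (\<lambda>\<phi> i j. \<bar>?v \<phi> i - (\<integral>x. w j x * partial_deriv i \<phi> x \<partial>lborel)\<bar>)"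
  \<comment> \<open>The supremum over the tail instead of the single error
    \<open>t \<phi> i n\<close>: it is decreasing in n, which makes the sets \<open>C n\<close>
    decreasing.\<close>
  define \<eta> where "\<eta> = (\<lambda>\<phi> i n. SUP j\<in>{n..}. t \<phi> i j)"
  have tl: "t \<phi> i \<longlonglongrightarrow> 0" if \<phi>: "test_function \<phi>" for \<phi> i
  proof -
    obtain R where R: "\<And>x. R < norm x \<Longrightarrow> \<phi> x = 0" using test_functionD(4)[OF \<phi>] by auto
    have "(\<lambda>j. \<integral>x. w j x * partial_deriv i \<phi> x \<partial>lborel) \<longlonglongrightarrow> ?v \<phi> i"
      by (rule lim[OF test_functionD(3)[OF \<phi>] partial_deriv_zero_outside[OF \<phi> R]])
    then have "(\<lambda>j. \<bar>?v \<phi> i - (\<integral>x. w j x * partial_deriv i \<phi> x \<partial>lborel)\<bar>) \<longlonglongrightarrow> \<bar>?v \<phi> i - ?v \<phi> i\<bar>"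
      by (intro tendsto_intros)
    then show ?thesis by (simp add: t_def)
  qed
  have bdd: "bdd_above (t \<phi> i ` A)" if "test_function \<phi>" for \<phi> i A
  proof -
    have "Bseq (t \<phi> i)" by (rule convergent_imp_Bseq) (use tl[OF that] in \<open>auto simp: convergent_def\<close>)
    then have "bounded (range (t \<phi> i))" by (simp add: Bseq_eq_bounded)
    then have "bdd_above (range (t \<phi> i))" by (rule bounded_imp_bdd_above)
    then show ?thesis by (rule bdd_above_mono) auto
  qed
  have \<eta>l: "\<eta> \<phi> i \<longlonglongrightarrow> 0" if \<phi>: "test_function \<phi>" for \<phi> i
  proof (rule LIMSEQ_I)
    fix r :: real assume r: "0 < r"
    obtain n0 where n0: "\<And>n. n0 \<le> n \<Longrightarrow> norm (t \<phi> i n - 0) < r / 2" using LIMSEQ_D[OF tl[OF \<phi>], of "r / 2" i] r by auto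
    show "\<exists>no. \<forall>n\<ge>no. norm (\<eta> \<phi> i n - 0) < r"
    proof (intro exI[of _ n0] allI impI)
      fix n assume n: "n0 \<le> n"
      have "\<eta> \<phi> i n \<le> r / 2" unfolding \<eta>_def using n0 n by (intro cSUP_least) (auto simp: t_def intro!: less_imp_le)
      moreover have "0 \<le> t \<phi> i n" by (simp add: t_def)
      then have "0 \<le> \<eta> \<phi> i n" unfolding \<eta>_def by (rule cSUP_upper2[OF bdd[OF \<phi>], rotated]) auto
      ultimately show "norm (\<eta> \<phi> i n - 0) < r" using r by simp
    qed
  qed
  \<comment> \<open>Integrability against test functions is part of the set because the integral of
    a midpoint, and later that of the difference to the limit, is split by additivity.\<close>
  define C where "C = (\<lambda>n. {F :: real^'n \<Rightarrow> real^'n. F \<in> borel_measurable lborel \<and> (\<forall>\<phi> i. test_function \<phi> \<longrightarrow>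
    integrable lborel (\<lambda>x. F x $ i * \<phi> x) \<and> \<bar>?v \<phi> i + (\<integral>x. F x $ i * \<phi> x \<partial>lborel)\<bar> \<le> \<eta> \<phi> i n)})"
  have GC: "G n \<in> C n" for n
    unfolding C_def
  proof (intro CollectI conjI allI impI)
    show "G n \<in> borel_measurable lborel" by simp
    fix \<phi> :: "real^'n \<Rightarrow> real" and i assume \<phi>: "test_function \<phi>"
    obtain R where R: "\<And>x. R < norm x \<Longrightarrow> \<phi> x = 0" using test_functionD(4)[OF \<phi>] by auto
    have \<phi>i: "integrable lborel \<phi>" by (rule continuous_compact_support_integrable[OF test_functionD(2)[OF \<phi>] R])
    have [measurable]: "\<phi> \<in> borel_measurable borel" by (intro borel_measurable_continuous_onI test_functionD[OF \<phi>])
    have Gi: "\<bar>G n x $ i\<bar> \<le> B n" for x using component_le_norm_cart[of "G n x" i] w(3)[of n x] by simp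
    show "integrable lborel (\<lambda>x. G n x $ i * \<phi> x)"
    proof (rule Bochner_Integration.integrable_bound)
      show "integrable lborel (\<lambda>x. B n * \<bar>\<phi> x\<bar>)" using \<phi>i by simp
      show "AE x in lborel. norm (G n x $ i * \<phi> x) \<le> norm (B n * \<bar>\<phi> x\<bar>)"
        using mult_right_mono[OF Gi abs_ge_zero] by (intro AE_I2) (metis abs_ge_self abs_mult order_trans real_norm_def)
    qed measurable
    have ga: "\<bar>G n x \<bullet> axis i 1\<bar> \<le> B n" for x using Gi[of x] by (simp add: inner_axis)
    have cc: "continuous_on UNIV (\<lambda>x. frechet_derivative \<phi> (at x) (axis i 1))"
      using test_functionD(3)[OF \<phi>, of i] by (simp add: partial_deriv_def[abs_def])
    have "(\<integral>x. w n x * frechet_derivative \<phi> (at x) (axis i 1) \<partial>lborel) = - (\<integral>x. (G n x \<bullet> axis i 1) * \<phi> x \<partial>lborel)"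
      by (rule integration_by_parts_direction[OF w(1,2) ga test_functionD(1)[OF \<phi>] cc R]) auto
    then have "(\<integral>x. w n x * partial_deriv i \<phi> x \<partial>lborel) = - (\<integral>x. G n x $ i * \<phi> x \<partial>lborel)"
      by (simp add: partial_deriv_def inner_axis)
    then have "\<bar>?v \<phi> i + (\<integral>x. G n x $ i * \<phi> x \<partial>lborel)\<bar> = t \<phi> i n" by (simp add: t_def)
    also have "\<dots> \<le> \<eta> \<phi> i n" unfolding \<eta>_def by (rule cSUP_upper[OF _ bdd[OF \<phi>]]) auto
    finally show "\<bar>?v \<phi> i + (\<integral>x. G n x $ i * \<phi> x \<partial>lborel)\<bar> \<le> \<eta> \<phi> i n" .
  qed
  obtain H f where H: "H \<in> borel_measurable lborel" and f: "\<And>k. f k \<in> C k"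
    and fH: "\<And>k. (\<integral>\<^sup>+x. ennreal (norm (f k x - H x) powr p) \<partial>lborel) \<le> ennreal ((1/2) ^ k)"
    and HS: "(\<integral>\<^sup>+x. ennreal (norm (H x) powr p) \<partial>lborel) \<le> ennreal S"
  proof (rule Lp_minimising_limit[OF p, of C lborel S])
    show "F \<in> borel_measurable lborel" if "F \<in> C n" for n F using that by (simp add: C_def)
    show "C n \<subseteq> C m" if "m \<le> n" for m n
    proof -
      have "\<eta> \<phi> i n \<le> \<eta> \<phi> i m" if "test_function \<phi>" for \<phi> i
        unfolding \<eta>_def using \<open>m \<le> n\<close> by (intro cSUP_subset_mono bdd[OF that]) auto
      from order_trans[OF _ this] show ?thesis unfolding C_def by blast
    qed
    show "(\<lambda>x. (1/2) *\<^sub>R (F x + K x)) \<in> C n" if F: "F \<in> C n" and K: "K \<in> C n" for n F K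
      unfolding C_def
    proof (intro CollectI conjI allI impI)
      have [measurable]: "F \<in> borel_measurable borel" "K \<in> borel_measurable borel" using F K by (auto simp: C_def)
      show "(\<lambda>x. (1/2) *\<^sub>R (F x + K x)) \<in> borel_measurable lborel" by measurable
      fix \<phi> :: "real^'n \<Rightarrow> real" and i assume \<phi>: "test_function \<phi>"
      have i: "integrable lborel (\<lambda>x. F x $ i * \<phi> x)" "integrable lborel (\<lambda>x. K x $ i * \<phi> x)"
        and b: "\<bar>?v \<phi> i + (\<integral>x. F x $ i * \<phi> x \<partial>lborel)\<bar> \<le> \<eta> \<phi> i n" "\<bar>?v \<phi> i + (\<integral>x. K x $ i * \<phi> x \<partial>lborel)\<bar> \<le> \<eta> \<phi> i n"
        using F K \<phi> by (auto simp: C_def)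
      have eq: "((1/2) *\<^sub>R (F x + K x)) $ i * \<phi> x = (F x $ i * \<phi> x + K x $ i * \<phi> x) / 2" for x
        by (simp add: algebra_simps)
      show "integrable lborel (\<lambda>x. ((1/2) *\<^sub>R (F x + K x)) $ i * \<phi> x)" unfolding eq using i by auto
      have "(\<integral>x. ((1/2) *\<^sub>R (F x + K x)) $ i * \<phi> x \<partial>lborel) = ((\<integral>x. F x $ i * \<phi> x \<partial>lborel) + (\<integral>x. K x $ i * \<phi> x \<partial>lborel)) / 2"
        unfolding eq using i by simp
      then show "\<bar>?v \<phi> i + (\<integral>x. ((1/2) *\<^sub>R (F x + K x)) $ i * \<phi> x \<partial>lborel)\<bar> \<le> \<eta> \<phi> i n"
        using b by (simp only: abs_le_iff) (simp add: field_simps)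
    qed
    show "\<exists>F\<in>C n. (\<integral>\<^sup>+x. ennreal (norm (F x) powr p) \<partial>lborel) \<le> ennreal S" for n using GC S by blast
  qed (use S0 in blast)+
  have Hm[measurable]: "H \<in> borel_measurable borel" using H by simp
  have fm[measurable]: "f k \<in> borel_measurable borel" for k using f[of k] by (simp add: C_def)
  show thesis
  proof (rule that[OF Hm HS])
    fix \<phi> :: "real^'n \<Rightarrow> real" and i assume \<phi>: "test_function \<phi>"
    obtain R where R: "\<And>x. R < norm x \<Longrightarrow> \<phi> x = 0" using test_functionD(4)[OF \<phi>] by auto
    obtain D where D: "0 \<le> D" "\<And>x. \<bar>\<phi> x\<bar> \<le> D * indicator (cball 0 R) x"
      using continuous_compact_support_bounded[OF test_functionD(2)[OF \<phi>] R] by metis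
    have [measurable]: "\<phi> \<in> borel_measurable borel" by (intro borel_measurable_continuous_onI test_functionD[OF \<phi>])
    have bnd: "\<bar>y * \<phi> x\<bar> \<le> D * (indicator (cball 0 R) x * c)" if "\<bar>y\<bar> \<le> c" for y c x
    proof -
      have "\<bar>y\<bar> * \<bar>\<phi> x\<bar> \<le> c * (D * indicator (cball 0 R) x)" using that D by (intro mult_mono) auto
      then show ?thesis by (simp add: abs_mult mult_ac)
    qed
    have Hp: "integrable lborel (\<lambda>x. norm (H x) powr p)"
      using order_le_less_trans[OF HS ennreal_less_top] by (intro integrableI_nonneg) auto
    have Hi: "integrable lborel (\<lambda>x. H x $ i * \<phi> x)"
    proof (rule Bochner_Integration.integrable_bound)
      show "integrable lborel (\<lambda>x. D * (indicator (cball 0 R) x * norm (H x)))"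
        using p Hp by (intro integrable_mult_right integrable_cball_of_powr[of p]) auto
      show "AE x in lborel. norm (H x $ i * \<phi> x) \<le> norm (D * (indicator (cball 0 R) x * norm (H x)))"
        unfolding real_norm_def[of "_ * _"] by (intro AE_I2 order_trans[OF bnd[OF component_le_norm_cart] abs_ge_self])
    qed measurable
    define V where "V = (\<integral>x. indicator (cball (0::real^'n) R) x \<partial>lborel :: real)"
    have ind: "integrable lborel (indicator (cball (0::real^'n) R) :: _ \<Rightarrow> real)"
      using emeasure_lborel_cball_finite[of "0::real^'n" R] by (intro integrable_real_indicator) auto
    have bound: "\<bar>?v \<phi> i + (\<integral>x. H x $ i * \<phi> x \<partial>lborel)\<bar> \<le> \<eta> \<phi> i k + D * (V + 1) * ((1/2) ^ k) powr (1 / p)" for k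
    proof -
      \<comment> \<open>The choice that balances the two terms of \<open>le_plus_scaled_powr\<close>
        when the energy of the difference is at most (1/2)^k: both become multiples of
        \<kappa>.\<close>
      define \<kappa> where "\<kappa> = ((1/2::real) ^ k) powr (1 / p)"
      have \<kappa>: "0 < \<kappa>" by (simp add: \<kappa>_def)
      have \<kappa>p: "\<kappa> powr (1 - p) * (1/2) ^ k = \<kappa>"
      proof -
        have "\<kappa> powr p = (1/2) ^ k" using p by (simp add: \<kappa>_def powr_powr)
        then have "\<kappa> powr (1 - p) * (1/2) ^ k = \<kappa> powr (1 - p) * \<kappa> powr p" by simp
        also have "\<dots> = \<kappa>" using \<kappa> by (simp add: powr_add[symmetric])
        finally show ?thesis .
      qed
      have fi: "integrable lborel (\<lambda>x. f k x $ i * \<phi> x)"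
        and fb: "\<bar>?v \<phi> i + (\<integral>x. f k x $ i * \<phi> x \<partial>lborel)\<bar> \<le> \<eta> \<phi> i k"
        using f[of k] \<phi> by (auto simp: C_def)
      have di: "integrable lborel (\<lambda>x. norm (f k x - H x) powr p)"
        using order_le_less_trans[OF fH[of k] ennreal_less_top] by (intro integrableI_nonneg) auto
      have d1: "(\<integral>x. norm (f k x - H x) powr p \<partial>lborel) \<le> (1/2) ^ k"
        using fH[of k] unfolding nn_integral_eq_integral[OF di AE_I2[OF powr_ge_zero]] by (subst (asm) ennreal_le_iff) auto
      have "\<bar>(\<integral>x. H x $ i * \<phi> x \<partial>lborel) - (\<integral>x. f k x $ i * \<phi> x \<partial>lborel)\<bar> = \<bar>\<integral>x. H x $ i * \<phi> x - f k x $ i * \<phi> x \<partial>lborel\<bar>"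
        using Hi fi by simp
      also have "\<dots> \<le> (\<integral>x. \<bar>H x $ i * \<phi> x - f k x $ i * \<phi> x\<bar> \<partial>lborel)" by (rule integral_abs_bound)
      also have "\<dots> \<le> (\<integral>x. D * (\<kappa> * indicator (cball 0 R) x + \<kappa> powr (1 - p) * norm (f k x - H x) powr p) \<partial>lborel)"
      proof (rule integral_mono)
        show "integrable lborel (\<lambda>x. \<bar>H x $ i * \<phi> x - f k x $ i * \<phi> x\<bar>)" using Hi fi by auto
        show "integrable lborel (\<lambda>x. D * (\<kappa> * indicator (cball 0 R) x + \<kappa> powr (1 - p) * norm (f k x - H x) powr p))"
          by (intro integrable_mult_right Bochner_Integration.integrable_add ind di)
        fix x
        have "\<bar>H x $ i - f k x $ i\<bar> \<le> norm (f k x - H x)"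
          using component_le_norm_cart[of "f k x - H x" i] by (simp add: abs_minus_commute)
        also have "\<dots> \<le> \<kappa> + \<kappa> powr (1 - p) * norm (f k x - H x) powr p"
          using p \<kappa> by (intro le_plus_scaled_powr) auto
        finally have "\<bar>(H x $ i - f k x $ i) * \<phi> x\<bar> \<le> D * (indicator (cball 0 R) x * (\<kappa> + \<kappa> powr (1 - p) * norm (f k x - H x) powr p))"
          by (rule bnd)
        also have "\<dots> \<le> D * (\<kappa> * indicator (cball 0 R) x + \<kappa> powr (1 - p) * norm (f k x - H x) powr p)"
          using D(1) \<kappa> by (intro mult_left_mono) (auto simp: indicator_def)
        finally show "\<bar>H x $ i * \<phi> x - f k x $ i * \<phi> x\<bar> \<le> D * (\<kappa> * indicator (cball 0 R) x + \<kappa> powr (1 - p) * norm (f k x - H x) powr p)"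
          by (simp only: left_diff_distrib)
      qed
      also have "\<dots> = D * (\<kappa> * V + \<kappa> powr (1 - p) * (\<integral>x. norm (f k x - H x) powr p \<partial>lborel))"
        using ind di by (simp add: V_def)
      also have "\<dots> \<le> D * (\<kappa> * V + \<kappa> powr (1 - p) * (1/2) ^ k)"
        using D(1) d1 by (intro mult_left_mono add_left_mono) auto
      also have "\<dots> = D * (V + 1) * \<kappa>" unfolding \<kappa>p by (simp add: algebra_simps)
      finally show ?thesis using fb unfolding \<kappa>_def by linarith
    qed
    have "(\<lambda>k. ((1/2::real) ^ k) powr (1 / p)) \<longlonglongrightarrow> 0 powr (1 / p)"
      using p by (intro tendsto_powr' LIMSEQ_power_zero tendsto_const) auto
    then have "(\<lambda>k. \<eta> \<phi> i k + D * (V + 1) * ((1/2) ^ k) powr (1 / p)) \<longlonglongrightarrow> 0 + D * (V + 1) * (0 powr (1 / p))"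
      by (intro tendsto_add tendsto_mult tendsto_const \<eta>l[OF \<phi>])
    then have "\<bar>?v \<phi> i + (\<integral>x. H x $ i * \<phi> x \<partial>lborel)\<bar> \<le> 0 + D * (V + 1) * (0 powr (1 / p))"
      by (rule LIMSEQ_le_const) (use bound in auto)
    then show "?v \<phi> i = - (\<integral>x. H x $ i * \<phi> x \<partial>lborel)" by simp
  qed
qed

section \<open>Local integrability and uniqueness of the weak gradient\<close>

lemma locally_integrableD:
  fixes F :: "'a::euclidean_space \<Rightarrow> 'b::euclidean_space"
  assumes "locally_integrable F"
  shows "integrable lebesgue (\<lambda>x. indicator (cball 0 R) x *\<^sub>R F x)" and "F \<in> borel_measurable lebesgue"
proof -
  show I: "integrable lebesgue (\<lambda>x. indicator (cball 0 R) x *\<^sub>R F x)" for R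
    using assms compact_cball[of "0::'a" R] unfolding locally_integrable_def set_integrable_def by blast
  have lim: "(\<lambda>n. indicator (cball 0 (real n)) x *\<^sub>R F x) \<longlonglongrightarrow> F x" for x
  proof (rule tendsto_eventually)
    obtain n :: nat where "norm x \<le> real n" using real_arch_simple by blast
    then have "indicator (cball 0 (real m)) x *\<^sub>R F x = F x" if "n \<le> m" for m using that by simp
    then show "\<forall>\<^sub>F n in sequentially. indicator (cball 0 (real n)) x *\<^sub>R F x = F x"
      unfolding eventually_sequentially by blast
  qed
  show "F \<in> borel_measurable lebesgue"
    by (rule borel_measurable_LIMSEQ_metric[where f="\<lambda>n x. indicator (cball 0 (real n)) x *\<^sub>R F x"])
       (use I lim in \<open>auto dest: borel_measurable_integrable\<close>)
qed

lemma locally_integrable_of_cball: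
  fixes F G :: "'a::euclidean_space \<Rightarrow> 'b::euclidean_space"
  assumes F: "F \<in> borel_measurable lebesgue" and G: "G \<in> borel_measurable borel" and FG: "AE x in lebesgue. F x = G x"
    and I: "\<And>R. integrable lborel (\<lambda>x. indicator (cball 0 R) x * norm (G x))"
  shows "locally_integrable F"
  unfolding locally_integrable_def set_integrable_def
proof (intro allI impI)
  fix K :: "'a set" assume K: "compact K"
  obtain R where R: "\<And>x. x \<in> K \<Longrightarrow> norm x \<le> R"
    using compact_imp_bounded[OF K] by (auto simp: bounded_iff)
  have "integrable lebesgue (\<lambda>x. indicator (cball 0 R) x * norm (G x))"
    using I[of R] G by (subst integrable_completion) auto
  then show "integrable lebesgue (\<lambda>x. indicator K x *\<^sub>R F x)"
  proof (rule Bochner_Integration.integrable_bound)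
    have "K \<in> sets lebesgue" using K by (simp add: lmeasurable_compact fmeasurableD)
    then show "(\<lambda>x. indicator K x *\<^sub>R F x) \<in> borel_measurable lebesgue" using F by simp
    show "AE x in lebesgue. norm (indicator K x *\<^sub>R F x) \<le> norm (indicator (cball 0 R) x * norm (G x))"
      using FG by eventually_elim (use R in \<open>auto simp: indicator_def\<close>)
  qed
qed

lemma locally_integrable_test:
  fixes F :: "real^'n::finite \<Rightarrow> real^'m::finite" and \<phi> :: "real^'n \<Rightarrow> real"
  assumes F: "locally_integrable F" and \<phi>: "test_function \<phi>"
  shows "integrable lebesgue (\<lambda>x. F x $ i * \<phi> x)"
proof -
  obtain R where R: "\<And>x. R < norm x \<Longrightarrow> \<phi> x = 0" using test_functionD(4)[OF \<phi>] by auto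
  obtain D where D: "0 \<le> D" "\<And>x. \<bar>\<phi> x\<bar> \<le> D * indicator (cball 0 R) x"
    using continuous_compact_support_bounded[OF test_functionD(2)[OF \<phi>] R] by metis
  have [measurable]: "F \<in> borel_measurable lebesgue" using locally_integrableD(2)[OF F] .
  have [measurable]: "\<phi> \<in> borel_measurable lebesgue"
    using borel_measurable_continuous_onI[OF test_functionD(2)[OF \<phi>]] by (intro measurable_completion) simp
  show ?thesis
  proof (rule Bochner_Integration.integrable_bound)
    show "integrable lebesgue (\<lambda>x. D *\<^sub>R indicator (cball 0 R) x *\<^sub>R F x)"
      using locally_integrableD(1)[OF F] by (rule integrable_scaleR_right)
    show "AE x in lebesgue. norm (F x $ i * \<phi> x) \<le> norm (D *\<^sub>R indicator (cball 0 R) x *\<^sub>R F x)"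
    proof (rule AE_I2)
      fix x
      have "\<bar>F x $ i\<bar> * \<bar>\<phi> x\<bar> \<le> norm (F x) * (D * indicator (cball 0 R) x)"
        using D by (intro mult_mono component_le_norm_cart) auto
      then show "norm (F x $ i * \<phi> x) \<le> norm (D *\<^sub>R indicator (cball 0 R) x *\<^sub>R F x)"
        using D(1) by (simp add: abs_mult mult_ac)
    qed
  qed measurable
qed

text \<open>Since \<open>weak_gradient\<close> is a Hilbert choice, \<open>Phi\<close> can be
  evaluated through a concrete gradient only by uniqueness. Each component of the difference
  integrates to 0 against all test functions; a Borel representative \<open>g\<close> brings it into
  the form of the fundamental lemma.\<close>

lemma weak_gradient_AE_unique:
  assumes F: "has_weak_gradient u F" and H: "has_weak_gradient u H"
  shows "AE x in lebesgue. F x = H x"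
proof -
  have lF: "locally_integrable F" and lH: "locally_integrable H" using F H by (auto simp: has_weak_gradient_def)
  note Fm[measurable] = locally_integrableD(2)[OF lF] and Hm[measurable] = locally_integrableD(2)[OF lH]
  have "AE x in lebesgue. F x $ i - H x $ i = 0" for i
  proof -
    let ?d = "\<lambda>x. F x $ i - H x $ i"
    have "?d \<in> borel_measurable lebesgue" by measurable
    then obtain g where g[measurable]: "g \<in> borel_measurable lborel" and dg: "AE x in lborel. ?d x = g x"
      using completion_ex_borel_measurable_real by blast
    have dg': "AE x in lebesgue. ?d x = g x" using dg by (rule AE_completion)
    have gm: "g \<in> borel_measurable lebesgue" using g by (rule measurable_completion)
    have "AE x in lborel. g x = 0"
    proof (rule AE_zero_if_test_integrals_zero)
      show "g \<in> borel_measurable borel" using g by simp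
      fix l u' :: "real^'a"
      obtain R where R: "cbox l u' \<subseteq> cball 0 R" using bounded_cbox[of l u'] by (auto simp: bounded_iff subset_eq)
      have "integrable lebesgue (\<lambda>x. indicator (cbox l u') x * g x)"
      proof (rule Bochner_Integration.integrable_bound)
        show "integrable lebesgue (\<lambda>x. norm (indicator (cball 0 R) x *\<^sub>R F x) + norm (indicator (cball 0 R) x *\<^sub>R H x))"
          using locally_integrableD(1)[OF lF] locally_integrableD(1)[OF lH] by (intro Bochner_Integration.integrable_add integrable_norm)
        show "(\<lambda>x. indicator (cbox l u') x * g x) \<in> borel_measurable lebesgue"
          using gm by (intro borel_measurable_times borel_measurable_indicator) auto
        show "AE x in lebesgue. norm (indicator (cbox l u') x * g x) \<le> norm (norm (indicator (cball 0 R) x *\<^sub>R F x) + norm (indicator (cball 0 R) x *\<^sub>R H x))"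
          using dg'
        proof eventually_elim
          case (elim x)
          have "\<bar>g x\<bar> \<le> norm (F x) + norm (H x)"
            using component_le_norm_cart[of "F x" i] component_le_norm_cart[of "H x" i] elim[symmetric] by simp
          then show ?case using R by (auto simp: indicator_def)
        qed
      qed
      then show "integrable lborel (\<lambda>x. indicator (cbox l u') x * g x)"
        by (subst (asm) integrable_completion) auto
    next
      fix \<phi> :: "real^'a \<Rightarrow> real" assume \<phi>: "test_function \<phi>"
      have \<phi>b[measurable]: "\<phi> \<in> borel_measurable borel" by (intro borel_measurable_continuous_onI test_functionD[OF \<phi>])
      then have \<phi>m: "\<phi> \<in> borel_measurable lebesgue" by (intro measurable_completion) simp
      have "(\<integral>x. g x * \<phi> x \<partial>lborel) = (LINT x|lebesgue. g x * \<phi> x)"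
        by (rule integral_completion[symmetric]) measurable
      also have "\<dots> = (LINT x|lebesgue. F x $ i * \<phi> x - H x $ i * \<phi> x)"
      proof (rule integral_cong_AE)
        show "(\<lambda>x. g x * \<phi> x) \<in> borel_measurable lebesgue" using gm \<phi>m by (rule borel_measurable_times)
        show "(\<lambda>x. F x $ i * \<phi> x - H x $ i * \<phi> x) \<in> borel_measurable lebesgue" using \<phi>m by measurable
        show "AE x in lebesgue. g x * \<phi> x = F x $ i * \<phi> x - H x $ i * \<phi> x"
          using dg' by eventually_elim (simp add: left_diff_distrib[symmetric])
      qed
      also have "\<dots> = (LINT x|lebesgue. F x $ i * \<phi> x) - (LINT x|lebesgue. H x $ i * \<phi> x)"
        by (intro Bochner_Integration.integral_diff locally_integrable_test lF lH \<phi>)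
      also have "\<dots> = 0"
      proof -
        have "(LINT x|lebesgue. u x * partial_deriv i \<phi> x) = - (LINT x|lebesgue. F x $ i * \<phi> x)"
          and "(LINT x|lebesgue. u x * partial_deriv i \<phi> x) = - (LINT x|lebesgue. H x $ i * \<phi> x)"
          using F H \<phi> unfolding has_weak_gradient_def by blast+
        then show ?thesis by simp
      qed
      finally show "(\<integral>x. g x * \<phi> x \<partial>lborel) = 0" .
    qed
    then have "AE x in lebesgue. g x = 0" by (rule AE_completion)
    with dg' show ?thesis by eventually_elim simp
  qed
  then have "AE x in lebesgue. \<forall>i. F x $ i - H x $ i = 0" by (simp add: AE_all_countable)
  then show ?thesis by eventually_elim (simp add: vec_eq_iff)
qed

lemma ennreal_scaled_le:
  fixes c l :: real and X :: ennreal
  assumes "0 < c" "0 \<le> l" "ennreal c * X \<le> ennreal l"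
  shows "X \<le> ennreal (l / c)"
proof (cases X)
  case (real x)
  then have "c * x \<le> l" using assms by (simp add: ennreal_mult[symmetric])
  then have "x \<le> l / c" using assms(1) by (simp add: field_simps)
  then show ?thesis using real by (simp add: ennreal_leI)
next
  case top
  then show ?thesis using assms by (simp add: ennreal_mult_top top_unique)
qed

theorem theorem2p3:
  fixes u :: "real^'n::finite \<Rightarrow> real" and p \<gamma> :: real and e :: "real^'n"
  assumes "1 \<le> p" and "-1 < \<gamma>" and "\<gamma> < 0" and "Lp p u" and "norm e = 1"
  shows "ennreal (K_const e p / (\<gamma> + 2 * p)) * Phi p u
           \<le> Limsup (at_right 0) (\<lambda>l. Phi_lam p \<gamma> l u) + Limsup at_top (\<lambda>l. Phi_lam p \<gamma> l u)
       \<and> (Limsup (at_right 0) (\<lambda>l. Phi_lam p \<gamma> l u) + Limsup at_top (\<lambda>l. Phi_lam p \<gamma> l u) < \<infinity>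
            \<longrightarrow> (p > 1 \<longrightarrow> sobolev_W1 p u) \<and> (p = 1 \<longrightarrow> BV u))"
proof (cases "Limsup (at_right 0) (\<lambda>l. Phi_lam p \<gamma> l u) + Limsup at_top (\<lambda>l. Phi_lam p \<gamma> l u)")
  case top
  show ?thesis unfolding top by simp
next
  case (real L)
  note p = assms(1) and \<gamma> = assms(2) and e = assms(5)
  have um: "u \<in> borel_measurable lebesgue" and uI: "integrable lebesgue (\<lambda>x. norm (u x) powr p)"
    using assms(4) by (auto simp: Lp_def)
  \<comment> \<open>Translations and convolutions are carried out for a Borel representative; u
    returns only in integrals and almost everywhere statements.\<close>
  obtain v where v: "v \<in> borel_measurable lborel" and uv: "AE x in lborel. u x = v x"
    using completion_ex_borel_measurable_real[OF um] by blast
  have vm[measurable]: "v \<in> borel_measurable borel" using v by simp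
  have vm': "v \<in> borel_measurable lebesgue" using v by (rule measurable_completion)
  have uv': "AE x in lebesgue. u x = v x" using uv by (rule AE_completion)
  have vp: "integrable lborel (\<lambda>x. norm (v x) powr p)"
  proof -
    have "integrable lebesgue (\<lambda>x. norm (v x) powr p)"
    proof (subst integrable_cong_AE)
      show "AE x in lebesgue. norm (v x) powr p = norm (u x) powr p" using uv' by eventually_elim simp
      show "(\<lambda>x. norm (v x) powr p) \<in> borel_measurable lebesgue" using vm' by simp
      show "(\<lambda>x. norm (u x) powr p) \<in> borel_measurable lebesgue" using um by simp
    qed (rule uI)
    then show ?thesis by (subst (asm) integrable_completion) auto
  qed
  have vI: "integrable lborel (\<lambda>x. indicator (cball 0 R) x * \<bar>v x\<bar>)" for R
    using integrable_cball_of_powr[OF p vm vp] by simp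
  have "e \<noteq> 0" using e by auto
  define c where "c = K_const e p / (\<gamma> + 2 * p)"
  have c: "0 < c" using K_const_pos[of p e] p \<gamma> \<open>e \<noteq> 0\<close> by (simp add: c_def)
  \<comment> \<open>One predicate holds all properties of the j-th approximation, so that a single
    choice over j yields kernel, gradient and bound together.\<close>
  define A :: "nat \<Rightarrow> (real^'n \<Rightarrow> real) \<Rightarrow> (real^'n \<Rightarrow> real^'n) \<Rightarrow> real \<Rightarrow> bool" where
    "A = (\<lambda>j \<rho> G B. (\<forall>z. 0 \<le> \<rho> z) \<and> integrable lborel \<rho> \<and> (\<integral>z. \<rho> z \<partial>lborel) = 1 \<and>
    (\<forall>z. inverse (real (Suc j)) < norm z \<longrightarrow> \<rho> z = 0) \<and>
    (\<forall>x. ((\<lambda>x. \<integral>z. \<rho> z * max (- real j) (min (real j) (v (x - z))) \<partial>lborel) has_derivative (\<lambda>h. G x \<bullet> h)) (at x)) \<and>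
    G \<in> borel_measurable borel \<and> (\<forall>x. norm (G x) \<le> B) \<and>
    ennreal c * (\<integral>\<^sup>+x. ennreal (norm (G x) powr p) \<partial>lborel) \<le> ennreal L)"
  have "\<exists>\<rho> G B. A j \<rho> G B" for j
  \<comment> \<open>Truncation level j and mollification radius 1/(j + 1) are tied to one index, so
    a single limit removes both.\<close>
  proof (rule mollified_gradient_bound[OF um vm uv p \<gamma> e, of "real j" "inverse (real (Suc j))"], goal_cases)
    case (3 \<rho> G B)
    then have "A j \<rho> G B" unfolding A_def c_def real(2)[symmetric] by blast
    then show ?case by blast
  qed simp_all
  then obtain \<rho> G B where A: "\<And>j. A j (\<rho> j) (G j) (B j)" by metis
  have \<rho>: "0 \<le> \<rho> j z" "integrable lborel (\<rho> j)" "(\<integral>z. \<rho> j z \<partial>lborel) = 1"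
      "inverse (real (Suc j)) < norm z \<Longrightarrow> \<rho> j z = 0"
    and D: "((\<lambda>x. \<integral>z. \<rho> j z * max (- real j) (min (real j) (v (x - z))) \<partial>lborel) has_derivative (\<lambda>h. G j x \<bullet> h)) (at x)"
    and Gm: "G j \<in> borel_measurable borel" and GB: "norm (G j x) \<le> B j"
    and GL: "ennreal c * (\<integral>\<^sup>+x. ennreal (norm (G j x) powr p) \<partial>lborel) \<le> ennreal L" for j x z
    using A[of j] unfolding A_def by blast+
  define w where "w = (\<lambda>j x. \<integral>z. \<rho> j z * max (- real j) (min (real j) (v (x - z))) \<partial>lborel)"
  have wd: "(w j has_derivative (\<lambda>h. G j x \<bullet> h)) (at x)" for j x unfolding w_def by (rule D)
  \<comment> \<open>An average of values in [-j, j]; the bound is used for integration by parts with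
    \<open>w j\<close>.\<close>
  have wb: "\<bar>w j x\<bar> \<le> real j" for j x
  proof -
    have [measurable]: "\<rho> j \<in> borel_measurable borel" using \<rho>(2)[of j] by auto
    have bd: "\<bar>\<rho> j z * max (- real j) (min (real j) (v (x - z)))\<bar> \<le> \<rho> j z * real j" for z
      using \<rho>(1)[of j z] by (auto simp: abs_mult intro!: mult_left_mono)
    have i1: "integrable lborel (\<lambda>z. \<rho> j z * real j)" using \<rho>(2)[of j] by simp
    then have i2: "integrable lborel (\<lambda>z. \<rho> j z * max (- real j) (min (real j) (v (x - z))))"
      by (rule Bochner_Integration.integrable_bound) (use bd in \<open>auto intro!: AE_I2 order_trans[OF bd]\<close>)
    have "\<bar>w j x\<bar> \<le> (\<integral>z. \<bar>\<rho> j z * max (- real j) (min (real j) (v (x - z)))\<bar> \<partial>lborel)"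
      unfolding w_def by (rule integral_abs_bound)
    also have "\<dots> \<le> (\<integral>z. \<rho> j z * real j \<partial>lborel)"
      by (rule integral_mono[OF integrable_abs[OF i2] i1 bd])
    finally have "\<bar>w j x\<bar> \<le> (\<integral>z. \<rho> j z * real j \<partial>lborel)" .
    then show ?thesis using \<rho>(3)[of j] by simp
  qed
  have lim: "(\<lambda>j. \<integral>x. w j x * \<psi> x \<partial>lborel) \<longlonglongrightarrow> (\<integral>x. v x * \<psi> x \<partial>lborel)"
    if "continuous_on UNIV \<psi>" "\<And>x. R < norm x \<Longrightarrow> \<psi> x = 0" for \<psi> R
    unfolding w_def by (rule truncated_mollifications_converge[OF vm vI \<rho> that])
  \<comment> \<open>Positivity of K and \<gamma> + 2p > 1 make c positive, so the energies of all
    \<open>G j\<close> have a common finite bound, which is moreover sharp enough for the claimed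
    inequality.\<close>
  define S where "S = L / c"
  have S0: "0 \<le> S" using c real(1) by (simp add: S_def)
  have GS: "(\<integral>\<^sup>+x. ennreal (norm (G j x) powr p) \<partial>lborel) \<le> ennreal S" for j
    unfolding S_def by (rule ennreal_scaled_le[OF c real(1) GL])
  have cS: "ennreal c * ennreal S = ennreal L" using c real(1) by (simp add: S_def ennreal_mult[symmetric])
  show ?thesis
  proof (cases "p = 1")
    case True
    have "total_variation u \<le> ennreal S"
      by (rule total_variation_le[OF um vm uv' wd wb GB Gm _ lim]) (use GS True in simp)
    moreover from this have "ennreal c * total_variation u \<le> ennreal L"
      using mult_left_mono[of _ _ "ennreal c"] cS by (metis zero_le)
    moreover have "total_variation u < \<infinity>"
      using \<open>total_variation u \<le> ennreal S\<close> by (rule order_le_less_trans) simp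
    ultimately show ?thesis using assms(4) True unfolding real(2) c_def by (simp add: Phi_def BV_def)
  next
    case False
    then have p1: "1 < p" using p by simp
    obtain H where Hm: "H \<in> borel_measurable borel" and HS: "(\<integral>\<^sup>+x. ennreal (norm (H x) powr p) \<partial>lborel) \<le> ennreal S"
      and Hw: "\<And>\<phi> :: real^'n \<Rightarrow> real. \<And>i. test_function \<phi> \<Longrightarrow> (\<integral>x. v x * partial_deriv i \<phi> x \<partial>lborel) = - (\<integral>x. H x $ i * \<phi> x \<partial>lborel)"
    proof (rule weak_gradient_limit[OF p1 S0 wd wb GB Gm GS lim], goal_cases)
      case (3 H)
      show thesis by (rule that[OF 3(2-)])
    qed auto
    note [measurable] = Hm
    have Hm': "H \<in> borel_measurable lebesgue" using Hm by (intro measurable_completion) simp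
    have Hp: "integrable lborel (\<lambda>x. norm (H x) powr p)"
      using order_le_less_trans[OF HS ennreal_less_top] by (intro integrableI_nonneg) auto
    have LpH: "Lp p H" unfolding Lp_def using Hm' Hp by (subst integrable_completion) auto
    have wg: "has_weak_gradient u H"
      unfolding has_weak_gradient_def
    proof (intro conjI allI impI)
      show "locally_integrable u" using vI by (intro locally_integrable_of_cball[OF um vm uv']) simp
      show "locally_integrable H"
        by (intro locally_integrable_of_cball[OF Hm' Hm] integrable_cball_of_powr[OF p Hm Hp]) simp
      fix \<phi> :: "real^'n \<Rightarrow> real" and i assume \<phi>: "test_function \<phi>"
      have [measurable]: "\<phi> \<in> borel_measurable borel" "partial_deriv i \<phi> \<in> borel_measurable borel"
        by (intro borel_measurable_continuous_onI test_functionD[OF \<phi>])+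
      then have pm: "partial_deriv i \<phi> \<in> borel_measurable lebesgue" by (intro measurable_completion) simp
      have "(LINT x|lebesgue. u x * partial_deriv i \<phi> x) = (LINT x|lebesgue. v x * partial_deriv i \<phi> x)"
      proof (rule integral_cong_AE)
        show "AE x in lebesgue. u x * partial_deriv i \<phi> x = v x * partial_deriv i \<phi> x" using uv' by eventually_elim simp
      qed (intro borel_measurable_times um vm' pm)+
      also have "\<dots> = (\<integral>x. v x * partial_deriv i \<phi> x \<partial>lborel)" by (rule integral_completion) measurable
      also have "\<dots> = - (\<integral>x. H x $ i * \<phi> x \<partial>lborel)" by (rule Hw[OF \<phi>])
      also have "(\<integral>x. H x $ i * \<phi> x \<partial>lborel) = (LINT x|lebesgue. H x $ i * \<phi> x)"
        by (rule integral_completion[symmetric]) measurable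
      finally show "(LINT x|lebesgue. u x * partial_deriv i \<phi> x) = - (LINT x|lebesgue. H x $ i * \<phi> x)" .
    qed
    have sob: "sobolev_W1 p u" unfolding sobolev_W1_def using assms(4) wg LpH by blast
    \<comment> \<open>H witnesses that the choice is legitimate; by uniqueness the chosen gradient
      agrees with H almost everywhere and inherits its energy bound.\<close>
    have "has_weak_gradient u (weak_gradient u)" unfolding weak_gradient_def by (rule someI[where P="has_weak_gradient u", OF wg])
    then have "AE x in lebesgue. weak_gradient u x = H x" by (rule weak_gradient_AE_unique[OF _ wg])
    then have "(\<integral>\<^sup>+x. ennreal (norm (weak_gradient u x) powr p) \<partial>lebesgue) = (\<integral>\<^sup>+x. ennreal (norm (H x) powr p) \<partial>lebesgue)"
      by (intro nn_integral_cong_AE, eventually_elim) simp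
    also have "\<dots> \<le> ennreal S" using HS by (simp add: nn_integral_completion)
    finally have "Phi p u \<le> ennreal S" using False sob by (simp add: Phi_def)
    then have "ennreal c * Phi p u \<le> ennreal L"
      using mult_left_mono[of _ _ "ennreal c"] cS by (metis zero_le)
    then show ?thesis using sob False unfolding real(2) c_def by simp
  qed
qed

end
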